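(* Let $(M,\kappa)$ be a connected symplectic manifold of dimension $2n$. Then the following statements are equivalent: (1) $(M,\kappa)$ admits a Kähler structure $(g,J)$ such that $\kappa(\cdot,\cdot)=g(J\cdot,\cdot)$; (2) there exists a field of endomorphisms $R$ of $TM$ that is $\kappa$-calibrated and satisfies $N_R\equiv 0$.
   Context: Everything is smooth. For a field of endomorphisms $R$ of $TM$, its Nijenhuis tensor is $$N_R(X,Y)=[RX,RY]+R^2[X,Y]-R[RX,Y]-R[X,RY].$$ $R$ is called $\kappa$-calibrated if $g:=\kappa(R\cdot,\cdot)$ is a Riemannian metric whose volume form (with respect to the orientation given by $\kappa^n$) satisfies $d\mu(g)=\frac{\kappa^n}{n!}$. A Kähler structure $(g,J)$ consists of a Riemannian metric $g$ and a field of endomorphisms $J$ of $TM$ such that $J^2=-\mathrm{Id}$, $N_J=0$, and $g(J\cdot,\cdot)$ is a closed (skew-symmetric) 2-form. *)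

theory Defs
  imports "HOL-Analysis.Analysis" "HOL-Library.Function_Algebras"
begin

section \<open>Smooth maps between open subsets of normed spaces\<close>

text \<open>Intended for open \<open>S\<close> in a finite-dimensional space; all iterated directional derivatives
  exist as Frechet derivatives and are continuous.\<close>

primrec Ck_on :: "nat \<Rightarrow> ('e::real_normed_vector \<Rightarrow> 'f::real_normed_vector) \<Rightarrow> 'e set \<Rightarrow> bool" where
  "Ck_on 0 f S \<longleftrightarrow> continuous_on S f"
| "Ck_on (Suc k) f S \<longleftrightarrow>
     (\<forall>x\<in>S. f differentiable (at x)) \<and>
     (\<forall>v. Ck_on k (\<lambda>x. frechet_derivative f (at x) v) S)"

definition smooth_on :: "('e::real_normed_vector \<Rightarrow> 'f::real_normed_vector) \<Rightarrow> 'e set \<Rightarrow> bool" where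
  "smooth_on f S \<longleftrightarrow> (\<forall>k. Ck_on k f S)"


section \<open>Smooth manifolds\<close>

datatype ('a, 'e) chart = Chart (cdom: "'a set") (cmap: "'a \<Rightarrow> 'e")

definition crange :: "('a, 'e) chart \<Rightarrow> 'e set" where
  "crange c = cmap c ` cdom c"

definition cinv :: "('a, 'e) chart \<Rightarrow> 'e \<Rightarrow> 'a" where
  "cinv c = inv_into (cdom c) (cmap c)"

definition transition :: "('a, 'e) chart \<Rightarrow> ('a, 'e) chart \<Rightarrow> 'e \<Rightarrow> 'e" where
  "transition c d = cmap d \<circ> cinv c"

definition chart_on :: "'a topology \<Rightarrow> ('a, 'e::euclidean_space) chart \<Rightarrow> bool" where
  "chart_on M c \<longleftrightarrow> openin M (cdom c) \<and> open (crange c) \<and>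
     homeomorphic_map (subtopology M (cdom c)) (top_of_set (crange c)) (cmap c)"

text \<open>The smooth structure is the one generated by \<open>A\<close>, which need not be a maximal atlas.\<close>

definition smooth_manifold :: "'a topology \<Rightarrow> ('a, 'e::euclidean_space) chart set \<Rightarrow> bool" where
  "smooth_manifold M A \<longleftrightarrow>
     Hausdorff_space M \<and> second_countable M \<and>
     (\<forall>c\<in>A. chart_on M c) \<and> (\<Union>c\<in>A. cdom c) = topspace M \<and>
     (\<forall>c\<in>A. \<forall>d\<in>A. smooth_on (transition c d) (cmap c ` (cdom c \<inter> cdom d)))"

definition charts_at :: "('a, 'e) chart set \<Rightarrow> 'a \<Rightarrow> ('a, 'e) chart set" where
  "charts_at A p = {c \<in> A. p \<in> cdom c}"


section \<open>Tangent vectors\<close>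

text \<open>A tangent vector at \<open>p\<close> is the family of its component vectors in all charts around \<open>p\<close>,
  related by the derivatives of the transition maps; it is zero by convention on all other charts,
  which makes tangent vectors closed under the pointwise operations.\<close>

type_synonym ('a, 'e) tvec = "('a, 'e) chart \<Rightarrow> 'e"

definition tangent_space :: "('a, 'e::euclidean_space) chart set \<Rightarrow> 'a \<Rightarrow> ('a, 'e) tvec set" where
  "tangent_space A p =
     {v. (\<forall>c. c \<notin> charts_at A p \<longrightarrow> v c = 0) \<and>
         (\<forall>c\<in>charts_at A p. \<forall>d\<in>charts_at A p.
            v d = frechet_derivative (transition c d) (at (cmap c p)) (v c))}"

definition tscale :: "real \<Rightarrow> ('a, 'e::real_vector) tvec \<Rightarrow> ('a, 'e) tvec" where
  "tscale a v = (\<lambda>c. a *\<^sub>R v c)"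

text \<open>The tangent vector at \<open>p\<close> with component vector \<open>e\<close> in the chart \<open>c\<close>; for basis vectors
  \<open>e\<close> these are the coordinate vector fields of \<open>c\<close>.\<close>

definition coord_vec ::
  "('a, 'e::euclidean_space) chart set \<Rightarrow> ('a, 'e) chart \<Rightarrow> 'a \<Rightarrow> 'e \<Rightarrow> ('a, 'e) tvec" where
  "coord_vec A c p e =
     (\<lambda>d. if d \<in> charts_at A p then frechet_derivative (transition c d) (at (cmap c p)) e else 0)"


section \<open>Vector fields, endomorphism fields and 2-tensors\<close>

definition vf_rep :: "('a, 'e) chart \<Rightarrow> ('a \<Rightarrow> ('a, 'e) tvec) \<Rightarrow> 'e \<Rightarrow> 'e" where
  "vf_rep c X = (\<lambda>x. X (cinv c x) c)"

definition vector_field_on ::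
  "('a, 'e::euclidean_space) chart set \<Rightarrow> 'a set \<Rightarrow> ('a \<Rightarrow> ('a, 'e) tvec) \<Rightarrow> bool" where
  "vector_field_on A W X \<longleftrightarrow>
     (\<forall>p\<in>W. X p \<in> tangent_space A p) \<and>
     (\<forall>c\<in>A. smooth_on (vf_rep c X) (cmap c ` (cdom c \<inter> W)))"

definition lie_bracket ::
  "('a, 'e::euclidean_space) chart set \<Rightarrow> ('a \<Rightarrow> ('a, 'e) tvec) \<Rightarrow> ('a \<Rightarrow> ('a, 'e) tvec)
    \<Rightarrow> 'a \<Rightarrow> ('a, 'e) tvec" where
  "lie_bracket A X Y p =
     (\<lambda>c. if c \<in> charts_at A p
          then frechet_derivative (vf_rep c Y) (at (cmap c p)) (X p c)
             - frechet_derivative (vf_rep c X) (at (cmap c p)) (Y p c)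
          else 0)"

definition endomorphism_field ::
  "'a topology \<Rightarrow> ('a, 'e::euclidean_space) chart set
    \<Rightarrow> ('a \<Rightarrow> ('a, 'e) tvec \<Rightarrow> ('a, 'e) tvec) \<Rightarrow> bool" where
  "endomorphism_field M A R \<longleftrightarrow>
     (\<forall>p\<in>topspace M. \<forall>v\<in>tangent_space A p. R p v \<in> tangent_space A p) \<and>
     (\<forall>p\<in>topspace M. \<forall>u\<in>tangent_space A p. \<forall>v\<in>tangent_space A p. \<forall>a b.
        R p (tscale a u + tscale b v) = tscale a (R p u) + tscale b (R p v)) \<and>
     (\<forall>c\<in>A. \<forall>e. smooth_on (\<lambda>x. R (cinv c x) (coord_vec A c (cinv c x) e) c) (crange c))"

definition nijenhuis ::
  "('a, 'e::euclidean_space) chart set \<Rightarrow> ('a \<Rightarrow> ('a, 'e) tvec \<Rightarrow> ('a, 'e) tvec)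
    \<Rightarrow> ('a \<Rightarrow> ('a, 'e) tvec) \<Rightarrow> ('a \<Rightarrow> ('a, 'e) tvec) \<Rightarrow> 'a \<Rightarrow> ('a, 'e) tvec" where
  "nijenhuis A R X Y p =
     (let RX = (\<lambda>q. R q (X q)); RY = (\<lambda>q. R q (Y q))
      in lie_bracket A RX RY p + R p (R p (lie_bracket A X Y p))
         - R p (lie_bracket A RX Y p) - R p (lie_bracket A X RY p))"

text \<open>Being a tensor, the Nijenhuis tensor is evaluated on vector fields defined on arbitrary open
  subsets (in particular on the whole manifold).\<close>

definition nijenhuis_zero ::
  "'a topology \<Rightarrow> ('a, 'e::euclidean_space) chart set
    \<Rightarrow> ('a \<Rightarrow> ('a, 'e) tvec \<Rightarrow> ('a, 'e) tvec) \<Rightarrow> bool" where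
  "nijenhuis_zero M A R \<longleftrightarrow>
     (\<forall>W X Y. openin M W \<and> vector_field_on A W X \<and> vector_field_on A W Y \<longrightarrow>
        (\<forall>p\<in>W. nijenhuis A R X Y p = 0))"

type_synonym ('a, 'e) two_tensor = "'a \<Rightarrow> ('a, 'e) tvec \<Rightarrow> ('a, 'e) tvec \<Rightarrow> real"

definition tensor_rep ::
  "('a, 'e::euclidean_space) chart set \<Rightarrow> ('a, 'e) chart \<Rightarrow> ('a, 'e) two_tensor
    \<Rightarrow> 'e \<Rightarrow> 'e \<Rightarrow> 'e \<Rightarrow> real" where
  "tensor_rep A c B x e f =
     B (cinv c x) (coord_vec A c (cinv c x) e) (coord_vec A c (cinv c x) f)"

definition smooth_two_tensor ::
  "'a topology \<Rightarrow> ('a, 'e::euclidean_space) chart set \<Rightarrow> ('a, 'e) two_tensor \<Rightarrow> bool" where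
  "smooth_two_tensor M A B \<longleftrightarrow>
     (\<forall>p\<in>topspace M. \<forall>u\<in>tangent_space A p. \<forall>v\<in>tangent_space A p. \<forall>w\<in>tangent_space A p. \<forall>a b.
        B p (tscale a u + tscale b v) w = a * B p u w + b * B p v w \<and>
        B p w (tscale a u + tscale b v) = a * B p w u + b * B p w v) \<and>
     (\<forall>c\<in>A. \<forall>e f. smooth_on (\<lambda>x. tensor_rep A c B x e f) (crange c))"

definition riemannian_metric ::
  "'a topology \<Rightarrow> ('a, 'e::euclidean_space) chart set \<Rightarrow> ('a, 'e) two_tensor \<Rightarrow> bool" where
  "riemannian_metric M A g \<longleftrightarrow> smooth_two_tensor M A g \<and>
     (\<forall>p\<in>topspace M. \<forall>u\<in>tangent_space A p. \<forall>v\<in>tangent_space A p. g p u v = g p v u) \<and>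
     (\<forall>p\<in>topspace M. \<forall>u\<in>tangent_space A p. u \<noteq> 0 \<longrightarrow> g p u u > 0)"

definition two_form ::
  "'a topology \<Rightarrow> ('a, 'e::euclidean_space) chart set \<Rightarrow> ('a, 'e) two_tensor \<Rightarrow> bool" where
  "two_form M A B \<longleftrightarrow> smooth_two_tensor M A B \<and>
     (\<forall>p\<in>topspace M. \<forall>u\<in>tangent_space A p. \<forall>v\<in>tangent_space A p. B p u v = - B p v u)"

text \<open>The exterior derivative of \<open>B\<close> at the point with coordinates \<open>x\<close>, evaluated on the
  (commuting) coordinate fields with constant components \<open>u\<close>, \<open>v\<close>, \<open>w\<close>.\<close>

definition ext_deriv_rep ::
  "('a, 'e::euclidean_space) chart set \<Rightarrow> ('a, 'e) chart \<Rightarrow> ('a, 'e) two_tensor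
    \<Rightarrow> 'e \<Rightarrow> 'e \<Rightarrow> 'e \<Rightarrow> 'e \<Rightarrow> real" where
  "ext_deriv_rep A c B x u v w =
     frechet_derivative (\<lambda>y. tensor_rep A c B y v w) (at x) u
   - frechet_derivative (\<lambda>y. tensor_rep A c B y u w) (at x) v
   + frechet_derivative (\<lambda>y. tensor_rep A c B y u v) (at x) w"

definition closed_two_form ::
  "'a topology \<Rightarrow> ('a, 'e::euclidean_space) chart set \<Rightarrow> ('a, 'e) two_tensor \<Rightarrow> bool" where
  "closed_two_form M A B \<longleftrightarrow> two_form M A B \<and>
     (\<forall>c\<in>A. \<forall>x\<in>crange c. \<forall>u v w. ext_deriv_rep A c B x u v w = 0)"

definition symplectic_form ::
  "'a topology \<Rightarrow> ('a, 'e::euclidean_space) chart set \<Rightarrow> ('a, 'e) two_tensor \<Rightarrow> bool" where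
  "symplectic_form M A B \<longleftrightarrow> closed_two_form M A B \<and>
     (\<forall>p\<in>topspace M. \<forall>u\<in>tangent_space A p.
        (\<forall>v\<in>tangent_space A p. B p u v = 0) \<longrightarrow> u = 0)"

definition kaehler_structure ::
  "'a topology \<Rightarrow> ('a, 'e::euclidean_space) chart set \<Rightarrow> ('a, 'e) two_tensor
    \<Rightarrow> ('a \<Rightarrow> ('a, 'e) tvec \<Rightarrow> ('a, 'e) tvec) \<Rightarrow> bool" where
  "kaehler_structure M A g J \<longleftrightarrow>
     riemannian_metric M A g \<and> endomorphism_field M A J \<and>
     (\<forall>p\<in>topspace M. \<forall>v\<in>tangent_space A p. J p (J p v) = - v) \<and>
     nijenhuis_zero M A J \<and>
     closed_two_form M A (\<lambda>p u v. g p (J p u) v)"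


section \<open>Exterior powers and volume forms\<close>

text \<open>An \<open>m\<close>-form on a vector space takes a sequence of vectors, of which only the first \<open>m\<close>
  matter. The normalisation of the wedge product is the one for which the wedge of the dual
  basis covectors has value 1 on the basis.\<close>

definition wedge ::
  "nat \<Rightarrow> nat \<Rightarrow> ((nat \<Rightarrow> 'v) \<Rightarrow> real) \<Rightarrow> ((nat \<Rightarrow> 'v) \<Rightarrow> real) \<Rightarrow> (nat \<Rightarrow> 'v) \<Rightarrow> real" where
  "wedge k l \<alpha> \<beta> v =
     (\<Sum>\<sigma> | \<sigma> permutes {..<k + l}.
        of_int (sign \<sigma>) * \<alpha> (\<lambda>i. v (\<sigma> i)) * \<beta> (\<lambda>i. v (\<sigma> (k + i)))) / (fact k * fact l)"

primrec wedge_power :: "('v \<Rightarrow> 'v \<Rightarrow> real) \<Rightarrow> nat \<Rightarrow> (nat \<Rightarrow> 'v) \<Rightarrow> real" where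
  "wedge_power \<omega> 0 = (\<lambda>v. 1)"
| "wedge_power \<omega> (Suc k) = wedge (2 * k) 2 (wedge_power \<omega> k) (\<lambda>v. \<omega> (v 0) (v 1))"

definition alternating_form ::
  "('a, 'e::euclidean_space) tvec set \<Rightarrow> nat \<Rightarrow> ((nat \<Rightarrow> ('a, 'e) tvec) \<Rightarrow> real) \<Rightarrow> bool" where
  "alternating_form V m \<mu> \<longleftrightarrow>
     (\<forall>v w. (\<forall>i<m. v i = w i) \<longrightarrow> \<mu> v = \<mu> w) \<and>
     (\<forall>v i. (\<forall>j<m. v j \<in> V) \<and> i < m \<longrightarrow> (\<forall>x\<in>V. \<forall>y\<in>V. \<forall>a b.
        \<mu> (v(i := tscale a x + tscale b y)) = a * \<mu> (v(i := x)) + b * \<mu> (v(i := y)))) \<and>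
     (\<forall>v i j. (\<forall>k<m. v k \<in> V) \<and> i < j \<and> j < m \<and> v i = v j \<longrightarrow> \<mu> v = 0)"

text \<open>\<open>\<mu>\<close> is the volume form on the \<open>m\<close>-dimensional space \<open>V\<close> of the inner product \<open>g\<close>, where a
  basis is positively oriented if the top-degree form \<open>\<omega>\<close> is positive on it.\<close>

definition is_volume_form ::
  "('a, 'e::euclidean_space) tvec set \<Rightarrow> nat \<Rightarrow> (('a, 'e) tvec \<Rightarrow> ('a, 'e) tvec \<Rightarrow> real)
    \<Rightarrow> ((nat \<Rightarrow> ('a, 'e) tvec) \<Rightarrow> real) \<Rightarrow> ((nat \<Rightarrow> ('a, 'e) tvec) \<Rightarrow> real) \<Rightarrow> bool" where
  "is_volume_form V m g \<omega> \<mu> \<longleftrightarrow> alternating_form V m \<mu> \<and>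
     (\<forall>v. (\<forall>i<m. v i \<in> V) \<and> (\<forall>i<m. \<forall>j<m. g (v i) (v j) = (if i = j then 1 else 0)) \<and> \<omega> v > 0
        \<longrightarrow> \<mu> v = 1)"

definition calibrated ::
  "'a topology \<Rightarrow> ('a, 'e::euclidean_space) chart set \<Rightarrow> nat \<Rightarrow> ('a, 'e) two_tensor
    \<Rightarrow> ('a \<Rightarrow> ('a, 'e) tvec \<Rightarrow> ('a, 'e) tvec) \<Rightarrow> bool" where
  "calibrated M A n \<kappa> R \<longleftrightarrow>
     riemannian_metric M A (\<lambda>p u v. \<kappa> p (R p u) v) \<and>
     (\<forall>p\<in>topspace M.
        is_volume_form (tangent_space A p) (2 * n) (\<lambda>u v. \<kappa> p (R p u) v)
          (wedge_power (\<kappa> p) n) (\<lambda>v. wedge_power (\<kappa> p) n v / fact n))"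

end

theory Submission
  imports Defs "HOL-Computational_Algebra.Polynomial"
begin

text \<open>Both directions compare \<open>R\<close> with a complex structure. If \<open>\<kappa> = g(J \<cdot>, \<cdot>)\<close> is Kaehler, take
\<open>R = - J\<close>: then \<open>\<kappa>(R \<cdot>, \<cdot>) = g\<close> and \<open>N\<^sub>R = N\<^sub>J = 0\<close>. What remains is that \<open>\<kappa>\<^sup>n / n!\<close> is the volume form
of \<open>g\<close>. A power of a 2-form takes the value \<open>n!\<close> on a symplectic frame, and every \<open>J\<close>-unitary frame is
one; two orthonormal frames are related by an orthogonal matrix, so an alternating form of top degree
takes the same value on both up to a sign (\<open>wedge_power_orthonormal\<close>).

Conversely let \<open>g = \<kappa>(R \<cdot>, \<cdot>)\<close> be a metric and \<open>N\<^sub>R = 0\<close>. The skew-symmetry of \<open>\<kappa>\<close> and the symmetry of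
\<open>g\<close> make \<open>R\<close> skew-adjoint for \<open>g\<close>, so the traces of the odd powers of \<open>R\<close> vanish. Tracing the equation
\<open>N\<^sub>R = 0\<close> gives the classical recursion
\<open>d tr(R\<^sup>k\<^sup>+\<^sup>1) / (k + 1) = d tr(R\<^sup>k) / k \<circ> R\<close> (\<open>endo_trace_recursion\<close>), and with \<open>k\<close> odd the right-hand
side is zero. Hence the traces of all powers of \<open>R\<close> are locally constant.

For the positive self-adjoint field \<open>S = - R\<^sup>2\<close>, the spectral theorem at one point provides a real
polynomial \<open>h\<close> with \<open>S h(S)\<^sup>4 = 1\<close> there (\<open>inverse_fourth_root_polynomial\<close>). The same \<open>h\<close> works near
that point: \<open>T = S h(S)\<^sup>4 - 1\<close> is self-adjoint, the trace of \<open>T\<^sup>2\<close> is a combination of traces of powers of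
\<open>R\<close>, hence constant, hence zero, and a self-adjoint endomorphism whose square has trace zero vanishes.
As \<open>M\<close> is connected, \<open>h\<close> works everywhere. So \<open>J = - R h(S)\<^sup>2\<close> is a polynomial in \<open>R\<close> with constant
coefficients and \<open>J\<^sup>2 = -1\<close>. It is the unitary part of the polar decomposition of \<open>R\<close>, up to sign, and
the vanishing of the Nijenhuis tensor passes from \<open>R\<close> to every such polynomial
(\<open>nijenhuis_zero_tpoly\<close>). Finally \<open>\<kappa>(- J u, v) = g(h(S) u, h(S) v)\<close> is a metric, and \<open>\<kappa>\<close> is its
fundamental form with respect to \<open>J\<close>.

Tensors are handled through their components in one chart at a time. Whether a bracket of vector
fields is again a tangent vector, that is, transforms correctly between charts, rests on the symmetry
of second derivatives.\<close>

section \<open>Calculus of smooth maps\<close>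

lemma frechet_derivativeI:
  "(f has_derivative f') (at x) \<Longrightarrow> frechet_derivative f (at x) = f'"
  by (rule frechet_derivative_at[symmetric])

text \<open>Openness matters: only then do the values of a map on \<open>S\<close> determine its derivatives on \<open>S\<close>.\<close>

lemma Ck_on_cong:
  assumes "open S" "\<And>x. x \<in> S \<Longrightarrow> f x = g x" "Ck_on k f S"
  shows "Ck_on k g S"
  using assms(2,3)
proof (induction k arbitrary: f g)
  case 0
  then show ?case using continuous_on_cong by (metis Ck_on.simps(1))
next
  case (Suc k)
  have d: "g differentiable (at x)" "frechet_derivative f (at x) = frechet_derivative g (at x)"
    if "x \<in> S" for x
  proof -
    have "f differentiable (at x)" using Suc.prems that by simp
    then show "frechet_derivative f (at x) = frechet_derivative g (at x)"
      using frechet_derivative_transform_within_open[OF _ assms(1) that] Suc.prems(1) by blast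
    show "g differentiable (at x)"
      using \<open>f differentiable (at x)\<close> assms(1) that Suc.prems(1)
      unfolding differentiable_def by (meson has_derivative_transform_within_open)
  qed
  have "Ck_on k (\<lambda>x. frechet_derivative g (at x) v) S" for v
    using Suc.IH[of "\<lambda>x. frechet_derivative f (at x) v"] Suc.prems(2) d(2) by simp
  then show ?case using d by simp
qed

lemma Ck_on_subset: "Ck_on k f S \<Longrightarrow> T \<subseteq> S \<Longrightarrow> Ck_on k f T"
  by (induction k arbitrary: f) (auto intro: continuous_on_subset)

lemma Ck_on_SucD: "Ck_on (Suc k) f S \<Longrightarrow> Ck_on k f S"
proof (induction k arbitrary: f)
  case 0
  then show ?case
    by (auto intro!: continuous_at_imp_continuous_on differentiable_imp_continuous_within)
next
  case (Suc k)
  then show ?case by (metis Ck_on.simps(2))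
qed

lemma Ck_on_Suc_I:
  assumes "open S" "\<And>x. x \<in> S \<Longrightarrow> (f has_derivative f' x) (at x)"
    and "\<And>v. Ck_on k (\<lambda>x. f' x v) S"
  shows "Ck_on (Suc k) f S"
proof -
  have "Ck_on k (\<lambda>x. frechet_derivative f (at x) v) S" for v
    by (rule Ck_on_cong[OF assms(1) _ assms(3)[of v]]) (simp add: frechet_derivativeI[OF assms(2)])
  then show ?thesis using assms(2) by (auto simp: differentiable_def)
qed

lemma Ck_on_const: "open S \<Longrightarrow> Ck_on k (\<lambda>x. c) S"
  by (induction k arbitrary: c) auto

lemma Ck_on_linear_comp:
  assumes "open S" "bounded_linear L" "Ck_on k f S"
  shows "Ck_on k (\<lambda>x. L (f x)) S"
  using assms(3)
proof (induction k arbitrary: f)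
  case 0
  then show ?case using bounded_linear.continuous_on[OF assms(2)] by auto
next
  case (Suc k)
  show ?case
  proof (rule Ck_on_Suc_I[OF assms(1)])
    show "((\<lambda>x. L (f x)) has_derivative (\<lambda>v. L (frechet_derivative f (at x) v))) (at x)"
      if "x \<in> S" for x
      using Suc.prems that bounded_linear.has_derivative[OF assms(2)]
      by (auto simp: frechet_derivative_works)
    show "Ck_on k (\<lambda>x. L (frechet_derivative f (at x) v)) S" for v
      using Suc by simp
  qed
qed

lemma Ck_on_add:
  assumes "open S" "Ck_on k f S" "Ck_on k g S"
  shows "Ck_on k (\<lambda>x. f x + g x) S"
  using assms(2,3)
proof (induction k arbitrary: f g)
  case 0
  then show ?case by (auto intro: continuous_on_add)
next
  case (Suc k)
  show ?case
  proof (rule Ck_on_Suc_I[OF assms(1)])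
    show "((\<lambda>x. f x + g x) has_derivative
        (\<lambda>v. frechet_derivative f (at x) v + frechet_derivative g (at x) v)) (at x)"
      if "x \<in> S" for x
      using Suc.prems that by (auto simp: frechet_derivative_works intro: has_derivative_add)
  qed (use Suc in simp)
qed

lemma Ck_on_sum:
  assumes "open S" "\<And>i. i \<in> I \<Longrightarrow> Ck_on k (f i) S"
  shows "Ck_on k (\<lambda>x. \<Sum>i\<in>I. f i x) S"
  using assms(2)
  by (induction I rule: infinite_finite_induct) (auto intro: Ck_on_const Ck_on_add assms(1))

lemma Ck_on_bilinear:
  assumes "open S" "bounded_bilinear B" "Ck_on k f S" "Ck_on k g S"
  shows "Ck_on k (\<lambda>x. B (f x) (g x)) S"
  using assms(3,4)
proof (induction k arbitrary: f g)
  case 0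
  then show ?case by (auto intro: bounded_bilinear.continuous_on[OF assms(2)])
next
  case (Suc k)
  show ?case
  proof (rule Ck_on_Suc_I[OF assms(1)])
    show "((\<lambda>x. B (f x) (g x)) has_derivative
        (\<lambda>v. B (f x) (frechet_derivative g (at x) v) + B (frechet_derivative f (at x) v) (g x))) (at x)"
      if "x \<in> S" for x
      using Suc.prems that
      by (intro bounded_bilinear.FDERIV[OF assms(2)]) (simp_all add: frechet_derivative_works)
    show "Ck_on k (\<lambda>x. B (f x) (frechet_derivative g (at x) v) + B (frechet_derivative f (at x) v) (g x)) S"
      for v
      using Suc.prems Ck_on_SucD[OF Suc.prems(1)] Ck_on_SucD[OF Suc.prems(2)]
      by (intro Ck_on_add assms(1) Suc.IH) simp_all
  qed
qed

text \<open>The chain rule is written in coordinates because the induction hypothesis covers the derivative of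
\<open>f\<close> only in fixed directions; the varying direction is absorbed into the components of the derivative
of \<open>g\<close>.\<close>

lemma Ck_on_compose:
  fixes g :: "'d::real_normed_vector \<Rightarrow> 'e::euclidean_space"
  assumes "open S" "open T" "g ` S \<subseteq> T" "Ck_on k f T" "Ck_on k g S"
  shows "Ck_on k (\<lambda>x. f (g x)) S"
  using assms(4,5)
proof (induction k arbitrary: f)
  case 0
  then show ?case using assms(3) by (auto intro: continuous_on_compose2)
next
  case (Suc k)
  let ?D = "\<lambda>x v. \<Sum>b\<in>Basis. (frechet_derivative g (at x) v \<bullet> b) *\<^sub>R frechet_derivative f (at (g x)) b"
  show ?case
  proof (rule Ck_on_Suc_I[OF assms(1)])
    fix x assume x: "x \<in> S"
    then have gx: "g x \<in> T" using assms(3) by auto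
    have df: "(f has_derivative frechet_derivative f (at (g x))) (at (g x))"
      using Suc.prems(1) gx by (simp add: frechet_derivative_works)
    have dg: "(g has_derivative frechet_derivative g (at x)) (at x)"
      using Suc.prems(2) x by (simp add: frechet_derivative_works)
    interpret f: bounded_linear "frechet_derivative f (at (g x))"
      using df by (rule has_derivative_bounded_linear)
    have "frechet_derivative f (at (g x)) (frechet_derivative g (at x) v) = ?D x v" for v
      by (subst (1) euclidean_representation[symmetric]) (simp only: f.sum f.scaleR)
    then show "((\<lambda>x. f (g x)) has_derivative (\<lambda>v. ?D x v)) (at x)"
      using has_derivative_compose[OF dg df] by simp
  next
    fix v
    have "Ck_on k (\<lambda>x. frechet_derivative g (at x) v \<bullet> b) S" for b
      using Suc.prems(2) by (auto intro: Ck_on_linear_comp assms(1) bounded_linear_inner_left)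
    moreover have "Ck_on k (\<lambda>x. frechet_derivative f (at (g x)) b) S" for b
      using Suc.prems(1) Ck_on_SucD[OF Suc.prems(2)]
      by (intro Suc.IH[of "\<lambda>y. frechet_derivative f (at y) b"]) simp_all
    ultimately show "Ck_on k (\<lambda>x. ?D x v) S"
      by (intro Ck_on_sum assms(1) Ck_on_bilinear[OF assms(1) bounded_bilinear_scaleR])
  qed
qed

lemma smooth_on_cong:
  "open S \<Longrightarrow> (\<And>x. x \<in> S \<Longrightarrow> f x = g x) \<Longrightarrow> smooth_on f S \<Longrightarrow> smooth_on g S"
  unfolding smooth_on_def by (metis Ck_on_cong)

lemma smooth_on_subset: "smooth_on f S \<Longrightarrow> T \<subseteq> S \<Longrightarrow> smooth_on f T"
  unfolding smooth_on_def by (metis Ck_on_subset)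

lemma smooth_on_const: "open S \<Longrightarrow> smooth_on (\<lambda>x. c) S"
  unfolding smooth_on_def by (metis Ck_on_const)

lemma smooth_on_linear_comp:
  "open S \<Longrightarrow> bounded_linear L \<Longrightarrow> smooth_on f S \<Longrightarrow> smooth_on (\<lambda>x. L (f x)) S"
  unfolding smooth_on_def by (metis Ck_on_linear_comp)

lemma smooth_on_add:
  "open S \<Longrightarrow> smooth_on f S \<Longrightarrow> smooth_on g S \<Longrightarrow> smooth_on (\<lambda>x. f x + g x) S"
  unfolding smooth_on_def by (metis Ck_on_add)

lemma smooth_on_sum:
  "open S \<Longrightarrow> (\<And>i. i \<in> I \<Longrightarrow> smooth_on (f i) S) \<Longrightarrow> smooth_on (\<lambda>x. \<Sum>i\<in>I. f i x) S"
  unfolding smooth_on_def by (simp add: Ck_on_sum)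

lemma smooth_on_scaleR:
  "open S \<Longrightarrow> smooth_on f S \<Longrightarrow> smooth_on g S \<Longrightarrow> smooth_on (\<lambda>x. f x *\<^sub>R g x) S"
  unfolding smooth_on_def using Ck_on_bilinear bounded_bilinear_scaleR by blast

lemma smooth_on_mult:
  fixes f g :: "_ \<Rightarrow> real"
  shows "open S \<Longrightarrow> smooth_on f S \<Longrightarrow> smooth_on g S \<Longrightarrow> smooth_on (\<lambda>x. f x * g x) S"
  unfolding smooth_on_def using Ck_on_bilinear bounded_bilinear_mult by blast

lemma smooth_on_inner_const:
  "open S \<Longrightarrow> smooth_on f S \<Longrightarrow> smooth_on (\<lambda>x. f x \<bullet> b) S"
  by (rule smooth_on_linear_comp[OF _ bounded_linear_inner_left])

lemma smooth_on_compose: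
  fixes g :: "'d::real_normed_vector \<Rightarrow> 'e::euclidean_space"
  shows "open S \<Longrightarrow> open T \<Longrightarrow> g ` S \<subseteq> T \<Longrightarrow> smooth_on f T \<Longrightarrow> smooth_on g S \<Longrightarrow>
    smooth_on (\<lambda>x. f (g x)) S"
  unfolding smooth_on_def by (metis Ck_on_compose)

lemma smooth_on_frechet_derivative:
  "smooth_on f S \<Longrightarrow> smooth_on (\<lambda>x. frechet_derivative f (at x) v) S"
  unfolding smooth_on_def by (metis Ck_on.simps(2))

lemma smooth_on_differentiable:
  "smooth_on f S \<Longrightarrow> x \<in> S \<Longrightarrow> f differentiable (at x)"
  unfolding smooth_on_def by (metis Ck_on.simps(2))

lemma smooth_on_has_derivative:
  "smooth_on f S \<Longrightarrow> x \<in> S \<Longrightarrow> (f has_derivative frechet_derivative f (at x)) (at x)"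
  using smooth_on_differentiable frechet_derivative_works by blast

lemma smooth_on_continuous: "smooth_on f S \<Longrightarrow> continuous_on S f"
  unfolding smooth_on_def by (metis Ck_on.simps(1))

text \<open>The mean value theorem along \<open>u\<close>, applied to the difference of \<open>f\<close> over a step in the direction \<open>v\<close>,
and then along \<open>v\<close>.\<close>

lemma double_difference_mean_value:
  fixes f :: "'e::real_normed_vector \<Rightarrow> real"
  assumes "smooth_on f S" "0 < h"
    and in_S: "\<And>s t. 0 \<le> s \<Longrightarrow> s \<le> h \<Longrightarrow> 0 \<le> t \<Longrightarrow> t \<le> h \<Longrightarrow> x + s *\<^sub>R u + t *\<^sub>R v \<in> S"
  shows "\<exists>s t. 0 < s \<and> s < h \<and> 0 < t \<and> t < h \<and>
    f (x + h *\<^sub>R u + h *\<^sub>R v) - f (x + h *\<^sub>R u) - f (x + h *\<^sub>R v) + f x =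
      h * (h * frechet_derivative (\<lambda>y. frechet_derivative f (at y) u) (at (x + s *\<^sub>R u + t *\<^sub>R v)) v)"
proof -
  let ?F = "\<lambda>s. f (x + s *\<^sub>R u + h *\<^sub>R v) - f (x + s *\<^sub>R u)"
  let ?G = "\<lambda>y. frechet_derivative f (at y) u"
  have path: "((\<lambda>s. \<phi> (a + s *\<^sub>R w)) has_real_derivative frechet_derivative \<phi> (at (a + s *\<^sub>R w)) w) (at s)"
    if "smooth_on \<phi> S" "a + s *\<^sub>R w \<in> S" for \<phi> :: "'e \<Rightarrow> real" and a w s
  proof -
    have d: "(\<phi> has_derivative frechet_derivative \<phi> (at (a + s *\<^sub>R w))) (at (a + s *\<^sub>R w))"
      using smooth_on_has_derivative that by blast
    have "((\<lambda>s. a + s *\<^sub>R w) has_derivative (\<lambda>r. r *\<^sub>R w)) (at s)"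
      by (auto intro!: derivative_eq_intros)
    from has_derivative_compose[OF this d]
    have "((\<lambda>s. \<phi> (a + s *\<^sub>R w)) has_derivative
        (\<lambda>r. r * frechet_derivative \<phi> (at (a + s *\<^sub>R w)) w)) (at s)"
      using linear_frechet_derivative[OF smooth_on_differentiable[OF that]] by (simp add: linear_cmul)
    then show ?thesis
      unfolding has_field_derivative_def
      by (rule has_derivative_eq_rhs) (simp add: fun_eq_iff)
  qed
  have dF: "(?F has_real_derivative ?G ((x + h *\<^sub>R v) + s *\<^sub>R u) - ?G (x + s *\<^sub>R u)) (at s)"
    if "0 \<le> s" "s \<le> h" for s
  proof -
    have "(x + h *\<^sub>R v) + s *\<^sub>R u \<in> S" "x + s *\<^sub>R u \<in> S"
      using in_S[of s h] in_S[of s 0] that assms(2) by (auto simp: add_ac)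
    from DERIV_diff[OF path[OF assms(1) this(1)] path[OF assms(1) this(2)]]
    show ?thesis by (simp add: add_ac)
  qed
  obtain s where s: "0 < s" "s < h"
    "?F h - ?F 0 = (h - 0) * (?G ((x + h *\<^sub>R v) + s *\<^sub>R u) - ?G (x + s *\<^sub>R u))"
    using MVT2[of 0 h ?F, OF assms(2) dF] by blast
  have dG: "((\<lambda>t. ?G ((x + s *\<^sub>R u) + t *\<^sub>R v)) has_real_derivative
      frechet_derivative ?G (at ((x + s *\<^sub>R u) + t *\<^sub>R v)) v) (at t)" if "0 \<le> t" "t \<le> h" for t
    using path[OF smooth_on_frechet_derivative[OF assms(1)]] in_S[of s t] that s by simp
  obtain t where t: "0 < t" "t < h"
    "?G ((x + s *\<^sub>R u) + h *\<^sub>R v) - ?G ((x + s *\<^sub>R u) + 0 *\<^sub>R v) =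
      (h - 0) * frechet_derivative ?G (at ((x + s *\<^sub>R u) + t *\<^sub>R v)) v"
    using MVT2[of 0 h "\<lambda>t. ?G ((x + s *\<^sub>R u) + t *\<^sub>R v)", OF assms(2) dG] by blast
  show ?thesis
    by (intro exI[of _ s] exI[of _ t] conjI s(1,2) t(1,2)) (use s(3) t(3) in \<open>simp add: add_ac\<close>)
qed

text \<open>The double difference is symmetric in \<open>u\<close> and \<open>v\<close>. Divided by \<open>h\<^sup>2\<close> it equals either mixed derivative
at suitable points near \<open>x\<close>, and both are continuous.\<close>

lemma second_derivative_symmetric_real:
  fixes f :: "'e::real_normed_vector \<Rightarrow> real"
  assumes "open S" "smooth_on f S" "x \<in> S"
  shows "frechet_derivative (\<lambda>y. frechet_derivative f (at y) u) (at x) v =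
         frechet_derivative (\<lambda>y. frechet_derivative f (at y) v) (at x) u"
proof -
  let ?H = "\<lambda>u v y. frechet_derivative (\<lambda>y. frechet_derivative f (at y) u) (at y) v"
  have cont: "continuous_on S (?H u v)" for u v
    by (intro smooth_on_continuous smooth_on_frechet_derivative assms)
  obtain r where r: "r > 0" "ball x r \<subseteq> S" using assms by (meson openE)
  \<comment> \<open>The summand 1 keeps \<open>K\<close> positive and the estimate below strict.\<close>
  define K where "K = norm u + norm v + 1"
  have K: "K > 0" unfolding K_def by (smt (verit) norm_ge_zero)
  have near: "dist x (x + s *\<^sub>R u + t *\<^sub>R v) < h * K"
    if "0 \<le> s" "s \<le> h" "0 \<le> t" "t \<le> h" "0 < h" for s t h
  proof -
    have "norm (s *\<^sub>R u + t *\<^sub>R v) \<le> h * norm u + h * norm v"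
      using that by (intro norm_triangle_le) (auto intro!: add_mono mult_right_mono)
    then have "norm (s *\<^sub>R u + t *\<^sub>R v) < h * K"
      using that(5) unfolding K_def by (simp add: algebra_simps)
    moreover have "dist x (x + s *\<^sub>R u + t *\<^sub>R v) = norm (s *\<^sub>R u + t *\<^sub>R v)"
      by (metis add.assoc add_diff_cancel_left' dist_commute dist_norm)
    ultimately show ?thesis by simp
  qed
  show ?thesis
  proof (rule ccontr)
    assume ne: "?H u v x \<noteq> ?H v u x"
    define e where "e = \<bar>?H u v x - ?H v u x\<bar> / 2"
    have e: "e > 0" using ne e_def by simp
    obtain d1 where d1: "d1 > 0" "\<And>y. y \<in> S \<Longrightarrow> dist y x < d1 \<Longrightarrow> \<bar>?H u v y - ?H u v x\<bar> < e"
      using cont[of u v] assms(3) e unfolding continuous_on_iff dist_real_def by blast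
    obtain d2 where d2: "d2 > 0" "\<And>y. y \<in> S \<Longrightarrow> dist y x < d2 \<Longrightarrow> \<bar>?H v u y - ?H v u x\<bar> < e"
      using cont[of v u] assms(3) e unfolding continuous_on_iff dist_real_def by blast
    define h where "h = min r (min d1 d2) / K"
    have h: "h > 0" "h * K \<le> r" "h * K \<le> d1" "h * K \<le> d2"
      using K r(1) d1(1) d2(1) by (auto simp: h_def)
    have in1: "x + s *\<^sub>R u + t *\<^sub>R v \<in> ball x r" if "0 \<le> s" "s \<le> h" "0 \<le> t" "t \<le> h" for s t
      using near[OF that h(1)] h(2) by simp
    then have in2: "x + s *\<^sub>R v + t *\<^sub>R u \<in> ball x r" if "0 \<le> s" "s \<le> h" "0 \<le> t" "t \<le> h" for s t
      using in1[of t s] that by (simp add: add.assoc add.commute[of "s *\<^sub>R v"])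
    have sm: "smooth_on f (ball x r)" using assms(2) r(2) smooth_on_subset by blast
    obtain s t where st: "0 < s" "s < h" "0 < t" "t < h"
      "f (x + h *\<^sub>R u + h *\<^sub>R v) - f (x + h *\<^sub>R u) - f (x + h *\<^sub>R v) + f x =
        h * (h * ?H u v (x + s *\<^sub>R u + t *\<^sub>R v))"
      using double_difference_mean_value[OF sm h(1) in1] by blast
    obtain s' t' where st': "0 < s'" "s' < h" "0 < t'" "t' < h"
      "f (x + h *\<^sub>R v + h *\<^sub>R u) - f (x + h *\<^sub>R v) - f (x + h *\<^sub>R u) + f x =
        h * (h * ?H v u (x + s' *\<^sub>R v + t' *\<^sub>R u))"
      using double_difference_mean_value[OF sm h(1) in2] by blast
    have "x + h *\<^sub>R v + h *\<^sub>R u = x + h *\<^sub>R u + h *\<^sub>R v" by simp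
    with st(5) st'(5) h(1) have eq: "?H u v (x + s *\<^sub>R u + t *\<^sub>R v) = ?H v u (x + s' *\<^sub>R v + t' *\<^sub>R u)"
      by (smt (verit) mult_cancel_left)
    have "x + s *\<^sub>R u + t *\<^sub>R v \<in> S" "dist (x + s *\<^sub>R u + t *\<^sub>R v) x < d1"
      using in1[of s t] near[of s h t] st h r(2) by (auto simp: dist_commute)
    then have 1: "\<bar>?H u v (x + s *\<^sub>R u + t *\<^sub>R v) - ?H u v x\<bar> < e" using d1 by blast
    have swap: "x + s' *\<^sub>R v + t' *\<^sub>R u = x + t' *\<^sub>R u + s' *\<^sub>R v" by simp
    have "x + s' *\<^sub>R v + t' *\<^sub>R u \<in> S" "dist (x + s' *\<^sub>R v + t' *\<^sub>R u) x < d2"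
      using in1[of t' s'] near[of t' h s'] st' h r(2) unfolding swap by (auto simp: dist_commute)
    then have 2: "\<bar>?H v u (x + s' *\<^sub>R v + t' *\<^sub>R u) - ?H v u x\<bar> < e" using d2 by blast
    have "\<bar>a - p\<bar> < \<bar>p - q\<bar> / 2 \<Longrightarrow> \<bar>b - q\<bar> < \<bar>p - q\<bar> / 2 \<Longrightarrow> a \<noteq> b" for a b p q :: real
      by (auto simp: abs_if split: if_splits)
    then show False using 1 2 eq unfolding e_def by blast
  qed
qed

lemma second_derivative_symmetric:
  fixes f :: "'e::real_normed_vector \<Rightarrow> 'f::euclidean_space"
  assumes "open S" "smooth_on f S" "x \<in> S"
  shows "frechet_derivative (\<lambda>y. frechet_derivative f (at y) u) (at x) v =
         frechet_derivative (\<lambda>y. frechet_derivative f (at y) v) (at x) u"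
proof (rule euclidean_eqI)
  fix b :: 'f
  let ?f = "\<lambda>x. f x \<bullet> b"
  have D: "frechet_derivative (\<lambda>x. \<phi> x \<bullet> b) (at y) w = frechet_derivative \<phi> (at y) w \<bullet> b"
    if "smooth_on \<phi> S" "y \<in> S" for \<phi> :: "'e \<Rightarrow> 'f" and y w
    using frechet_derivativeI[OF has_derivative_inner_left[OF smooth_on_has_derivative[OF that]]]
    by (rule fun_cong)
  have "frechet_derivative (\<lambda>y. frechet_derivative ?f (at y) u) (at x) v =
      frechet_derivative (\<lambda>y. frechet_derivative f (at y) u) (at x) v \<bullet> b" for u v
  proof -
    have "frechet_derivative (\<lambda>y. frechet_derivative ?f (at y) u) (at x) =
        frechet_derivative (\<lambda>y. frechet_derivative f (at y) u \<bullet> b) (at x)"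
      by (rule frechet_derivative_transform_within_open[OF _ assms(1,3)])
        (auto simp: D[OF assms(2)] intro!: smooth_on_differentiable[OF smooth_on_frechet_derivative]
           smooth_on_inner_const assms)
    then show ?thesis by (simp add: D[OF smooth_on_frechet_derivative[OF assms(2)] assms(3)])
  qed
  from this[of u v] this[of v u]
  show "frechet_derivative (\<lambda>y. frechet_derivative f (at y) u) (at x) v \<bullet> b =
      frechet_derivative (\<lambda>y. frechet_derivative f (at y) v) (at x) u \<bullet> b"
    using second_derivative_symmetric_real[OF assms(1) smooth_on_inner_const[OF assms(1,2)] assms(3)]
    by simp
qed

section \<open>Linear algebra of an inner product\<close>

subsection \<open>Orthonormal frames\<close>

locale inner_form =
  fixes g :: "'e::euclidean_space \<Rightarrow> 'e \<Rightarrow> real"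
  assumes bilin: "bilinear g" and sym: "g u v = g v u" and pos: "u \<noteq> 0 \<Longrightarrow> g u u > 0"
begin

lemmas g_simps [simp] =
  bilinear_ladd[OF bilin] bilinear_radd[OF bilin] bilinear_lsub[OF bilin] bilinear_rsub[OF bilin]
  bilinear_lmul[OF bilin] bilinear_rmul[OF bilin] bilinear_lneg[OF bilin] bilinear_rneg[OF bilin]
  bilinear_lzero[OF bilin] bilinear_rzero[OF bilin]

lemma linear_left: "linear (\<lambda>u. g u v)"
  using bilin by (simp add: bilinear_def)

lemmas g_sum_left = linear_sum[OF linear_left]

lemma nonneg: "g u u \<ge> 0"
  using pos[of u] by (cases "u = 0") auto

lemma eq_zeroI: "g u u = 0 \<Longrightarrow> u = 0"
  using pos[of u] by fastforce

definition orthonormal :: "nat \<Rightarrow> (nat \<Rightarrow> 'e) \<Rightarrow> bool" where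
  "orthonormal k e \<longleftrightarrow> (\<forall>i<k. \<forall>j<k. g (e i) (e j) = (if i = j then 1 else 0))"

lemma Basis_enumeration: obtains b where "bij_betw b {..<DIM('e)} (Basis :: 'e set)"
  using ex_bij_betw_nat_finite[OF finite_Basis] by (auto simp: lessThan_atLeast0)

lemma coordinate_map_nth:
  assumes b: "bij_betw b {..<DIM('e)} (Basis :: 'e set)" and k: "k \<le> DIM('e)" and j: "j < DIM('e)"
  shows "(\<Sum>i<k. a i *\<^sub>R b i) \<bullet> b j = (if j < k then a j else 0)"
proof -
  have "(\<Sum>i<k. a i *\<^sub>R b i) \<bullet> b j = (\<Sum>i<k. if i = j then a i else 0)"
    unfolding inner_sum_left
  proof (rule sum.cong[OF refl])
    fix i assume "i \<in> {..<k}"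
    then have i: "i < DIM('e)" using k by simp
    have "b i \<in> Basis" "b j \<in> Basis" using b i j by (auto simp: bij_betw_def)
    moreover have "b i = b j \<longleftrightarrow> i = j" using b i j by (auto simp: bij_betw_def inj_on_def)
    ultimately show "a i *\<^sub>R b i \<bullet> b j = (if i = j then a i else 0)" by (simp add: inner_Basis)
  qed
  then show ?thesis by simp
qed

lemma linear_coordinate_map: "linear (\<lambda>v. \<Sum>i<k. g v (e i) *\<^sub>R b i)"
  by (rule linearI) (simp_all add: scaleR_add_left sum.distrib scaleR_sum_right)

text \<open>Fewer than \<open>DIM('e)\<close> linear equations have a non-zero common solution.\<close>

lemma exists_unit_orthogonal:
  assumes "k < DIM('e)"
  shows "\<exists>u. g u u = 1 \<and> (\<forall>i<k. g u (e i) = 0)"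
proof -
  obtain b where b: "bij_betw b {..<DIM('e)} (Basis :: 'e set)" by (rule Basis_enumeration)
  let ?T = "\<lambda>v. \<Sum>i<k. g v (e i) *\<^sub>R b i"
  have nth: "?T v \<bullet> b j = (if j < k then g v (e j) else 0)" if "j < DIM('e)" for v j
    using coordinate_map_nth[OF b _ that] assms by simp
  have "b k \<in> Basis" using b assms by (auto simp: bij_betw_def)
  then have "?T v \<noteq> b k" for v using nth[OF assms, of v] by auto
  then have "\<not> surj ?T" by (metis (no_types, lifting) surjE)
  then have "\<not> inj ?T" using linear_injective_imp_surjective[OF linear_coordinate_map] by blast
  then obtain v where v: "v \<noteq> 0" "?T v = 0"
    using linear_injective_0[OF linear_coordinate_map] by blast
  have "g v (e i) = 0" if "i < k" for i using nth[of i v] that assms v(2) by simp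
  moreover have "g v v > 0" using pos v(1) by blast
  ultimately show ?thesis
    by (intro exI[of _ "(1 / sqrt (g v v)) *\<^sub>R v"]) (simp add: field_simps)
qed

text \<open>The map taking a vector to its \<open>g\<close>-coordinates with respect to \<open>e\<close> is onto, hence injective, and the
two sides have the same coordinates.\<close>

lemma orthonormal_expansion:
  assumes "orthonormal (DIM('e)) e"
  shows "(\<Sum>i<DIM('e). g v (e i) *\<^sub>R e i) = v"
proof -
  obtain b where b: "bij_betw b {..<DIM('e)} (Basis :: 'e set)" by (rule Basis_enumeration)
  let ?T = "\<lambda>v. \<Sum>i<DIM('e). g v (e i) *\<^sub>R b i"
  have lin: "linear ?T" by (rule linear_coordinate_map)
  have Te: "?T (e j) = b j" if "j < DIM('e)" for j
  proof -
    have "?T (e j) = (\<Sum>i<DIM('e). if i = j then b i else 0)"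
      using assms that by (intro sum.cong) (auto simp: orthonormal_def)
    then show ?thesis using that by simp
  qed
  have "surj ?T"
  proof (rule surjI)
    fix y
    have "?T (\<Sum>i<DIM('e). (y \<bullet> b i) *\<^sub>R e i) = (\<Sum>i<DIM('e). (y \<bullet> b i) *\<^sub>R b i)"
      by (simp only: linear_sum[OF lin] linear_cmul[OF lin]) (simp add: Te)
    also have "\<dots> = (\<Sum>x\<in>Basis. (y \<bullet> x) *\<^sub>R x)"
      using sum.reindex_bij_betw[OF b, of "\<lambda>x. (y \<bullet> x) *\<^sub>R x"] by simp
    finally show "?T (\<Sum>i<DIM('e). (y \<bullet> b i) *\<^sub>R e i) = y" by (simp add: euclidean_representation)
  qed
  then have "inj ?T" using linear_surjective_imp_injective[OF lin] by blast
  moreover have "?T (\<Sum>i<DIM('e). g v (e i) *\<^sub>R e i) = ?T v"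
    by (simp only: linear_sum[OF lin] linear_cmul[OF lin]) (simp add: Te)
  ultimately show ?thesis by (rule injD)
qed

lemma orthonormal_extend:
  assumes "orthonormal k e" "g u u = 1" "\<And>i. i < k \<Longrightarrow> g u (e i) = 0"
  shows "orthonormal (Suc k) (e(k := u))"
proof -
  have "g (e i) u = 0" if "i < k" for i using assms(3)[OF that] sym[of u "e i"] by simp
  then show ?thesis using assms by (auto simp: orthonormal_def less_Suc_eq)
qed

text \<open>Otherwise the quadratic polynomial \<open>B (w + t v) (w + t v)\<close> in \<open>t\<close>, which has no constant term, would
take negative values.\<close>

lemma semidefinite_null_vector:
  assumes "bilinear B" "\<And>u v. B u v = B v u" "subspace W" "\<And>u. u \<in> W \<Longrightarrow> B u u \<ge> 0"
    and "w \<in> W" "B w w = 0" "v \<in> W"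
  shows "B w v = (0::real)"
proof (rule ccontr)
  define c where "c = B v v"
  define d where "d = B w v"
  assume "B w v \<noteq> 0"
  then have d: "d \<noteq> 0" by (simp add: d_def)
  have c: "c \<ge> 0" using assms(4,7) by (simp add: c_def)
  \<comment> \<open>The shift by 1 avoids a case distinction on \<open>c = 0\<close>, the minimiser being \<open>- d / c\<close>.\<close>
  define t where "t = - d / (c + 1)"
  have "w + t *\<^sub>R v \<in> W" using assms(3,5,7) by (simp add: subspace_add subspace_scale)
  then have "0 \<le> B (w + t *\<^sub>R v) (w + t *\<^sub>R v)" using assms(4) by blast
  also have "\<dots> = 2 * t * d + t * t * c"
    using assms(2)[of v w] assms(6)
    by (simp add: bilinear_ladd[OF assms(1)] bilinear_radd[OF assms(1)] bilinear_lmul[OF assms(1)]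
        bilinear_rmul[OF assms(1)] c_def d_def algebra_simps)
  also have "\<dots> = - (d * d * (c + 2)) / ((c + 1) * (c + 1))"
  proof -
    have "c + 1 \<noteq> 0" using c by simp
    then show ?thesis by (simp add: t_def divide_simps) (simp add: algebra_simps)
  qed
  also have "\<dots> < 0" using c d by (intro divide_neg_pos) (auto simp: not_square_less_zero less_le)
  finally show False by simp
qed

subsection \<open>The spectral theorem\<close>

text \<open>A maximum \<open>\<mu>\<close> of the Rayleigh quotient on \<open>W\<close> makes \<open>\<mu> g - g(S \<cdot>, \<cdot>)\<close> positive semidefinite with
the maximising vector in its null cone, so this vector is orthogonal to its own defect \<open>\<mu> w - S w\<close>.\<close>

lemma exists_eigenvector:
  assumes S: "linear S" "\<And>u v. g (S u) v = g u (S v)"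
    and W: "subspace W" "\<And>u. u \<in> W \<Longrightarrow> S u \<in> W" and ne: "u \<in> W" "u \<noteq> 0"
  shows "\<exists>w \<mu>. w \<in> W \<and> g w w = 1 \<and> S w = \<mu> *\<^sub>R w"
proof -
  let ?K = "W \<inter> sphere 0 1"
  let ?q = "\<lambda>u. g (S u) u / g u u"
  have bS: "bilinear (\<lambda>u v. g (S u) v)"
    using S(1) by (auto simp: bilinear_def linear_iff)
  have cont2: "continuous_on X (\<lambda>u. B u u)" if "bilinear B" for B :: "'e \<Rightarrow> 'e \<Rightarrow> real" and X
    using bounded_bilinear.continuous_on[OF that[unfolded bilinear_conv_bounded_bilinear]
        continuous_on_id continuous_on_id] by simp
  have "compact ?K" using closed_subspace[OF W(1)] by (simp add: closed_Int_compact)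
  moreover have "(1 / norm u) *\<^sub>R u \<in> ?K" using ne W(1) by (auto simp: subspace_scale)
  moreover have "g u u \<noteq> 0" if "u \<in> ?K" for u using pos[of u] that by (metis IntD2 less_irrefl mem_sphere_0 norm_zero zero_neq_one)
  then have "continuous_on ?K ?q"
    using cont2[OF bS] cont2[OF bilin] by (intro continuous_on_divide) auto
  ultimately obtain w where w: "w \<in> ?K" "\<And>v. v \<in> ?K \<Longrightarrow> ?q v \<le> ?q w"
    using continuous_attains_sup[of ?K ?q] by blast
  define \<mu> where "\<mu> = ?q w"
  define B where "B u v = \<mu> * g u v - g (S u) v" for u v
  have w0: "w \<noteq> 0" using w(1) by auto
  have bilB: "bilinear B"
    unfolding B_def using S(1) by (auto simp: bilinear_def linear_iff algebra_simps)
  have "B v v \<ge> 0" if "v \<in> W" for v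
  proof (cases "v = 0")
    case False
    define c where "c = 1 / norm v"
    have "c *\<^sub>R v \<in> ?K" using that False W(1) by (auto simp: subspace_scale c_def)
    then have "?q (c *\<^sub>R v) \<le> \<mu>" unfolding \<mu>_def by (rule w(2))
    moreover have "c \<noteq> 0" using False by (simp add: c_def)
    then have "?q (c *\<^sub>R v) = ?q v" by (simp add: linear_cmul[OF S(1)])
    ultimately have "?q v \<le> \<mu>" by (simp only:)
    then show ?thesis using pos[OF False] by (simp add: B_def field_simps)
  qed (simp add: B_def)
  moreover have "B w w = 0" using pos[OF w0] by (simp add: B_def \<mu>_def)
  moreover have "B u v = B v u" for u v unfolding B_def using S(2)[of u v] sym by metis
  ultimately have "B w v = 0" if "v \<in> W" for v
    using semidefinite_null_vector[OF bilB _ W(1), of w v] w(1) that by blast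
  moreover have "\<mu> *\<^sub>R w - S w \<in> W" using w(1) W by (simp add: subspace_diff subspace_scale)
  ultimately have "B w (\<mu> *\<^sub>R w - S w) = 0" by blast
  then have "g (\<mu> *\<^sub>R w - S w) (\<mu> *\<^sub>R w - S w) = 0" by (simp add: B_def algebra_simps)
  then have "\<mu> *\<^sub>R w - S w = 0" by (rule eq_zeroI)
  then have "S w = \<mu> *\<^sub>R w" by simp
  then have "S ((1 / sqrt (g w w)) *\<^sub>R w) = \<mu> *\<^sub>R ((1 / sqrt (g w w)) *\<^sub>R w)"
    by (simp add: linear_cmul[OF S(1)])
  moreover have "(1 / sqrt (g w w)) *\<^sub>R w \<in> W" using w(1) W(1) by (simp add: subspace_scale)
  moreover have "g ((1 / sqrt (g w w)) *\<^sub>R w) ((1 / sqrt (g w w)) *\<^sub>R w) = 1"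
    using pos[OF w0] by simp
  ultimately show ?thesis by blast
qed

text \<open>The orthogonal complement of the eigenvectors found so far is invariant under \<open>S\<close>, so it contains the
next one.\<close>

lemma orthonormal_eigenframe:
  assumes S: "linear S" "\<And>u v. g (S u) v = g u (S v)" and "k \<le> DIM('e)"
  shows "\<exists>e. orthonormal k e \<and> (\<forall>i<k. \<exists>\<mu>. S (e i) = \<mu> *\<^sub>R e i)"
  using assms(3)
proof (induction k)
  case 0
  then show ?case by (simp add: orthonormal_def)
next
  case (Suc k)
  then obtain e where e: "orthonormal k e" "\<forall>i<k. \<exists>\<mu>. S (e i) = \<mu> *\<^sub>R e i" by auto
  define W where "W = {u. \<forall>i<k. g u (e i) = 0}"
  have "subspace W" by (auto simp: W_def subspace_def)
  moreover have "S u \<in> W" if u: "u \<in> W" for u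
  proof -
    have "g (S u) (e i) = 0" if i: "i < k" for i
    proof -
      obtain \<mu> where "S (e i) = \<mu> *\<^sub>R e i" using e(2) i by blast
      then show ?thesis using u i by (simp add: S(2) W_def)
    qed
    then show ?thesis by (simp add: W_def)
  qed
  moreover obtain u where "g u u = 1" "u \<in> W"
    using exists_unit_orthogonal[of k e] Suc.prems by (auto simp: W_def)
  moreover from this have "u \<noteq> 0" by auto
  ultimately obtain w \<mu> where w: "w \<in> W" "g w w = 1" "S w = \<mu> *\<^sub>R w"
    using exists_eigenvector[OF S] by metis
  show ?case
  proof (intro exI conjI)
    show "orthonormal (Suc k) (e(k := w))"
      using orthonormal_extend e(1) w by (simp add: W_def)
    show "\<forall>i<Suc k. \<exists>\<mu>. S ((e(k := w)) i) = \<mu> *\<^sub>R (e(k := w)) i"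
      using e(2) w(3) by (auto simp: less_Suc_eq)
  qed
qed

lemma orthonormal_frame_exists: "\<exists>e. orthonormal (DIM('e)) e"
  using orthonormal_eigenframe[of "\<lambda>v. v" "DIM('e)"] by (auto simp: linear_iff)

text \<open>A unit vector \<open>u\<close> orthogonal to the pairs found so far can be adjoined together with \<open>J u\<close>, because the
span of these pairs is invariant under \<open>J\<close>.\<close>

lemma unitary_frame_exists:
  assumes J: "\<And>v. J (J v) = - v" "\<And>u v. g (J u) v = - g u (J v)" and "2 * k \<le> DIM('e)"
  shows "\<exists>e. orthonormal (2 * k) e \<and> (\<forall>i<k. e (Suc (2 * i)) = J (e (2 * i)))"
  using assms(3)
proof (induction k)
  case 0
  then show ?case by (simp add: orthonormal_def)
next
  case (Suc k)
  then obtain e where e: "orthonormal (2 * k) e" "\<forall>i<k. e (Suc (2 * i)) = J (e (2 * i))" by auto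
  obtain u where u: "g u u = 1" "\<And>i. i < 2 * k \<Longrightarrow> g u (e i) = 0"
    using exists_unit_orthogonal[of "2 * k" e] Suc.prems by auto
  have Ju: "g (J u) (J u) = 1" "g (J u) u = 0"
    using J(1)[of u] J(2)[of u "J u"] J(2)[of u u] sym[of "J u" u] u(1) by simp_all
  have perp: "g (J u) (e i) = 0" if i: "i < 2 * k" for i
  proof (cases "even i")
    case True
    then obtain j where "i = 2 * j" by (rule evenE)
    then show ?thesis using e(2) u(2)[of "Suc (2 * j)"] i J(2) by auto
  next
    case False
    then obtain j where j: "i = Suc (2 * j)" by (metis oddE Suc_eq_plus1)
    then have "e i = J (e (2 * j))" using e(2) i by simp
    then have "J (e i) = - e (2 * j)" using J(1) by simp
    then show ?thesis using J(2)[of u "e i"] u(2)[of "2 * j"] i j by simp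
  qed
  let ?e = "(e(2 * k := u))(Suc (2 * k) := J u)"
  have "orthonormal (Suc (2 * k)) (e(2 * k := u))" using orthonormal_extend e(1) u by blast
  then have "orthonormal (Suc (Suc (2 * k))) ?e"
    by (rule orthonormal_extend) (use Ju perp in \<open>auto simp: less_Suc_eq\<close>)
  moreover have "\<forall>i<Suc k. ?e (Suc (2 * i)) = J (?e (2 * i))"
    using e(2) by (auto simp: less_Suc_eq)
  ultimately show ?case by (auto intro!: exI[of _ ?e] simp del: fun_upd_apply)
qed

end

subsection \<open>Traces\<close>

definition endo_trace :: "('e::euclidean_space \<Rightarrow> 'e) \<Rightarrow> real" where
  "endo_trace L = (\<Sum>b\<in>Basis. L b \<bullet> b)"

lemma endo_trace_commute:
  fixes K L :: "'e::euclidean_space \<Rightarrow> 'e"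
  assumes "linear K" "linear L"
  shows "endo_trace (\<lambda>v. K (L v)) = endo_trace (\<lambda>v. L (K v))"
proof -
  have expand: "endo_trace (\<lambda>v. K (L v)) = (\<Sum>b\<in>Basis. \<Sum>a\<in>Basis. (L b \<bullet> a) * (K a \<bullet> b))"
    if "linear K" for K L :: "'e \<Rightarrow> 'e"
    unfolding endo_trace_def
  proof (rule sum.cong[OF refl])
    fix b :: 'e
    have "K (L b) = K (\<Sum>a\<in>Basis. (L b \<bullet> a) *\<^sub>R a)" by (simp add: euclidean_representation)
    also have "\<dots> = (\<Sum>a\<in>Basis. (L b \<bullet> a) *\<^sub>R K a)" by (simp add: linear_sum[OF that] linear_cmul[OF that])
    finally show "K (L b) \<bullet> b = (\<Sum>a\<in>Basis. (L b \<bullet> a) * (K a \<bullet> b))" by (simp add: inner_sum_left)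
  qed
  show ?thesis
    unfolding expand[OF assms(1)] expand[OF assms(2)]
    by (subst sum.swap) (simp add: mult.commute)
qed

context inner_form
begin

text \<open>The trace is defined through the ambient standard basis, which need not be orthonormal for \<open>g\<close>; adjointness
with respect to \<open>g\<close> becomes visible only in a frame that is.\<close>

lemma endo_trace_orthonormal:
  assumes "linear L" "orthonormal (DIM('e)) e"
  shows "endo_trace L = (\<Sum>i<DIM('e). g (L (e i)) (e i))"
proof -
  have "L b \<bullet> b = (\<Sum>i<DIM('e). g b (e i) * (L (e i) \<bullet> b))" for b
  proof -
    have "L b = L (\<Sum>i<DIM('e). g b (e i) *\<^sub>R e i)" by (simp add: orthonormal_expansion[OF assms(2)])
    also have "\<dots> = (\<Sum>i<DIM('e). g b (e i) *\<^sub>R L (e i))"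
      by (simp add: linear_sum[OF assms(1)] linear_cmul[OF assms(1)])
    finally show ?thesis by (simp add: inner_sum_left)
  qed
  then have "endo_trace L = (\<Sum>i<DIM('e). \<Sum>b\<in>Basis. g b (e i) * (L (e i) \<bullet> b))"
    unfolding endo_trace_def by (simp only: sum.swap[of _ "{..<DIM('e)}"])
  also have "\<dots> = (\<Sum>i<DIM('e). g (\<Sum>b\<in>Basis. (L (e i) \<bullet> b) *\<^sub>R b) (e i))"
    by (simp add: g_sum_left mult.commute)
  finally show ?thesis by (simp add: euclidean_representation)
qed

lemma endo_trace_skew:
  assumes "linear L" "\<And>u v. g (L u) v = - g u (L v)"
  shows "endo_trace L = 0"
proof -
  obtain e where e: "orthonormal (DIM('e)) e" using orthonormal_frame_exists by blast
  have "g (L v) v = 0" for v using assms(2)[of v v] sym[of "L v" v] by simp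
  then show ?thesis using endo_trace_orthonormal[OF assms(1) e] by simp
qed

text \<open>In an orthonormal frame the trace of \<open>L\<^sup>2\<close> is the sum of the squared lengths of the images.\<close>

lemma selfadjoint_zeroI:
  assumes "linear L" "\<And>u v. g (L u) v = g u (L v)" "endo_trace (\<lambda>v. L (L v)) = 0"
  shows "L v = 0"
proof -
  obtain e where e: "orthonormal (DIM('e)) e" using orthonormal_frame_exists by blast
  have "linear (\<lambda>v. L (L v))" using linear_compose[OF assms(1,1)] by (simp add: o_def)
  then have "(\<Sum>i<DIM('e). g (L (e i)) (L (e i))) = 0"
    using endo_trace_orthonormal[OF _ e] assms(2,3) by simp
  then have "\<forall>i<DIM('e). g (L (e i)) (L (e i)) = 0"
    by (subst (asm) sum_nonneg_eq_0_iff) (auto intro: nonneg)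
  then have "\<forall>i<DIM('e). L (e i) = 0" using eq_zeroI by blast
  moreover have "L v = (\<Sum>i<DIM('e). g v (e i) *\<^sub>R L (e i))"
    using arg_cong[OF orthonormal_expansion[OF e, of v], of L]
    by (simp add: linear_sum[OF assms(1)] linear_cmul[OF assms(1)])
  ultimately show ?thesis by simp
qed

end

subsection \<open>Polynomials of an endomorphism\<close>

definition opoly :: "real poly \<Rightarrow> ('e::real_vector \<Rightarrow> 'e) \<Rightarrow> 'e \<Rightarrow> 'e" where
  "opoly q L v = (\<Sum>i\<le>degree q. coeff q i *\<^sub>R (L ^^ i) v)"

lemma opoly_bound: "degree q \<le> N \<Longrightarrow> opoly q L v = (\<Sum>i\<le>N. coeff q i *\<^sub>R (L ^^ i) v)"
  unfolding opoly_def by (rule sum.mono_neutral_left) (auto simp: coeff_eq_0)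

lemma linear_funpow:
  fixes L :: "'e::real_vector \<Rightarrow> 'e"
  shows "linear L \<Longrightarrow> linear (L ^^ i)"
  by (induction i) (simp_all add: linear_iff)

lemma linear_opoly: "linear L \<Longrightarrow> linear (opoly q L)"
  unfolding opoly_def
  by (intro linear_compose_sum ballI linear_compose_scale_right linear_funpow)

lemma opoly_0 [simp]: "opoly 0 L v = 0"
  by (simp add: opoly_def)

lemma opoly_pCons: "linear L \<Longrightarrow> opoly (pCons a q) L v = a *\<^sub>R v + L (opoly q L v)"
proof -
  assume L: "linear L"
  have "opoly (pCons a q) L v = (\<Sum>i\<le>Suc (degree q). coeff (pCons a q) i *\<^sub>R (L ^^ i) v)"
    by (rule opoly_bound) (rule degree_pCons_le)
  also have "\<dots> = a *\<^sub>R v + (\<Sum>i\<le>degree q. coeff q i *\<^sub>R L ((L ^^ i) v))"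
    by (simp add: sum.atMost_Suc_shift del: sum.atMost_Suc)
  finally show ?thesis by (simp add: opoly_def linear_sum[OF L] linear_cmul[OF L])
qed

lemma opoly_1 [simp]: "opoly 1 L v = v"
  by (simp add: opoly_def)

lemma opoly_add: "linear L \<Longrightarrow> opoly (p + q) L v = opoly p L v + opoly q L v"
proof (induction p arbitrary: q)
  case (pCons a p)
  obtain b q' where q: "q = pCons b q'" by (rule pCons_cases)
  have "L (opoly (p + q') L v) = L (opoly p L v) + L (opoly q' L v)"
    by (simp only: pCons.IH[OF pCons.prems] linear_add[OF pCons.prems])
  then show ?case using pCons.prems q by (simp add: opoly_pCons scaleR_add_left)
qed simp

lemma opoly_smult: "linear L \<Longrightarrow> opoly (smult a q) L v = a *\<^sub>R opoly q L v"
  by (induction q) (auto simp: opoly_pCons linear_cmul algebra_simps)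

lemma opoly_diff: "linear L \<Longrightarrow> opoly (p - q) L v = opoly p L v - opoly q L v"
  using opoly_add[of L p "smult (- 1) q" v] opoly_smult[of L "- 1" q v] by simp

lemma opoly_mult: "linear L \<Longrightarrow> opoly (p * q) L v = opoly p L (opoly q L v)"
  by (induction p) (auto simp: opoly_pCons opoly_add opoly_smult)

lemma opoly_pcompose: "linear L \<Longrightarrow> opoly (pcompose p q) L v = opoly p (opoly q L) v"
  by (induction p) (auto simp: pcompose_pCons opoly_pCons opoly_add opoly_mult linear_opoly linear_0)

lemma opoly_eigenvector:
  assumes "linear L" "L v = \<mu> *\<^sub>R v"
  shows "opoly q L v = poly q \<mu> *\<^sub>R v"
  using assms by (induction q) (auto simp: opoly_pCons linear_cmul algebra_simps)

lemma opoly_commute: "linear L \<Longrightarrow> opoly q L (L v) = L (opoly q L v)"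
  by (induction q) (auto simp: opoly_pCons linear_add linear_cmul linear_0)

lemma opoly_adjoint:
  assumes "bilinear B" "linear L" "\<And>u v. B (L u) v = B u (L v)"
  shows "B (opoly q L u) v = B u (opoly q L v)"
proof (induction q arbitrary: u v)
  case 0
  then show ?case using bilinear_lzero[OF assms(1)] bilinear_rzero[OF assms(1)] by simp
next
  case (pCons a q)
  then show ?case
    by (simp add: opoly_pCons opoly_commute assms bilinear_ladd[OF assms(1)] bilinear_radd[OF assms(1)]
        bilinear_lmul[OF assms(1)] bilinear_rmul[OF assms(1)])
qed

lemma polynomial_interpolation:
  fixes f :: "real \<Rightarrow> real"
  assumes "finite X"
  shows "\<exists>q. \<forall>x\<in>X. poly q x = f x"
  using assms
proof (induction X)
  case (insert a X)
  then obtain q where q: "\<forall>x\<in>X. poly q x = f x" by blast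
  \<comment> \<open>Correct \<open>q\<close> at \<open>a\<close> by a multiple of a polynomial that vanishes on \<open>X\<close>.\<close>
  let ?w = "\<Prod>x\<in>X. [:- x, 1:]"
  have "poly ?w a \<noteq> 0" using insert by (simp add: poly_prod)
  moreover have "poly ?w x = 0" if "x \<in> X" for x using that insert(1) by (simp add: poly_prod prod_zero_iff)
  ultimately show ?case
    using q by (intro exI[of _ "q + smult ((f a - poly q a) / poly ?w a) ?w"]) auto
qed simp

text \<open>Interpolate \<open>t powr (- 1 / 4)\<close> at the eigenvalues. The fourth root is used instead of the square root
so that the inverse square root \<open>h(S)\<^sup>2\<close> is visibly positive: \<open>g(h(S)\<^sup>2 u, u) = g(h(S) u, h(S) u)\<close>.\<close>

lemma (in inner_form) inverse_fourth_root_polynomial: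
  assumes S: "linear S" "\<And>u v. g (S u) v = g u (S v)" "\<And>u. u \<noteq> 0 \<Longrightarrow> g (S u) u > 0"
  shows "\<exists>h. \<forall>v. opoly ([:0, 1:] * h ^ 4 - 1) S v = 0"
proof -
  obtain e where e: "orthonormal (DIM('e)) e" "\<forall>i<DIM('e). \<exists>\<mu>. S (e i) = \<mu> *\<^sub>R e i"
    using orthonormal_eigenframe[OF S(1,2) order_refl] by blast
  obtain \<mu> where \<mu>: "\<And>i. i < DIM('e) \<Longrightarrow> S (e i) = \<mu> i *\<^sub>R e i" using e(2) by metis
  have \<mu>_pos: "\<mu> i > 0" if "i < DIM('e)" for i
  proof -
    have "g (e i) (e i) = 1" using e(1) that by (simp add: orthonormal_def)
    moreover from this have "e i \<noteq> 0" by auto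
    ultimately show ?thesis using S(3)[of "e i"] \<mu>[OF that] by simp
  qed
  obtain h where h: "\<forall>x\<in>\<mu> ` {..<DIM('e)}. poly h x = x powr (- (1 / 4))"
    using polynomial_interpolation[of "\<mu> ` {..<DIM('e)}" "\<lambda>x. x powr (- (1 / 4))"] by blast
  have "poly ([:0, 1:] * h ^ 4 - 1) (\<mu> i) = 0" if "i < DIM('e)" for i
  proof -
    have "(\<mu> i powr (- (1 / 4))) ^ 4 = \<mu> i powr (- 1)"
      using \<mu>_pos[OF that] by (simp add: powr_realpow[symmetric] powr_powr)
    then show ?thesis using h \<mu>_pos[OF that] that by (simp add: poly_power powr_minus)
  qed
  then have zero: "opoly ([:0, 1:] * h ^ 4 - 1) S (e i) = 0" if "i < DIM('e)" for i
    using opoly_eigenvector[OF S(1) \<mu>[OF that], of "[:0, 1:] * h ^ 4 - 1"] that by simp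
  have "opoly ([:0, 1:] * h ^ 4 - 1) S v = 0" for v
  proof -
    define F where "F = opoly ([:0, 1:] * h ^ 4 - 1) S"
    have lin: "linear F" unfolding F_def using linear_opoly[OF S(1)] .
    have "F v = F (\<Sum>i<DIM('e). g v (e i) *\<^sub>R e i)" by (simp add: orthonormal_expansion[OF e(1)])
    also have "\<dots> = (\<Sum>i<DIM('e). g v (e i) *\<^sub>R F (e i))"
      by (simp add: linear_sum[OF lin] linear_cmul[OF lin])
    also have "\<dots> = 0" unfolding F_def using zero by (intro sum.neutral ballI) (simp only: lessThan_iff scaleR_zero_right)
    finally show ?thesis by (simp add: F_def)
  qed
  then show ?thesis by blast
qed

section \<open>Alternating forms and powers of a 2-form\<close>

text \<open>A name for transpositions of indices, since matrix transposition bears the same short name.\<close>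

abbreviation swap_idx :: "nat \<Rightarrow> nat \<Rightarrow> nat \<Rightarrow> nat" where
  "swap_idx \<equiv> Transposition.transpose"

definition multilinear_form :: "nat \<Rightarrow> ((nat \<Rightarrow> 'v::real_vector) \<Rightarrow> real) \<Rightarrow> bool" where
  "multilinear_form m \<mu> \<longleftrightarrow> (\<forall>v w. (\<forall>i<m. v i = w i) \<longrightarrow> \<mu> v = \<mu> w) \<and>
     (\<forall>v. \<forall>i<m. linear (\<lambda>x. \<mu> (v(i := x))))"

definition alternating :: "nat \<Rightarrow> ((nat \<Rightarrow> 'v::real_vector) \<Rightarrow> real) \<Rightarrow> bool" where
  "alternating m \<mu> \<longleftrightarrow> multilinear_form m \<mu> \<and> (\<forall>v i j. i < j \<and> j < m \<and> v i = v j \<longrightarrow> \<mu> v = 0)"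

lemma multilinear_form_cong: "multilinear_form m \<mu> \<Longrightarrow> (\<And>i. i < m \<Longrightarrow> v i = w i) \<Longrightarrow> \<mu> v = \<mu> w"
  by (auto simp: multilinear_form_def)

lemma multilinear_form_linear: "multilinear_form m \<mu> \<Longrightarrow> i < m \<Longrightarrow> linear (\<lambda>x. \<mu> (v(i := x)))"
  by (auto simp: multilinear_form_def)

lemma alternating_multilinear: "alternating m \<mu> \<Longrightarrow> multilinear_form m \<mu>"
  by (simp add: alternating_def)

lemma alternating_eq_zero:
  "alternating m \<mu> \<Longrightarrow> i < m \<Longrightarrow> j < m \<Longrightarrow> i \<noteq> j \<Longrightarrow> v i = v j \<Longrightarrow> \<mu> v = 0"
  unfolding alternating_def by (metis nat_neq_iff)

lemma alternating_transpose:
  assumes "alternating m \<mu>" "i < m" "j < m" "i \<noteq> j"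
  shows "\<mu> (\<lambda>k. v (swap_idx i j k)) = - \<mu> v"
proof -
  let ?F = "\<lambda>x y. \<mu> ((v(i := x))(j := y))"
  have lin1: "linear (\<lambda>y. ?F x y)" for x
    using multilinear_form_linear[OF alternating_multilinear[OF assms(1)] assms(3)] .
  have "?F x y = \<mu> ((v(j := y))(i := x))" for x y using assms(4) by (simp add: fun_upd_twist)
  then have lin2: "linear (\<lambda>x. ?F x y)" for y
    using multilinear_form_linear[OF alternating_multilinear[OF assms(1)] assms(2), of "v(j := y)"] by simp
  have zero: "?F x x = 0" for x
    using alternating_eq_zero[OF assms] assms(4) by simp
  \<comment> \<open>Polarisation: an alternating form vanishes when two arguments are equal to \<open>x + y\<close>.\<close>
  have "?F (x + y) (x + y) = ?F x x + ?F x y + ?F y x + ?F y y" for x y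
    using linear_add[OF lin1[of "x + y"], of x y] linear_add[OF lin2[of x], of x y]
      linear_add[OF lin2[of y], of x y] by simp
  then have "?F x y = - ?F y x" for x y
    using zero[of "x + y"] zero[of x] zero[of y] by (smt (verit))
  moreover have "(\<lambda>k. v (swap_idx i j k)) = (v(i := v j))(j := v i)"
    by (auto simp: fun_eq_iff Transposition.transpose_def)
  ultimately show ?thesis by simp
qed

lemma alternating_permutation:
  assumes "alternating m \<mu>" "\<sigma> permutes {..<m}"
  shows "\<mu> (\<lambda>i. v (\<sigma> i)) = of_int (sign \<sigma>) * \<mu> v"
  using assms(2) finite_lessThan
proof (induction \<sigma> arbitrary: v rule: permutes_induct)
  case id
  then show ?case by simp
next
  case (swap a b p)
    have "\<mu> (\<lambda>i. v ((swap_idx a b \<circ> p) i)) = of_int (sign p) * \<mu> (\<lambda>i. v (swap_idx a b i))"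
      using swap.IH[of "\<lambda>i. v (swap_idx a b i)"] by simp
    also have "\<dots> = of_int (- sign p) * \<mu> v"
      using alternating_transpose[OF assms(1)] swap.hyps by simp
    also have "- sign p = sign (swap_idx a b \<circ> p)"
      using swap.hyps
      by (simp add: sign_compose permutation_swap_id permutes_imp_permutation[of "{..<m}"] sign_swap_id)
    finally show ?case .
qed

lemma wedge_cong:
  assumes "\<And>v w. (\<And>i. i < k \<Longrightarrow> v i = w i) \<Longrightarrow> \<alpha> v = \<alpha> w"
    and "\<And>v w. (\<And>i. i < l \<Longrightarrow> v i = w i) \<Longrightarrow> \<beta> v = \<beta> w"
    and eq: "\<And>i. i < k + l \<Longrightarrow> v i = w i"
  shows "wedge k l \<alpha> \<beta> v = wedge k l \<alpha> \<beta> w"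
proof -
  have "of_int (sign \<sigma>) * \<alpha> (\<lambda>i. v (\<sigma> i)) * \<beta> (\<lambda>i. v (\<sigma> (k + i))) =
      of_int (sign \<sigma>) * \<alpha> (\<lambda>i. w (\<sigma> i)) * \<beta> (\<lambda>i. w (\<sigma> (k + i)))"
    if p: "\<sigma> permutes {..<k + l}" for \<sigma>
  proof -
    have V: "v (\<sigma> i) = w (\<sigma> i)" if "i < k + l" for i using permutes_in_image[OF p, of i] eq that by simp
    have "\<alpha> (\<lambda>i. v (\<sigma> i)) = \<alpha> (\<lambda>i. w (\<sigma> i))" by (rule assms(1)) (simp add: V)
    moreover have "\<beta> (\<lambda>i. v (\<sigma> (k + i))) = \<beta> (\<lambda>i. w (\<sigma> (k + i)))" by (rule assms(2)) (simp add: V)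
    ultimately show ?thesis by simp
  qed
  then have "(\<Sum>\<sigma> | \<sigma> permutes {..<k + l}. of_int (sign \<sigma>) * \<alpha> (\<lambda>i. v (\<sigma> i)) * \<beta> (\<lambda>i. v (\<sigma> (k + i)))) =
      (\<Sum>\<sigma> | \<sigma> permutes {..<k + l}. of_int (sign \<sigma>) * \<alpha> (\<lambda>i. w (\<sigma> i)) * \<beta> (\<lambda>i. w (\<sigma> (k + i))))"
    by (intro sum.cong) auto
  then show ?thesis unfolding wedge_def by (rule arg_cong)
qed

text \<open>The sum over all permutations already antisymmetrises: composing with a transposition that exchanges
two equal arguments leaves the arguments in place and changes the sign of every term.\<close>

lemma wedge_alternating:
  assumes "multilinear_form k \<alpha>" "multilinear_form l \<beta>"
  shows "alternating (k + l) (wedge k l \<alpha> \<beta>)"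
proof -
  let ?t = "\<lambda>v \<sigma>. of_int (sign \<sigma>) * \<alpha> (\<lambda>i. v (\<sigma> i)) * \<beta> (\<lambda>i. v (\<sigma> (k + i)))"
  have cong: "wedge k l \<alpha> \<beta> v = wedge k l \<alpha> \<beta> w" if "\<And>i. i < k + l \<Longrightarrow> v i = w i" for v w
    by (rule wedge_cong[OF multilinear_form_cong[OF assms(1)] multilinear_form_cong[OF assms(2)] that])
  have lin: "linear (\<lambda>x. wedge k l \<alpha> \<beta> (v(i := x)))" if i: "i < k + l" for v i
  proof -
    have lin_term: "linear (\<lambda>x. ?t (v(i := x)) \<sigma>)" if p: "\<sigma> permutes {..<k + l}" for \<sigma>
    proof -
      obtain j where j: "\<sigma> j = i" "j < k + l"
        using p i by (metis lessThan_iff permutes_def permutes_in_image)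
      have inj: "\<sigma> a = i \<longleftrightarrow> a = j" for a using p j(1) by (metis permutes_inj injD)
      show ?thesis
      proof (cases "j < k")
        case True
        have "(\<lambda>a. (v(i := x)) (\<sigma> a)) = (\<lambda>a. v (\<sigma> a))(j := x)" for x
          using inj by (auto simp: fun_eq_iff)
        moreover have "(\<lambda>a. (v(i := x)) (\<sigma> (k + a))) = (\<lambda>a. v (\<sigma> (k + a)))" for x
          using inj True by (auto simp: fun_eq_iff)
        ultimately show ?thesis
          using multilinear_form_linear[OF assms(1) True, of "\<lambda>a. v (\<sigma> a)"]
          by (simp add: linear_iff algebra_simps)
      next
        case False
        then obtain b where b: "j = k + b" by (metis not_less le_Suc_ex)
        then have bl: "b < l" using j(2) by simp
        have "multilinear_form k \<alpha> \<Longrightarrow> \<alpha> (\<lambda>a. (v(i := x)) (\<sigma> a)) = \<alpha> (\<lambda>a. v (\<sigma> a))" for x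
          by (erule multilinear_form_cong) (use inj b in auto)
        moreover have "(\<lambda>a. (v(i := x)) (\<sigma> (k + a))) = (\<lambda>a. v (\<sigma> (k + a)))(b := x)" for x
          using inj b by (auto simp: fun_eq_iff)
        ultimately show ?thesis
          using multilinear_form_linear[OF assms(2) bl, of "\<lambda>a. v (\<sigma> (k + a))"] assms(1)
          by (simp add: linear_iff algebra_simps)
      qed
    qed
    have "linear (\<lambda>x. \<Sum>\<sigma> | \<sigma> permutes {..<k + l}. ?t (v(i := x)) \<sigma>)"
      by (intro linear_compose_sum ballI) (use lin_term in blast)
    from linear_compose_scale_right[OF this, of "1 / (fact k * fact l)"]
    show ?thesis unfolding wedge_def by (simp add: field_simps)
  qed
  have alt: "wedge k l \<alpha> \<beta> v = 0" if ij: "i < j" "j < k + l" "v i = v j" for v i j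
  proof -
    have tr: "swap_idx i j permutes {..<k + l}" using ij by (intro permutes_swap_id) auto
    have "v (swap_idx i j a) = v a" for a using ij(3) by (auto simp: Transposition.transpose_def)
    moreover have "sign (swap_idx i j \<circ> \<sigma>) = - sign \<sigma>" if "\<sigma> permutes {..<k + l}" for \<sigma>
      using ij that
      by (simp add: sign_compose permutation_swap_id permutes_imp_permutation[of "{..<k + l}"] sign_swap_id)
    ultimately have "?t v (swap_idx i j \<circ> \<sigma>) = - ?t v \<sigma>" if "\<sigma> permutes {..<k + l}" for \<sigma>
      using that by simp
    then have "(\<Sum>\<sigma> | \<sigma> permutes {..<k + l}. ?t v (swap_idx i j \<circ> \<sigma>)) =
        - (\<Sum>\<sigma> | \<sigma> permutes {..<k + l}. ?t v \<sigma>)" by (simp add: sum_negf)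
    moreover have "(\<Sum>\<sigma> | \<sigma> permutes {..<k + l}. ?t v (swap_idx i j \<circ> \<sigma>)) =
        (\<Sum>\<sigma> | \<sigma> permutes {..<k + l}. ?t v \<sigma>)"
      using setum_permutations_compose_left[OF tr, of "?t v"] by simp
    ultimately show ?thesis unfolding wedge_def by simp
  qed
  show ?thesis unfolding alternating_def multilinear_form_def using cong lin alt by blast
qed

lemma bilinear_multilinear_form: "bilinear B \<Longrightarrow> multilinear_form 2 (\<lambda>v. B (v 0) (v 1))"
  unfolding multilinear_form_def by (auto simp: less_2_cases_iff bilinear_def)

lemma wedge_power_alternating:
  assumes "bilinear B"
  shows "alternating (2 * k) (wedge_power B k)"
proof (induction k)
  case 0
  then show ?case by (simp add: alternating_def multilinear_form_def)
next
  case (Suc k)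
  then show ?case
    using wedge_alternating[OF alternating_multilinear bilinear_multilinear_form[OF assms], of "2 * k" _]
    by (simp add: add.commute)
qed

subsection \<open>The value on a symplectic frame\<close>

text \<open>The \<open>j\<close>-th summand is non-zero only for the pair \<open>(2 j, 2 j + 1)\<close> in either order. Keeping the Gram
matrix as a sum over \<open>j\<close> lets \<open>wedge_power_symplectic_frame\<close> split the sum over permutations
accordingly.\<close>

definition symplectic_frame :: "('v \<Rightarrow> 'v \<Rightarrow> real) \<Rightarrow> nat \<Rightarrow> (nat \<Rightarrow> 'v) \<Rightarrow> bool" where
  "symplectic_frame B k v \<longleftrightarrow> (\<forall>a<2 * k. \<forall>b<2 * k. B (v a) (v b) =
     (\<Sum>j<k. (if a = 2 * j \<and> b = Suc (2 * j) then 1 else 0) - (if a = Suc (2 * j) \<and> b = 2 * j then 1 else 0)))"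

definition swap_pairs :: "nat \<Rightarrow> nat \<Rightarrow> nat \<Rightarrow> nat" where
  "swap_pairs j k = swap_idx (2 * j) (2 * k) \<circ> swap_idx (Suc (2 * j)) (Suc (2 * k))"

lemma swap_pairs_double: "swap_pairs j k (2 * i) = 2 * swap_idx j k i"
  and swap_pairs_Suc_double: "swap_pairs j k (Suc (2 * i)) = Suc (2 * swap_idx j k i)"
  by (auto simp: swap_pairs_def Transposition.transpose_def)

lemma swap_pairs_permutes: "j \<le> k \<Longrightarrow> swap_pairs j k permutes {..<2 * k + 2}"
  unfolding swap_pairs_def by (intro permutes_compose permutes_swap_id) auto

lemma sign_swap_pairs: "sign (swap_pairs j k) = 1"
  by (simp add: swap_pairs_def sign_compose permutation_swap_id sign_swap_id)

lemma swap_pairs_involution: "swap_pairs j k (swap_pairs j k i) = i"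
proof (cases "even i")
  case True
  then show ?thesis by (auto simp: swap_pairs_double elim: evenE)
next
  case False
  then show ?thesis by (auto simp: swap_pairs_Suc_double elim!: oddE)
qed

lemma symplectic_frame_swap_pairs:
  assumes "symplectic_frame B (Suc k) v" "j \<le> k"
  shows "symplectic_frame B k (\<lambda>i. v (swap_pairs j k i))"
  unfolding symplectic_frame_def
proof (intro allI impI)
  fix a b assume ab: "a < 2 * k" "b < 2 * k"
  let ?s = "swap_pairs j k"
  let ?d = "\<lambda>a b i. (if a = 2 * i \<and> b = Suc (2 * i) then 1 else 0) -
    (if a = Suc (2 * i) \<and> b = 2 * i then 1 else (0 :: real))"
  have lt: "?s a < 2 * Suc k" "?s b < 2 * Suc k"
    using permutes_in_image[OF swap_pairs_permutes[OF assms(2)]] ab by auto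
  have move: "?s x = y \<longleftrightarrow> x = ?s y" for x y using swap_pairs_involution by metis
  have tr: "swap_idx j k permutes {..<Suc k}" using assms(2) by (intro permutes_swap_id) auto
  have "B (v (?s a)) (v (?s b)) = (\<Sum>i<Suc k. ?d (?s a) (?s b) i)"
    using assms(1) lt unfolding symplectic_frame_def by blast
  also have "\<dots> = (\<Sum>i<Suc k. ?d a b (swap_idx j k i))"
    unfolding move swap_pairs_double swap_pairs_Suc_double ..
  also have "\<dots> = (\<Sum>i<Suc k. ?d a b i)"
    using sum.permute[OF tr, of "?d a b"] by (simp add: o_def)
  also have "\<dots> = (\<Sum>i<k. ?d a b i)" using ab by simp
  finally show "B (v (?s a)) (v (?s b)) = (\<Sum>i<k. ?d a b i)" .
qed

text \<open>In the last wedge product a permutation contributes only if the two arguments left for \<open>B\<close> form one of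
the \<open>k + 1\<close> pairs of the frame, in either order. Moving that pair to the end by an even permutation
shows that each choice contributes \<open>(2 k)!\<close> times the value on the remaining \<open>k\<close> pairs, and the
normalising factor \<open>(2 k)! 2!\<close> leaves \<open>(k + 1) k!\<close>.\<close>

lemma wedge_power_symplectic_frame:
  assumes "bilinear B" "symplectic_frame B k v"
  shows "wedge_power B k v = fact k"
  using assms(2)
proof (induction k arbitrary: v)
  case 0
  then show ?case by simp
next
  case (Suc k)
  let ?W = "wedge_power B k"
  let ?P = "{\<sigma>. \<sigma> permutes {..<2 * k + 2}}"
  let ?u = "\<lambda>\<sigma>. of_int (sign \<sigma>) * ?W (\<lambda>i. v (\<sigma> i))"
  let ?A = "\<lambda>j. {\<sigma> \<in> ?P. \<sigma> (2 * k) = 2 * j \<and> \<sigma> (Suc (2 * k)) = Suc (2 * j)}"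
  let ?A' = "\<lambda>j. {\<sigma> \<in> ?P. \<sigma> (2 * k) = Suc (2 * j) \<and> \<sigma> (Suc (2 * k)) = 2 * j}"
  let ?T = "swap_idx (2 * k) (Suc (2 * k))"
  have fin: "finite ?P" by (simp add: finite_permutations)
  have alt: "alternating (2 * k) ?W" by (rule wedge_power_alternating[OF assms(1)])
  have T: "?T permutes {..<2 * k + 2}" by (intro permutes_swap_id) auto
  \<comment> \<open>The permutations that put the \<open>j\<close>-th pair last are \<open>swap_pairs j k\<close> composed with the permutations
    of the first \<open>2 k\<close> indices.\<close>
  have A: "(\<Sum>\<sigma>\<in>?A j. ?u \<sigma>) = fact (2 * k) * fact k" if j: "j < Suc k" for j
  proof -
    let ?s = "swap_pairs j k"
    have s_last: "?s (2 * k) = 2 * j" "?s (Suc (2 * k)) = Suc (2 * j)"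
      by (simp_all add: swap_pairs_double swap_pairs_Suc_double)
    have s: "?s permutes {..<2 * k + 2}" using swap_pairs_permutes j by simp
    have "(\<Sum>\<sigma>\<in>?A j. ?u \<sigma>) = (\<Sum>\<rho> | \<rho> permutes {..<2 * k}. fact k)"
    proof (rule sum.reindex_bij_witness[of _ "\<lambda>\<rho>. ?s \<circ> \<rho>" "\<lambda>\<sigma>. ?s \<circ> \<sigma>"])
      fix \<sigma> assume \<sigma>: "\<sigma> \<in> ?A j"
      show "?s \<circ> (?s \<circ> \<sigma>) = \<sigma>" by (simp add: fun_eq_iff swap_pairs_involution)
      have "(?s \<circ> \<sigma>) permutes {..<2 * k + 2}" using \<sigma> s by (auto intro: permutes_compose)
      moreover have "(?s \<circ> \<sigma>) (2 * k) = 2 * k" "(?s \<circ> \<sigma>) (Suc (2 * k)) = Suc (2 * k)"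
        using \<sigma> by (simp_all add: swap_pairs_double swap_pairs_Suc_double)
      then have "(?s \<circ> \<sigma>) x = x" if "x \<in> {..<2 * k + 2} - {..<2 * k}" for x
        using that by (cases "x = 2 * k") (auto simp: less_Suc_eq)
      ultimately have \<rho>: "(?s \<circ> \<sigma>) permutes {..<2 * k}"
        by (rule permutes_superset)
      then show "?s \<circ> \<sigma> \<in> {\<rho>. \<rho> permutes {..<2 * k}}" by simp
      let ?\<rho> = "?s \<circ> \<sigma>"
      have \<sigma>_eq: "\<sigma> = ?s \<circ> ?\<rho>" by (simp add: fun_eq_iff swap_pairs_involution)
      have "sign \<sigma> = sign ?\<rho>"
        using \<sigma> s by (simp add: sign_compose sign_swap_pairs permutes_imp_permutation[of "{..<2 * k + 2}"])
      moreover have "?W (\<lambda>i. v (\<sigma> i)) = of_int (sign ?\<rho>) * ?W (\<lambda>i. v (?s i))"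
        using alternating_permutation[OF alt \<rho>, of "\<lambda>i. v (?s i)"] by (simp add: swap_pairs_involution)
      moreover have "?W (\<lambda>i. v (?s i)) = fact k"
        using Suc.IH symplectic_frame_swap_pairs[OF Suc.prems] j by simp
      ultimately show "fact k = ?u \<sigma>"
        by (simp add: of_int_mult[symmetric] mult.assoc[symmetric] del: of_int_mult)
    next
      fix \<rho> assume \<rho>: "\<rho> \<in> {\<rho>. \<rho> permutes {..<2 * k}}"
      show "?s \<circ> (?s \<circ> \<rho>) = \<rho>" by (simp add: fun_eq_iff swap_pairs_involution)
      have "\<rho> permutes {..<2 * k + 2}" using \<rho> by (auto intro: permutes_subset)
      then have "(?s \<circ> \<rho>) permutes {..<2 * k + 2}" using s by (rule permutes_compose)
      moreover have "\<rho> (2 * k) = 2 * k" "\<rho> (Suc (2 * k)) = Suc (2 * k)"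
        using \<rho> by (auto simp: permutes_def)
      ultimately show "?s \<circ> \<rho> \<in> ?A j" using s_last by simp
    qed
    then show ?thesis by (simp add: card_permutations[of _ "2 * k"])
  qed
  \<comment> \<open>Exchanging the last two indices relates the two orders of a pair.\<close>
  have A': "(\<Sum>\<sigma>\<in>?A' j. ?u \<sigma>) = - (fact (2 * k) * fact k)" if j: "j < Suc k" for j
  proof -
    have "(\<Sum>\<sigma>\<in>?A' j. ?u \<sigma>) = (\<Sum>\<sigma>\<in>?A j. - ?u \<sigma>)"
    proof (rule sum.reindex_bij_witness[of _ "\<lambda>\<sigma>. \<sigma> \<circ> ?T" "\<lambda>\<sigma>. \<sigma> \<circ> ?T"])
      fix \<sigma> assume \<sigma>: "\<sigma> \<in> ?A' j"
      show "\<sigma> \<circ> ?T \<circ> ?T = \<sigma>" by (simp add: fun_eq_iff)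
      show "\<sigma> \<circ> ?T \<in> ?A j" using \<sigma> permutes_compose[OF T] by simp
      have "sign (\<sigma> \<circ> ?T) = - sign \<sigma>"
        using \<sigma> by (simp add: sign_compose permutation_swap_id sign_swap_id
            permutes_imp_permutation[of "{..<2 * k + 2}"])
      moreover have "?W (\<lambda>i. v ((\<sigma> \<circ> ?T) i)) = ?W (\<lambda>i. v (\<sigma> i))"
        by (rule multilinear_form_cong[OF alternating_multilinear[OF alt]]) (simp add: Transposition.transpose_def)
      ultimately show "- ?u (\<sigma> \<circ> ?T) = ?u \<sigma>" by simp
    next
      fix \<sigma> assume \<sigma>: "\<sigma> \<in> ?A j"
      show "\<sigma> \<circ> ?T \<circ> ?T = \<sigma>" by (simp add: fun_eq_iff)
      show "\<sigma> \<circ> ?T \<in> ?A' j" using \<sigma> permutes_compose[OF T] by simp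
    qed
    then show ?thesis using A[OF j] by (simp add: sum_negf)
  qed
  have "?u \<sigma> * B (v (\<sigma> (2 * k))) (v (\<sigma> (Suc (2 * k)))) =
      (\<Sum>j<Suc k. (if \<sigma> \<in> ?A j then ?u \<sigma> else 0) - (if \<sigma> \<in> ?A' j then ?u \<sigma> else 0))"
    if "\<sigma> \<in> ?P" for \<sigma>
  proof -
    have "\<sigma> (2 * k) < 2 * Suc k" "\<sigma> (Suc (2 * k)) < 2 * Suc k"
      using that permutes_in_image[of \<sigma> "{..<2 * k + 2}"] by auto
    then have *: "B (v (\<sigma> (2 * k))) (v (\<sigma> (Suc (2 * k)))) = (\<Sum>j<Suc k.
        (if \<sigma> (2 * k) = 2 * j \<and> \<sigma> (Suc (2 * k)) = Suc (2 * j) then 1 else 0) -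
        (if \<sigma> (2 * k) = Suc (2 * j) \<and> \<sigma> (Suc (2 * k)) = 2 * j then 1 else 0))"
      using Suc.prems unfolding symplectic_frame_def by blast
    show ?thesis unfolding * sum_distrib_left by (rule sum.cong) (use that in auto)
  qed
  then have "(\<Sum>\<sigma>\<in>?P. ?u \<sigma> * B (v (\<sigma> (2 * k))) (v (\<sigma> (Suc (2 * k))))) =
      (\<Sum>\<sigma>\<in>?P. \<Sum>j<Suc k. (if \<sigma> \<in> ?A j then ?u \<sigma> else 0) - (if \<sigma> \<in> ?A' j then ?u \<sigma> else 0))"
    by (intro sum.cong refl)
  also have "\<dots> = (\<Sum>j<Suc k. (\<Sum>\<sigma>\<in>?P. if \<sigma> \<in> ?A j then ?u \<sigma> else 0) -
      (\<Sum>\<sigma>\<in>?P. if \<sigma> \<in> ?A' j then ?u \<sigma> else 0))"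
    by (subst sum.swap) (simp only: sum_subtractf)
  also have "\<dots> = (\<Sum>j<Suc k. (\<Sum>\<sigma>\<in>?A j. ?u \<sigma>) - (\<Sum>\<sigma>\<in>?A' j. ?u \<sigma>))"
  proof (rule sum.cong[OF refl])
    fix j
    have restrict: "(\<Sum>\<sigma>\<in>?P. if \<sigma> \<in> X then ?u \<sigma> else 0) = (\<Sum>\<sigma>\<in>X. ?u \<sigma>)" if "X \<subseteq> ?P" for X
      using that fin by (simp add: sum.If_cases Int_absorb1)
    have "?A j \<subseteq> ?P" "?A' j \<subseteq> ?P" by blast+
    from this[THEN restrict] show "(\<Sum>\<sigma>\<in>?P. if \<sigma> \<in> ?A j then ?u \<sigma> else 0) - (\<Sum>\<sigma>\<in>?P. if \<sigma> \<in> ?A' j then ?u \<sigma> else 0) =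
        (\<Sum>\<sigma>\<in>?A j. ?u \<sigma>) - (\<Sum>\<sigma>\<in>?A' j. ?u \<sigma>)"
      by (simp only:)
  qed
  also have "\<dots> = (\<Sum>j<Suc k. 2 * (fact (2 * k) * fact k))"
    by (rule sum.cong[OF refl]) (simp only: A A' lessThan_iff)
  also have "\<dots> = 2 * fact (2 * k) * fact (Suc k)" by simp
  finally show ?case by (simp add: wedge_def)
qed

subsection \<open>Change of frame\<close>

text \<open>Expands the first \<open>k\<close> arguments by linearity, so that the induction on \<open>k\<close> replaces one argument at a
time.\<close>

lemma alternating_expand:
  assumes alt: "alternating m \<mu>" and "\<And>i. i < m \<Longrightarrow> v i = (\<Sum>j<m. a i j *\<^sub>R e j)" and "k \<le> m"
  shows "\<mu> v = (\<Sum>f \<in> {..<k} \<rightarrow>\<^sub>E {..<m}. (\<Prod>i<k. a i (f i)) * \<mu> (\<lambda>i. if i < k then e (f i) else v i))"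
  using assms(3)
proof (induction k)
  case 0
  then show ?case by simp
next
  case (Suc k)
  then have k: "k < m" by simp
  let ?w = "\<lambda>f i. if i < k then e (f i) else v i"
  have step: "(\<Prod>i<k. a i (f i)) * \<mu> (?w f) =
      (\<Sum>j<m. (\<Prod>i<Suc k. a i ((f(k := j)) i)) * \<mu> (\<lambda>i. if i < Suc k then e ((f(k := j)) i) else v i))"
    for f
  proof -
    have lin: "linear (\<lambda>x. \<mu> ((?w f)(k := x)))"
      using multilinear_form_linear[OF alternating_multilinear[OF alt] k] .
    have "\<mu> (?w f) = \<mu> ((?w f)(k := \<Sum>j<m. a k j *\<^sub>R e j))"
      using assms(2)[OF k] by (intro arg_cong[of _ _ \<mu>]) auto
    also have "\<dots> = (\<Sum>j<m. a k j * \<mu> ((?w f)(k := e j)))"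
      by (simp add: linear_sum[OF lin] linear_cmul[OF lin])
    also have "\<dots> = (\<Sum>j<m. a k j * \<mu> (\<lambda>i. if i < Suc k then e ((f(k := j)) i) else v i))"
      by (intro sum.cong refl arg_cong2[of _ _ _ _ "(*)"] arg_cong[of _ _ \<mu>]) auto
    finally show ?thesis
      by (simp add: sum_distrib_left mult_ac)
  qed
  have "\<mu> v = (\<Sum>f \<in> {..<k} \<rightarrow>\<^sub>E {..<m}. \<Sum>j<m. (\<Prod>i<Suc k. a i ((f(k := j)) i)) *
      \<mu> (\<lambda>i. if i < Suc k then e ((f(k := j)) i) else v i))"
    unfolding step[symmetric] using Suc by simp
  also have "\<dots> = (\<Sum>(j, f) \<in> {..<m} \<times> ({..<k} \<rightarrow>\<^sub>E {..<m}). (\<Prod>i<Suc k. a i ((f(k := j)) i)) *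
      \<mu> (\<lambda>i. if i < Suc k then e ((f(k := j)) i) else v i))"
    by (subst sum.swap) (rule sum.cartesian_product)
  also have "\<dots> = (\<Sum>f \<in> (\<lambda>(j, f). f(k := j)) ` ({..<m} \<times> ({..<k} \<rightarrow>\<^sub>E {..<m})).
      (\<Prod>i<Suc k. a i (f i)) * \<mu> (\<lambda>i. if i < Suc k then e (f i) else v i))"
    by (subst sum.reindex[OF inj_combinator]) (simp, unfold case_prod_beta o_def, rule refl)
  also have "(\<lambda>(j, f). f(k := j)) ` ({..<m} \<times> ({..<k} \<rightarrow>\<^sub>E {..<m})) = {..<Suc k} \<rightarrow>\<^sub>E {..<m}"
    unfolding lessThan_Suc PiE_insert_eq ..
  finally show ?case .
qed

text \<open>After the full expansion, index maps with a repeated value contribute nothing, and the others are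
permutations. The factor is the determinant of \<open>a\<close>.\<close>

lemma alternating_change_of_frame:
  assumes alt: "alternating m \<mu>" and v: "\<And>i. i < m \<Longrightarrow> v i = (\<Sum>j<m. a i j *\<^sub>R e j)"
  shows "\<mu> v = (\<Sum>\<sigma> | \<sigma> permutes {..<m}. of_int (sign \<sigma>) * (\<Prod>i<m. a i (\<sigma> i))) * \<mu> e"
proof -
  let ?F = "{..<m} \<rightarrow>\<^sub>E {..<m}"
  let ?t = "\<lambda>f. (\<Prod>i<m. a i (f i)) * \<mu> (\<lambda>i. e (f i))"
  have ml: "multilinear_form m \<mu>" using alt by (rule alternating_multilinear)
  have "\<mu> v = (\<Sum>f\<in>?F. (\<Prod>i<m. a i (f i)) * \<mu> (\<lambda>i. if i < m then e (f i) else v i))"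
    using alternating_expand[OF alt v order_refl] .
  also have "\<dots> = (\<Sum>f\<in>?F. ?t f)"
    by (intro sum.cong refl arg_cong2[of _ _ _ _ "(*)"] multilinear_form_cong[OF ml]) auto
  also have "\<dots> = (\<Sum>f\<in>{f \<in> ?F. inj_on f {..<m}}. ?t f)"
  proof (rule sum.mono_neutral_right)
    show "finite ?F" by (intro finite_PiE) auto
    show "\<forall>f\<in>?F - {f \<in> ?F. inj_on f {..<m}}. ?t f = 0"
    proof
      fix f assume "f \<in> ?F - {f \<in> ?F. inj_on f {..<m}}"
      then obtain i j where "i < m" "j < m" "i \<noteq> j" "f i = f j" by (auto simp: inj_on_def)
      then have "\<mu> (\<lambda>i. e (f i)) = 0" by (intro alternating_eq_zero[OF alt, of i j]) auto
      then show "?t f = 0" by simp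
    qed
  qed auto
  also have "\<dots> = (\<Sum>\<sigma> | \<sigma> permutes {..<m}. ?t \<sigma>)"
  proof (rule sum.reindex_bij_witness[of _ "\<lambda>\<sigma>. restrict \<sigma> {..<m}" "\<lambda>f i. if i < m then f i else i"])
    fix f assume f: "f \<in> {f \<in> ?F. inj_on f {..<m}}"
    let ?g = "\<lambda>i. if i < m then f i else i"
    show "restrict ?g {..<m} = f"
      using f by (auto simp: fun_eq_iff PiE_def extensional_def)
    have "inj_on ?g {..<m}" using f by (auto simp: inj_on_def)
    moreover from this have "?g ` {..<m} = {..<m}"
      using f by (intro endo_inj_surj) auto
    ultimately have "bij_betw ?g {..<m} {..<m}" by (rule bij_betw_imageI)
    then show "?g \<in> {\<sigma>. \<sigma> permutes {..<m}}" by (intro CollectI bij_imp_permutes) auto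
    show "?t ?g = ?t f"
      by (intro arg_cong2[of _ _ _ _ "(*)"] multilinear_form_cong[OF ml] prod.cong refl) auto
  next
    fix \<sigma> assume \<sigma>: "\<sigma> \<in> {\<sigma>. \<sigma> permutes {..<m}}"
    then show "(\<lambda>i. if i < m then restrict \<sigma> {..<m} i else i) = \<sigma>"
      by (auto simp: fun_eq_iff permutes_def)
    show "restrict \<sigma> {..<m} \<in> {f \<in> ?F. inj_on f {..<m}}"
      using \<sigma> permutes_in_image[of \<sigma> "{..<m}"]
      by (auto simp: inj_on_def dest: injD[OF permutes_inj])
  qed
  also have "\<dots> = (\<Sum>\<sigma> | \<sigma> permutes {..<m}. of_int (sign \<sigma>) * (\<Prod>i<m. a i (\<sigma> i)) * \<mu> e)"
    using alternating_permutation[OF alt] by (intro sum.cong) auto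
  finally show ?thesis by (simp add: sum_distrib_right)
qed

text \<open>Invariance of the determinant under transposition, by substituting the inverse permutation.\<close>

lemma signed_permutation_sum_transpose:
  fixes m :: nat
  shows "(\<Sum>\<sigma> | \<sigma> permutes {..<m}. of_int (sign \<sigma>) * (\<Prod>i<m. a i (\<sigma> i))) =
   (\<Sum>\<sigma> | \<sigma> permutes {..<m}. of_int (sign \<sigma>) * (\<Prod>i<m. a (\<sigma> i) i :: real))"
proof -
  have "of_int (sign (inv \<sigma>)) * (\<Prod>i<m. a i (inv \<sigma> i)) = of_int (sign \<sigma>) * (\<Prod>i<m. a (\<sigma> i) i)"
    if "\<sigma> permutes {..<m}" for \<sigma>
  proof -
    have "(\<Prod>i<m. a i (inv \<sigma> i)) = (\<Prod>i<m. a (\<sigma> i) i)"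
      using prod.permute[OF that, of "\<lambda>i. a i (inv \<sigma> i)"] by (simp add: o_def permutes_inverses[OF that])
    moreover have "permutation \<sigma>" using that by (rule permutes_imp_permutation[rotated]) simp
    ultimately show ?thesis by (simp add: sign_inverse)
  qed
  then show ?thesis by (subst sum_permutations_inverse) (auto intro: sum.cong)
qed

text \<open>The matrices expressing \<open>v\<close> in terms of \<open>e\<close> and \<open>e\<close> in terms of \<open>v\<close> are transposes of each other and
have the same determinant \<open>d\<close>, so that \<open>\<mu> v = d \<mu> e = d\<^sup>2 \<mu> v\<close>.\<close>

lemma (in inner_form) alternating_orthonormal:
  assumes alt: "alternating (DIM('e)) \<mu>"
    and v: "orthonormal (DIM('e)) v" and e: "orthonormal (DIM('e)) e"
  shows "\<bar>\<mu> v\<bar> = \<bar>\<mu> e\<bar>"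
proof -
  define d where "d = (\<Sum>\<sigma> | \<sigma> permutes {..<DIM('e)}. of_int (sign \<sigma>) * (\<Prod>i<DIM('e). g (v i) (e (\<sigma> i))))"
  have 1: "\<mu> v = d * \<mu> e"
    unfolding d_def by (rule alternating_change_of_frame[OF alt]) (simp add: orthonormal_expansion[OF e])
  have "d = (\<Sum>\<sigma> | \<sigma> permutes {..<DIM('e)}. of_int (sign \<sigma>) * (\<Prod>i<DIM('e). g (e i) (v (\<sigma> i))))"
    unfolding d_def signed_permutation_sum_transpose[where a = "\<lambda>i j. g (v i) (e j)"] by (simp add: sym)
  moreover have "\<mu> e =
      (\<Sum>\<sigma> | \<sigma> permutes {..<DIM('e)}. of_int (sign \<sigma>) * (\<Prod>i<DIM('e). g (e i) (v (\<sigma> i)))) * \<mu> v"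
    by (rule alternating_change_of_frame[OF alt]) (simp add: orthonormal_expansion[OF v])
  ultimately have 2: "\<mu> e = d * \<mu> v" by simp
  show ?thesis
  proof (cases "\<mu> v = 0")
    case False
    have "\<mu> v = d * (d * \<mu> v)" by (subst 2[symmetric]) (rule 1)
    with False have "d * d = 1" by simp
    then have "d = 1 \<or> d = - 1" by (simp add: square_eq_1_iff)
    then show ?thesis using 1 by auto
  qed (use 2 in simp)
qed

text \<open>Compare the given frame with a \<open>J\<close>-unitary one, which is symplectic for \<open>g(J \<cdot>, \<cdot>)\<close>.\<close>

lemma (in inner_form) wedge_power_orthonormal:
  assumes J: "linear J" "\<And>v. J (J v) = - v" "\<And>u v. g (J u) v = - g u (J v)"
    and n: "DIM('e) = 2 * n" and v: "orthonormal (2 * n) v"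
  shows "\<bar>wedge_power (\<lambda>u v. g (J u) v) n v\<bar> = fact n"
proof -
  let ?B = "\<lambda>u v. g (J u) v"
  have bil: "bilinear ?B" using J(1) by (auto simp: bilinear_def linear_iff)
  obtain e where e: "orthonormal (2 * n) e" "\<forall>i<n. e (Suc (2 * i)) = J (e (2 * i))"
    using unitary_frame_exists[OF J(2,3), of n] n by auto
  have "symplectic_frame ?B n e"
    unfolding symplectic_frame_def
  proof (intro allI impI)
    fix a b assume ab: "a < 2 * n" "b < 2 * n"
    show "?B (e a) (e b) = (\<Sum>j<n. (if a = 2 * j \<and> b = Suc (2 * j) then 1 else 0) -
        (if a = Suc (2 * j) \<and> b = 2 * j then 1 else 0))"
    proof (cases "even a")
      case True
      then obtain i where i: "a = 2 * i" "i < n" using ab(1) by (auto elim: evenE)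
      then have "?B (e a) (e b) = (if b = Suc (2 * i) then 1 else 0)"
        using e ab by (auto simp: orthonormal_def simp flip: e(2)[rule_format])
      moreover have "(\<Sum>j<n. (if a = 2 * j \<and> b = Suc (2 * j) then 1 else 0) -
        (if a = Suc (2 * j) \<and> b = 2 * j then 1 else 0)) = (\<Sum>j<n. if j = i then if b = Suc (2 * i) then 1 else 0 else (0::real))"
        by (rule sum.cong[OF refl]) (auto simp: i, presburger?)
      ultimately show ?thesis using i by simp
    next
      case False
      then obtain i where i: "a = Suc (2 * i)" "i < n" using ab(1) by (auto elim!: oddE)
      have "?B (e a) (e b) = - (if b = 2 * i then 1 else 0)"
        using e ab i by (auto simp: orthonormal_def J(2))
      moreover have "(\<Sum>j<n. (if a = 2 * j \<and> b = Suc (2 * j) then 1 else 0) -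
        (if a = Suc (2 * j) \<and> b = 2 * j then 1 else 0)) = (\<Sum>j<n. if j = i then - (if b = 2 * i then 1 else 0) else (0::real))"
        by (rule sum.cong[OF refl]) (auto simp: i, presburger?)
      ultimately show ?thesis using i by simp
    qed
  qed
  from wedge_power_symplectic_frame[OF bil this]
  show ?thesis
    using alternating_orthonormal[of "wedge_power ?B n" v e] wedge_power_alternating[OF bil, of n] v e(1) n
    by simp
qed

section \<open>Fields of endomorphisms on open subsets of a Euclidean space\<close>

definition smooth_endo :: "'e::euclidean_space set \<Rightarrow> ('e \<Rightarrow> 'e \<Rightarrow> 'e) \<Rightarrow> bool" where
  "smooth_endo U L \<longleftrightarrow> (\<forall>x\<in>U. linear (L x)) \<and> (\<forall>v. smooth_on (\<lambda>x. L x v) U)"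

definition endo_deriv :: "('e::euclidean_space \<Rightarrow> 'e \<Rightarrow> 'e) \<Rightarrow> 'e \<Rightarrow> 'e \<Rightarrow> 'e \<Rightarrow> 'e" where
  "endo_deriv L x u v = frechet_derivative (\<lambda>y. L y v) (at x) u"

lemma smooth_endo_linear: "smooth_endo U L \<Longrightarrow> x \<in> U \<Longrightarrow> linear (L x)"
  by (simp add: smooth_endo_def)

lemma smooth_endo_smooth: "smooth_endo U L \<Longrightarrow> smooth_on (\<lambda>x. L x v) U"
  by (simp add: smooth_endo_def)

lemma smooth_endo_subset: "smooth_endo U L \<Longrightarrow> V \<subseteq> U \<Longrightarrow> smooth_endo V L"
  unfolding smooth_endo_def using smooth_on_subset by blast

lemma endo_has_derivative_const:
  "smooth_endo U L \<Longrightarrow> x \<in> U \<Longrightarrow> ((\<lambda>y. L y v) has_derivative (\<lambda>u. endo_deriv L x u v)) (at x)"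
  unfolding endo_deriv_def by (rule smooth_on_has_derivative[OF smooth_endo_smooth])

lemma linear_endo_deriv_direction:
  "smooth_endo U L \<Longrightarrow> x \<in> U \<Longrightarrow> linear (\<lambda>u. endo_deriv L x u v)"
  using endo_has_derivative_const has_derivative_linear by blast

lemma endo_apply_basis: "linear F \<Longrightarrow> F v = (\<Sum>b\<in>Basis. (v \<bullet> b) *\<^sub>R F b)"
  using arg_cong[OF euclidean_representation[of v, symmetric], of F]
  by (simp add: linear_sum linear_cmul)

text \<open>Writing the moving argument in the standard basis reduces the product rule to fields with constant
arguments, which are all that the notion of a smooth field speaks about.\<close>

lemma endo_has_derivative_basis:
  assumes U: "open U" "x \<in> U" and L: "smooth_endo U L" and X: "(X has_derivative X') (at x)"
  shows "((\<lambda>y. L y (X y)) has_derivative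
    (\<lambda>u. \<Sum>b\<in>Basis. (X x \<bullet> b) *\<^sub>R endo_deriv L x u b + (X' u \<bullet> b) *\<^sub>R L x b)) (at x)"
proof -
  have "((\<lambda>y. \<Sum>b\<in>Basis. (X y \<bullet> b) *\<^sub>R L y b) has_derivative
    (\<lambda>u. \<Sum>b\<in>Basis. (X x \<bullet> b) *\<^sub>R endo_deriv L x u b + (X' u \<bullet> b) *\<^sub>R L x b)) (at x)"
    by (intro has_derivative_sum has_derivative_scaleR has_derivative_inner_left X
        endo_has_derivative_const[OF L U(2)])
  then show ?thesis
  proof (rule has_derivative_transform_within_open[OF _ U])
    show "(\<Sum>b\<in>Basis. (X y \<bullet> b) *\<^sub>R L y b) = L y (X y)" if "y \<in> U" for y
      using endo_apply_basis[OF smooth_endo_linear[OF L that]] by metis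
  qed
qed

lemma linear_endo_deriv:
  assumes U: "open U" "x \<in> U" and L: "smooth_endo U L"
  shows "linear (endo_deriv L x u)"
proof -
  have "endo_deriv L x u v = (\<Sum>b\<in>Basis. (v \<bullet> b) *\<^sub>R endo_deriv L x u b)" for v
    using frechet_derivativeI[OF endo_has_derivative_basis[OF U L has_derivative_const[of v]]]
    by (simp add: endo_deriv_def)
  then have "endo_deriv L x u = (\<lambda>v. \<Sum>b\<in>Basis. (v \<bullet> b) *\<^sub>R endo_deriv L x u b)"
    by (rule ext)
  moreover have "linear (\<lambda>v. \<Sum>b\<in>Basis. (v \<bullet> b) *\<^sub>R endo_deriv L x u b)"
    by (intro linear_compose_sum ballI linearI) (auto simp: inner_add_left scaleR_add_left)
  ultimately show ?thesis by (rule ssubst[of _ _ linear])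
qed

lemma endo_has_derivative:
  assumes U: "open U" "x \<in> U" and L: "smooth_endo U L" and X: "(X has_derivative X') (at x)"
  shows "((\<lambda>y. L y (X y)) has_derivative (\<lambda>u. endo_deriv L x u (X x) + L x (X' u))) (at x)"
proof (rule has_derivative_eq_rhs[OF endo_has_derivative_basis[OF assms]], rule ext)
  fix u
  show "(\<Sum>b\<in>Basis. (X x \<bullet> b) *\<^sub>R endo_deriv L x u b + (X' u \<bullet> b) *\<^sub>R L x b) =
      endo_deriv L x u (X x) + L x (X' u)"
    unfolding sum.distrib
    by (rule arg_cong2[of _ _ _ _ "(+)", OF endo_apply_basis[OF linear_endo_deriv[OF U L], symmetric]
          endo_apply_basis[OF smooth_endo_linear[OF L U(2)], symmetric]])
qed

lemma smooth_endo_apply: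
  assumes U: "open U" and L: "smooth_endo U L" and X: "smooth_on X U"
  shows "smooth_on (\<lambda>y. L y (X y)) U"
proof (rule smooth_on_cong[OF U])
  show "smooth_on (\<lambda>y. \<Sum>b\<in>Basis. (X y \<bullet> b) *\<^sub>R L y b) U"
    by (intro smooth_on_sum smooth_on_scaleR smooth_on_inner_const U X smooth_endo_smooth[OF L])
  show "(\<Sum>b\<in>Basis. (X y \<bullet> b) *\<^sub>R L y b) = L y (X y)" if "y \<in> U" for y
    using endo_apply_basis[OF smooth_endo_linear[OF L that]] by metis
qed

lemma smooth_endo_compose:
  assumes U: "open U" and "smooth_endo U K" "smooth_endo U L"
  shows "smooth_endo U (\<lambda>x v. K x (L x v))"
  unfolding smooth_endo_def
proof (intro conjI ballI allI)
  show "linear (\<lambda>v. K x (L x v))" if "x \<in> U" for x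
    using linear_compose[of "L x" "K x"] assms(2,3) that by (simp add: o_def smooth_endo_linear)
  show "smooth_on (\<lambda>x. K x (L x v)) U" for v
    by (rule smooth_endo_apply[OF assms(1,2) smooth_endo_smooth[OF assms(3)]])
qed

lemma smooth_endo_scale_add:
  assumes U: "open U" and "smooth_endo U L"
  shows "smooth_endo U (\<lambda>x v. a *\<^sub>R v + L x v)"
  unfolding smooth_endo_def
proof (intro conjI ballI allI)
  show "linear (\<lambda>v. a *\<^sub>R v + L x v)" if "x \<in> U" for x
    by (intro linear_compose_add linear_scale_self smooth_endo_linear[OF assms(2) that])
  show "smooth_on (\<lambda>x. a *\<^sub>R v + L x v) U" for v
    by (intro smooth_on_add smooth_on_const U smooth_endo_smooth[OF assms(2)])
qed

lemma smooth_endo_cong: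
  assumes "open U" "smooth_endo U L" "\<And>x v. x \<in> U \<Longrightarrow> L x v = K x v"
  shows "smooth_endo U K"
  unfolding smooth_endo_def
proof (intro conjI ballI allI)
  show "linear (K x)" if "x \<in> U" for x
    using smooth_endo_linear[OF assms(2) that] assms(3)[OF that] by (simp add: linear_iff)
  show "smooth_on (\<lambda>x. K x v) U" for v
    by (rule smooth_on_cong[OF assms(1) _ smooth_endo_smooth[OF assms(2)]]) (rule assms(3))
qed

lemma endo_deriv_cong:
  assumes "open U" "x \<in> U" "smooth_endo U L" "\<And>x v. x \<in> U \<Longrightarrow> L x v = K x v"
  shows "endo_deriv K x u v = endo_deriv L x u v"
proof -
  have "((\<lambda>y. K y v) has_derivative (\<lambda>u. endo_deriv L x u v)) (at x)"
    using endo_has_derivative_const[OF assms(3,2)] assms(1,2)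
    by (rule has_derivative_transform_within_open) (rule assms(4))
  then show ?thesis by (simp add: endo_deriv_def frechet_derivativeI)
qed

lemma endo_deriv_compose:
  assumes U: "open U" "x \<in> U" and "smooth_endo U K" "smooth_endo U L"
  shows "endo_deriv (\<lambda>x v. K x (L x v)) x u v = endo_deriv K x u (L x v) + K x (endo_deriv L x u v)"
  using frechet_derivativeI[OF endo_has_derivative[OF assms(1-3) endo_has_derivative_const[OF assms(4,2)]]]
  unfolding endo_deriv_def by (rule fun_cong)

lemma endo_deriv_scale_add:
  assumes U: "open U" "x \<in> U" and "smooth_endo U L"
  shows "endo_deriv (\<lambda>x v. a *\<^sub>R v + L x v) x u v = endo_deriv L x u v"
proof -
  have "((\<lambda>y. a *\<^sub>R v + L y v) has_derivative (\<lambda>u. 0 + endo_deriv L x u v)) (at x)"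
    by (intro has_derivative_add has_derivative_const endo_has_derivative_const[OF assms(3,2)])
  from frechet_derivativeI[OF this] show ?thesis by (simp add: endo_deriv_def)
qed

lemma smooth_endo_opoly:
  assumes U: "open U" and L: "smooth_endo U L"
  shows "smooth_endo U (\<lambda>x. opoly q (L x))"
proof (induction q)
  case 0
  show ?case by (simp add: smooth_endo_def smooth_on_const[OF U] linear_zero)
next
  case (pCons a q)
  show ?case
    by (rule smooth_endo_cong[OF U smooth_endo_scale_add[OF U smooth_endo_compose[OF U L pCons(2)], of a]])
      (simp add: opoly_pCons smooth_endo_linear[OF L])
qed

subsection \<open>The Nijenhuis tensor in coordinates\<close>

text \<open>Polarised coordinate form of the Nijenhuis tensor: for commuting \<open>K\<close> and \<open>L\<close> this is
\<open>[K u, L v] + K L [u, v] - L [K u, v] - K [u, L v]\<close>, in which the derivatives of \<open>u\<close> and \<open>v\<close> cancel. The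
Nijenhuis tensor itself is the case \<open>K = L\<close>; two different fields are needed to reach polynomials.\<close>

definition nijenhuis_rep ::
  "('e::euclidean_space \<Rightarrow> 'e \<Rightarrow> 'e) \<Rightarrow> ('e \<Rightarrow> 'e \<Rightarrow> 'e) \<Rightarrow> 'e \<Rightarrow> 'e \<Rightarrow> 'e \<Rightarrow> 'e" where
  "nijenhuis_rep K L x u v = endo_deriv L x (K x u) v - endo_deriv K x (L x v) u
     + L x (endo_deriv K x v u) - K x (endo_deriv L x u v)"

lemma nijenhuis_rep_swap:
  "nijenhuis_rep K L x u v = - nijenhuis_rep L K x v u"
  by (simp add: nijenhuis_rep_def)

lemma nijenhuis_rep_cong:
  assumes "open U" "x \<in> U" "smooth_endo U L" "\<And>x v. x \<in> U \<Longrightarrow> L x v = L' x v"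
  shows "nijenhuis_rep K L' x u v = nijenhuis_rep K L x u v"
  using endo_deriv_cong[OF assms] assms(4)[OF assms(2)] by (simp add: nijenhuis_rep_def)

text \<open>The polarised tensor is a derivation in its second field, so the fields that commute with \<open>K\<close> and have
vanishing bracket with it are closed under products.\<close>

lemma nijenhuis_rep_compose:
  assumes U: "open U" "x \<in> U" and K: "smooth_endo U K" and L: "smooth_endo U L" and P: "smooth_endo U P"
    and comm: "\<And>v. K x (L x v) = L x (K x v)"
  shows "nijenhuis_rep K (\<lambda>x v. L x (P x v)) x u v =
    nijenhuis_rep K L x u (P x v) + L x (nijenhuis_rep K P x u v)"
  using smooth_endo_linear[OF L U(2)] smooth_endo_linear[OF K U(2)] comm
  by (simp add: nijenhuis_rep_def endo_deriv_compose[OF U L P] linear_add linear_diff)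

lemma nijenhuis_rep_scale_add:
  assumes U: "open U" "x \<in> U" and K: "smooth_endo U K" and L: "smooth_endo U L"
  shows "nijenhuis_rep K (\<lambda>x v. a *\<^sub>R v + L x v) x u v = nijenhuis_rep K L x u v"
  by (simp add: nijenhuis_rep_def endo_deriv_scale_add[OF U L]
      linear_add[OF linear_endo_deriv_direction[OF K U(2)]]
      linear_cmul[OF linear_endo_deriv_direction[OF K U(2)]])

lemma nijenhuis_rep_opoly_right:
  assumes U: "open U" and K: "smooth_endo U K" and L: "smooth_endo U L"
    and comm: "\<And>x v. x \<in> U \<Longrightarrow> K x (L x v) = L x (K x v)"
    and zero: "\<And>x u v. x \<in> U \<Longrightarrow> nijenhuis_rep K L x u v = 0" and x: "x \<in> U"
  shows "nijenhuis_rep K (\<lambda>x. opoly q (L x)) x u v = 0"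
proof (induction q arbitrary: u v)
  case 0
  show ?case
    by (simp add: nijenhuis_rep_def endo_deriv_def linear_0[OF smooth_endo_linear[OF K x]]
        linear_0[OF linear_endo_deriv_direction[OF K x, unfolded endo_deriv_def]])
next
  case (pCons a q)
  let ?P = "\<lambda>x. opoly q (L x)"
  have P: "smooth_endo U ?P" by (rule smooth_endo_opoly[OF U L])
  have LP: "smooth_endo U (\<lambda>x v. L x (?P x v))" by (rule smooth_endo_compose[OF U L P])
  have "nijenhuis_rep K (\<lambda>x. opoly (pCons a q) (L x)) x u v =
      nijenhuis_rep K (\<lambda>x v. a *\<^sub>R v + L x (?P x v)) x u v"
    by (rule nijenhuis_rep_cong[OF U x smooth_endo_scale_add[OF U LP]])
      (simp add: opoly_pCons smooth_endo_linear[OF L])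
  also have "\<dots> = nijenhuis_rep K L x u (?P x v) + L x (nijenhuis_rep K ?P x u v)"
    using nijenhuis_rep_scale_add[OF U x K LP, of a u v] nijenhuis_rep_compose[OF U x K L P, OF comm[OF x], of u v]
    by (rule trans)
  also have "\<dots> = 0"
    by (simp only: pCons(2) zero[OF x] linear_0[OF smooth_endo_linear[OF L x]] add_0_left)
  finally show ?case .
qed

text \<open>First \<open>L\<close> is paired with \<open>q(L)\<close>; by antisymmetry \<open>q(L)\<close> has vanishing bracket with \<open>L\<close>, hence also
with \<open>q(L)\<close>.\<close>

lemma nijenhuis_rep_opoly:
  assumes U: "open U" and L: "smooth_endo U L"
    and zero: "\<And>x u v. x \<in> U \<Longrightarrow> nijenhuis_rep L L x u v = 0" and x: "x \<in> U"
  shows "nijenhuis_rep (\<lambda>x. opoly q (L x)) (\<lambda>x. opoly q (L x)) x u v = 0"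
proof (rule nijenhuis_rep_opoly_right[OF U smooth_endo_opoly[OF U L] L _ _ x])
  fix y u v assume y: "y \<in> U"
  show "opoly q (L y) (L y v) = L y (opoly q (L y) v)"
    by (rule opoly_commute[OF smooth_endo_linear[OF L y]])
  show "nijenhuis_rep (\<lambda>x. opoly q (L x)) L y u v = 0"
    using nijenhuis_rep_opoly_right[OF U L L refl zero y] nijenhuis_rep_swap[of _ L] by simp
qed

subsection \<open>Traces of powers\<close>

lemma endo_trace_add_diff:
  "endo_trace (\<lambda>v. F v + G v) = endo_trace F + endo_trace G"
  "endo_trace (\<lambda>v. F v - G v) = endo_trace F - endo_trace G"
  by (simp_all add: endo_trace_def inner_add_left inner_diff_left sum.distrib sum_subtractf)

lemma endo_trace_opoly: "endo_trace (opoly q L) = (\<Sum>i\<le>degree q. coeff q i * endo_trace (L ^^ i))"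
  unfolding endo_trace_def opoly_def
  by (simp add: inner_sum_left sum_distrib_left sum.swap[of _ _ Basis])

lemma endo_trace_has_derivative:
  assumes "smooth_endo U L" "x \<in> U"
  shows "((\<lambda>y. endo_trace (L y)) has_derivative (\<lambda>u. endo_trace (endo_deriv L x u))) (at x)"
  unfolding endo_trace_def
  by (intro has_derivative_sum has_derivative_inner_left endo_has_derivative_const[OF assms])

lemma smooth_endo_power:
  assumes U: "open U" and L: "smooth_endo U L"
  shows "smooth_endo U (\<lambda>x. L x ^^ k)"
proof (induction k)
  case 0
  show ?case by (simp add: smooth_endo_def smooth_on_const[OF U] id_def linear_iff)
next
  case (Suc k)
  then show ?case using smooth_endo_compose[OF U L Suc] by (simp add: o_def)
qed

text \<open>By cyclicity all terms of the product rule for \<open>L\<^sup>k\<^sup>+\<^sup>1\<close> have the same trace.\<close>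

lemma endo_trace_power_deriv:
  assumes U: "open U" and L: "smooth_endo U L" and x: "x \<in> U"
  shows "endo_trace (endo_deriv (\<lambda>x. L x ^^ Suc k) x u) =
    real (Suc k) * endo_trace (\<lambda>v. (L x ^^ k) (endo_deriv L x u v))"
proof -
  let ?D = "endo_deriv L x u"
  have lin: "linear ?D" "linear (L x)" "linear (L x ^^ i)" for i
    using linear_endo_deriv[OF U x L] smooth_endo_linear[OF L x] linear_funpow by auto
  have Dk: "endo_deriv (\<lambda>x. L x ^^ Suc k) x u v =
      ?D ((L x ^^ k) v) + L x (endo_deriv (\<lambda>x. L x ^^ k) x u v)" for k v
    using endo_deriv_compose[OF U x L smooth_endo_power[OF U L]] by (simp add: o_def)
  have power_Suc_right: "(L x ^^ Suc m) y = (L x ^^ m) (L x y)" for m y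
    by (simp add: funpow_swap1)
  \<comment> \<open>The extra power \<open>m\<close> absorbs the factors of \<open>L\<close> that the product rule splits off.\<close>
  have "endo_trace (\<lambda>v. (L x ^^ m) (endo_deriv (\<lambda>x. L x ^^ Suc k) x u v)) =
      real (Suc k) * endo_trace (\<lambda>v. (L x ^^ (m + k)) (?D v))" for m
  proof (induction k arbitrary: m)
    case 0
    have "endo_deriv (\<lambda>x. L x ^^ Suc 0) x u v = ?D v" for v by simp
    then show ?case by simp
  next
    case (Suc k)
    have "(L x ^^ m) (endo_deriv (\<lambda>x. L x ^^ Suc (Suc k)) x u v) =
       (L x ^^ m) (?D ((L x ^^ Suc k) v)) +
       (L x ^^ Suc m) (endo_deriv (\<lambda>x. L x ^^ Suc k) x u v)" for v
      by (simp only: Dk[of "Suc k"] linear_add[OF lin(3)] power_Suc_right[of m])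
    then have "endo_trace (\<lambda>v. (L x ^^ m) (endo_deriv (\<lambda>x. L x ^^ Suc (Suc k)) x u v)) =
       endo_trace (\<lambda>v. (L x ^^ m) (?D ((L x ^^ Suc k) v))) +
       endo_trace (\<lambda>v. (L x ^^ Suc m) (endo_deriv (\<lambda>x. L x ^^ Suc k) x u v))"
      by (simp only: endo_trace_add_diff)
    also have "endo_trace (\<lambda>v. (L x ^^ m) (?D ((L x ^^ Suc k) v))) =
        endo_trace (\<lambda>v. (L x ^^ Suc k) ((L x ^^ m) (?D v)))"
      using endo_trace_commute[OF linear_compose[OF lin(1) lin(3)[of m]] lin(3)[of "Suc k"]]
      by (simp only: o_apply)
    also have "\<dots> = endo_trace (\<lambda>v. (L x ^^ (m + Suc k)) (?D v))"
      unfolding funpow_add[of "Suc k" m, unfolded o_def fun_eq_iff, rule_format, symmetric]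
      by (simp only: add.commute)
    finally show ?case unfolding Suc.IH by (simp add: algebra_simps)
  qed
  from this[of 0] show ?thesis by simp
qed

text \<open>Composing the vanishing Nijenhuis tensor with a power of \<open>L\<close> and taking the trace over the
  second argument leaves the classical recursion: the differential of
  \<open>tr L\<^sup>k\<^sup>+\<^sup>1 / (k + 1)\<close> is the differential of \<open>tr L\<^sup>k / k\<close> precomposed with \<open>L\<close>, the two terms that
  contain the derivative in the direction of the second argument cancelling by cyclicity.\<close>

lemma endo_trace_recursion:
  assumes U: "open U" and L: "smooth_endo U L" and x: "x \<in> U"
    and zero: "\<And>u v. nijenhuis_rep L L x u v = 0"
  shows "endo_trace (\<lambda>v. (L x ^^ Suc k) (endo_deriv L x u v)) =
    endo_trace (\<lambda>v. (L x ^^ k) (endo_deriv L x (L x u) v))"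
proof -
  let ?K = "\<lambda>v. endo_deriv L x v u"
  have lin: "linear ?K" "linear (L x)" "linear (L x ^^ i)" for i
    using linear_endo_deriv_direction[OF L x] smooth_endo_linear[OF L x] linear_funpow by auto
  have "(L x ^^ k) (endo_deriv L x (L x u) v) - (L x ^^ k) (?K (L x v))
      + (L x ^^ k) (L x (?K v)) - (L x ^^ k) (L x (endo_deriv L x u v)) = 0" for v
    using arg_cong[OF zero[of u v], of "L x ^^ k"]
    by (simp add: nijenhuis_rep_def linear_add[OF lin(3)] linear_diff[OF lin(3)] linear_0[OF lin(3)])
  then have "(L x ^^ Suc k) (endo_deriv L x u v) = (L x ^^ k) (endo_deriv L x (L x u) v)
      - ((L x ^^ k) (?K (L x v)) - (L x ^^ k) (L x (?K v)))" for v
    by (simp add: funpow_swap1 algebra_simps)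
  moreover have "endo_trace (\<lambda>v. (L x ^^ k) (?K (L x v))) = endo_trace (\<lambda>v. (L x ^^ k) (L x (?K v)))"
    using endo_trace_commute[OF linear_compose[OF lin(1) lin(3)[of k]] lin(2)]
    by (simp add: funpow_swap1)
  ultimately show ?thesis by (simp only: endo_trace_add_diff)
qed

text \<open>For an even positive exponent the recursion expresses the differential of the trace through that of the
preceding, odd exponent.\<close>

lemma endo_trace_power_deriv_zero:
  assumes U: "open U" and L: "smooth_endo U L"
    and zero: "\<And>x u v. x \<in> U \<Longrightarrow> nijenhuis_rep L L x u v = 0"
    and odd: "\<And>x k. x \<in> U \<Longrightarrow> odd k \<Longrightarrow> endo_trace (L x ^^ k) = 0" and x: "x \<in> U"
  shows "((\<lambda>y. endo_trace (L y ^^ k)) has_derivative (\<lambda>u. 0)) (at x)"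
proof -
  have der: "((\<lambda>y. endo_trace (L y ^^ k)) has_derivative
      (\<lambda>u. endo_trace (endo_deriv (\<lambda>x. L x ^^ k) x u))) (at x)" for k
    by (rule endo_trace_has_derivative[OF smooth_endo_power[OF U L] x])
  have odd_zero: "((\<lambda>y. endo_trace (L y ^^ k)) has_derivative (\<lambda>u. 0)) (at x)" if "odd k" for k
    by (rule has_derivative_transform_within_open[OF has_derivative_const[of 0] U x])
      (simp add: odd that)
  show ?thesis
  proof (cases "odd k")
    case False
    show ?thesis
    proof (cases k)
      case 0
      then show ?thesis by simp
    next
      case (Suc j)
      then have "odd j" using False by simp
      then obtain i where i: "j = Suc i" by (cases j) auto
      have "endo_trace (endo_deriv (\<lambda>x. L x ^^ j) x u) = 0" for u
        using has_derivative_unique[OF der odd_zero[OF \<open>odd j\<close>]] by metis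
      then have "endo_trace (\<lambda>v. (L x ^^ i) (endo_deriv L x u v)) = 0" for u
        unfolding i endo_trace_power_deriv[OF U L x] by simp
      then have "endo_trace (\<lambda>v. (L x ^^ j) (endo_deriv L x u v)) = 0" for u
        unfolding i using endo_trace_recursion[OF U L x zero[OF x], of i u] by simp
      then have "endo_trace (endo_deriv (\<lambda>x. L x ^^ k) x u) = 0" for u
        unfolding Suc endo_trace_power_deriv[OF U L x] by simp
      then show ?thesis using der[of k] by simp
    qed
  qed (rule odd_zero)
qed

section \<open>Charts and tangent vectors\<close>

text \<open>Tangent vectors at \<open>p\<close> are determined by their component in any one chart around \<open>p\<close>, and
\<open>coord_vec\<close> inverts the passage to components; all computations below are transported in this way.\<close>

locale smooth_atlas =
  fixes M :: "'a topology" and A :: "('a, 'e::euclidean_space) chart set"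
  assumes manifold: "smooth_manifold M A"
begin

lemma chart_on_atlas: "c \<in> A \<Longrightarrow> chart_on M c"
  using manifold by (simp add: smooth_manifold_def)

lemma openin_cdom: "c \<in> A \<Longrightarrow> openin M (cdom c)"
  and open_crange: "c \<in> A \<Longrightarrow> open (crange c)"
  using chart_on_atlas by (auto simp: chart_on_def)

lemma cdom_subset: "c \<in> A \<Longrightarrow> cdom c \<subseteq> topspace M"
  using openin_cdom openin_subset by blast

lemma chart_homeomorphic:
  "c \<in> A \<Longrightarrow> homeomorphic_map (subtopology M (cdom c)) (top_of_set (crange c)) (cmap c)"
  using chart_on_atlas by (auto simp: chart_on_def)

lemma inj_on_cmap:
  assumes "c \<in> A"
  shows "inj_on (cmap c) (cdom c)"
  using homeomorphic_imp_injective_map[OF chart_homeomorphic[OF assms]] cdom_subset[OF assms]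
  by (simp add: Int_absorb1)

lemma cinv_cmap [simp]: "c \<in> A \<Longrightarrow> p \<in> cdom c \<Longrightarrow> cinv c (cmap c p) = p"
  unfolding cinv_def using inv_into_f_f[OF inj_on_cmap] .

lemma cinv_in_cdom [simp]: "x \<in> crange c \<Longrightarrow> cinv c x \<in> cdom c"
  unfolding cinv_def crange_def by (rule inv_into_into)

lemma cmap_cinv [simp]: "x \<in> crange c \<Longrightarrow> cmap c (cinv c x) = x"
  unfolding cinv_def crange_def by (rule f_inv_into_f)

lemma cmap_in_crange [simp]: "p \<in> cdom c \<Longrightarrow> cmap c p \<in> crange c"
  by (simp add: crange_def)

lemma open_chart_image:
  assumes "c \<in> A" "openin M W"
  shows "open (cmap c ` (cdom c \<inter> W))"
proof -
  have "openin (subtopology M (cdom c)) (cdom c \<inter> W)"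
    using assms(2) by (auto simp: openin_subtopology)
  then have "openin (top_of_set (crange c)) (cmap c ` (cdom c \<inter> W))"
    using homeomorphic_imp_open_map[OF chart_homeomorphic[OF assms(1)]] by (simp add: open_map_def)
  then show ?thesis using open_crange[OF assms(1)] openin_open_eq by blast
qed

lemma openin_chart_preimage:
  assumes "c \<in> A" "open U"
  shows "openin M {p \<in> cdom c. cmap c p \<in> U}"
proof -
  have "continuous_map (subtopology M (cdom c)) (top_of_set (crange c)) (cmap c)"
    by (rule homeomorphic_imp_continuous_map[OF chart_homeomorphic[OF assms(1)]])
  moreover have "openin (top_of_set (crange c)) (crange c \<inter> U)" using assms(2) by blast
  ultimately have "openin (subtopology M (cdom c))
      {p \<in> topspace (subtopology M (cdom c)). cmap c p \<in> crange c \<inter> U}"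
    by (rule openin_continuous_map_preimage)
  moreover have "{p \<in> topspace (subtopology M (cdom c)). cmap c p \<in> crange c \<inter> U} = {p \<in> cdom c. cmap c p \<in> U}"
    using cdom_subset[OF assms(1)] by auto
  ultimately show ?thesis
    using openin_trans_full[OF _ openin_cdom[OF assms(1)]] by simp
qed

lemma charts_atD: "c \<in> charts_at A p \<Longrightarrow> c \<in> A" "c \<in> charts_at A p \<Longrightarrow> p \<in> cdom c"
  by (simp_all add: charts_at_def)

lemma charts_at_nonempty: "p \<in> topspace M \<Longrightarrow> \<exists>c. c \<in> charts_at A p"
  using manifold by (auto simp: smooth_manifold_def charts_at_def)

lemma charts_at_topspace: "c \<in> charts_at A p \<Longrightarrow> p \<in> topspace M"
  using cdom_subset by (auto simp: charts_at_def)

lemma charts_at_cinv [simp]: "c \<in> A \<Longrightarrow> x \<in> crange c \<Longrightarrow> c \<in> charts_at A (cinv c x)"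
  by (simp add: charts_at_def)

lemma smooth_transition:
  "c \<in> A \<Longrightarrow> d \<in> A \<Longrightarrow> smooth_on (transition c d) (cmap c ` (cdom c \<inter> cdom d))"
  using manifold by (simp add: smooth_manifold_def)

lemma transition_cmap [simp]:
  "c \<in> A \<Longrightarrow> p \<in> cdom c \<Longrightarrow> transition c d (cmap c p) = cmap d p"
  by (simp add: transition_def)

lemma transition_has_derivative:
  assumes "c \<in> charts_at A p" "d \<in> charts_at A p"
  shows "(transition c d has_derivative frechet_derivative (transition c d) (at (cmap c p))) (at (cmap c p))"
  using assms by (intro smooth_on_has_derivative[OF smooth_transition]) (auto simp: charts_at_def)

lemma transition_deriv_refl:
  assumes "c \<in> charts_at A p"
  shows "frechet_derivative (transition c c) (at (cmap c p)) v = v"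
proof -
  have "(transition c c has_derivative (\<lambda>v. v)) (at (cmap c p))"
    by (rule has_derivative_transform_within_open[OF has_derivative_ident open_crange])
      (use charts_atD[OF assms] in \<open>auto simp: transition_def\<close>)
  then show ?thesis by (simp add: frechet_derivativeI)
qed

text \<open>The cocycle identity for the derivatives of the transition maps; it is what makes \<open>coord_vec\<close> produce
tangent vectors.\<close>

lemma transition_deriv_trans:
  assumes c: "c \<in> charts_at A p" and d: "d \<in> charts_at A p" and e: "e \<in> charts_at A p"
  shows "frechet_derivative (transition d e) (at (cmap d p))
      (frechet_derivative (transition c d) (at (cmap c p)) v) =
    frechet_derivative (transition c e) (at (cmap c p)) v"
proof -
  note cA = charts_atD(1)[OF c] and dA = charts_atD(1)[OF d]
  let ?V = "cmap c ` (cdom c \<inter> cdom d)"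
  have "(transition d e has_derivative frechet_derivative (transition d e) (at (cmap d p)))
      (at (transition c d (cmap c p)))"
    using transition_has_derivative[OF d e] c by (simp add: charts_atD)
  from has_derivative_compose[OF transition_has_derivative[OF c d] this]
  have "(transition c e has_derivative (\<lambda>v. frechet_derivative (transition d e) (at (cmap d p))
      (frechet_derivative (transition c d) (at (cmap c p)) v))) (at (cmap c p))"
  proof (rule has_derivative_transform_within_open)
    show "open ?V" by (rule open_chart_image[OF cA openin_cdom[OF dA]])
    show "cmap c p \<in> ?V" using c d by (auto simp: charts_at_def)
    show "transition d e (transition c d y) = transition c e y" if "y \<in> ?V" for y
      using that cA dA by auto
  qed
  then show ?thesis by (simp add: frechet_derivativeI)
qed

lemma coord_vec_tangent:
  assumes "c \<in> charts_at A p"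
  shows "coord_vec A c p e \<in> tangent_space A p"
  using transition_deriv_trans[OF assms] by (simp add: tangent_space_def coord_vec_def)

lemma coord_vec_component [simp]: "c \<in> charts_at A p \<Longrightarrow> coord_vec A c p e c = e"
  by (simp add: coord_vec_def transition_deriv_refl)

lemma tangent_change_chart:
  "v \<in> tangent_space A p \<Longrightarrow> c \<in> charts_at A p \<Longrightarrow> d \<in> charts_at A p \<Longrightarrow>
    v d = frechet_derivative (transition c d) (at (cmap c p)) (v c)"
  unfolding tangent_space_def by blast

lemma tangent_outside: "v \<in> tangent_space A p \<Longrightarrow> c \<notin> charts_at A p \<Longrightarrow> v c = 0"
  unfolding tangent_space_def by blast

lemma coord_vec_of_component [simp]:
  "c \<in> charts_at A p \<Longrightarrow> v \<in> tangent_space A p \<Longrightarrow> coord_vec A c p (v c) = v"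
  unfolding coord_vec_def
  by (rule ext) (metis tangent_change_chart tangent_outside)

lemma tangent_eqI:
  "c \<in> charts_at A p \<Longrightarrow> u \<in> tangent_space A p \<Longrightarrow> v \<in> tangent_space A p \<Longrightarrow> u c = v c \<Longrightarrow> u = v"
  by (metis coord_vec_of_component)

lemma linear_transition_deriv:
  "c \<in> charts_at A p \<Longrightarrow> d \<in> charts_at A p \<Longrightarrow>
    linear (frechet_derivative (transition c d) (at (cmap c p)))"
  using transition_has_derivative has_derivative_linear by blast

lemma tangent_combination:
  assumes "u \<in> tangent_space A p" "v \<in> tangent_space A p"
  shows "tscale a u + tscale b v \<in> tangent_space A p"
proof -
  have "(tscale a u + tscale b v) d =
      frechet_derivative (transition c d) (at (cmap c p)) ((tscale a u + tscale b v) c)"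
    if c: "c \<in> charts_at A p" and d: "d \<in> charts_at A p" for c d
    using linear_transition_deriv[OF c d]
    by (simp add: tscale_def linear_add linear_cmul
        tangent_change_chart[OF assms(1) c d, symmetric] tangent_change_chart[OF assms(2) c d, symmetric])
  moreover have "(tscale a u + tscale b v) c = 0" if "c \<notin> charts_at A p" for c
    using assms[THEN tangent_outside, OF that] by (simp add: tscale_def)
  ultimately show ?thesis unfolding tangent_space_def by blast
qed

lemma tangent_zero: "0 \<in> tangent_space A p"
  using linear_transition_deriv by (auto simp: tangent_space_def linear_0)

lemma tscale_apply [simp]: "tscale a v c = a *\<^sub>R v c"
  by (simp add: tscale_def)

lemma tangent_add: "u \<in> tangent_space A p \<Longrightarrow> v \<in> tangent_space A p \<Longrightarrow> u + v \<in> tangent_space A p"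
  using tangent_combination[of u p v 1 1] by (simp add: tscale_def)

lemma tangent_scale: "u \<in> tangent_space A p \<Longrightarrow> tscale a u \<in> tangent_space A p"
  using tangent_combination[of u p u a 0] by (simp add: tscale_def plus_fun_def)

lemma tangent_minus: "u \<in> tangent_space A p \<Longrightarrow> - u \<in> tangent_space A p"
  using tangent_scale[of u p "- 1"] by (simp add: tscale_def fun_Compl_def)

lemma tangent_diff: "u \<in> tangent_space A p \<Longrightarrow> v \<in> tangent_space A p \<Longrightarrow> u - v \<in> tangent_space A p"
  using tangent_add[OF _ tangent_minus, of u p v] by simp

lemma tangent_sum: "(\<And>i. i \<in> I \<Longrightarrow> f i \<in> tangent_space A p) \<Longrightarrow> (\<Sum>i\<in>I. f i) \<in> tangent_space A p"
  by (induction I rule: infinite_finite_induct) (auto intro: tangent_zero tangent_add)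

lemma coord_vec_combination:
  assumes "c \<in> charts_at A p"
  shows "coord_vec A c p (a *\<^sub>R x + b *\<^sub>R y) = tscale a (coord_vec A c p x) + tscale b (coord_vec A c p y)"
  by (rule tangent_eqI[OF assms])
    (auto simp: assms coord_vec_tangent[OF assms] tangent_combination)

lemma tangent_nonzero_component:
  "c \<in> charts_at A p \<Longrightarrow> u \<in> tangent_space A p \<Longrightarrow> u \<noteq> 0 \<Longrightarrow> u c \<noteq> 0"
  using tangent_eqI[OF _ _ tangent_zero] by auto

subsection \<open>Vector fields and brackets\<close>

lemma vector_field_onD:
  assumes "vector_field_on A W X"
  shows "p \<in> W \<Longrightarrow> X p \<in> tangent_space A p"
    and "c \<in> A \<Longrightarrow> smooth_on (vf_rep c X) (cmap c ` (cdom c \<inter> W))"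
  using assms by (simp_all add: vector_field_on_def)

lemma vf_rep_cmap [simp]: "c \<in> charts_at A p \<Longrightarrow> vf_rep c X (cmap c p) = X p c"
  by (simp add: vf_rep_def charts_atD)

lemma vf_rep_has_derivative:
  assumes "vector_field_on A W X" "c \<in> charts_at A p" "p \<in> W"
  shows "(vf_rep c X has_derivative frechet_derivative (vf_rep c X) (at (cmap c p))) (at (cmap c p))"
  using assms by (intro smooth_on_has_derivative[OF vector_field_onD(2)]) (auto simp: charts_at_def)

lemma smooth_endo_transition_deriv:
  assumes "c \<in> A" "d \<in> A"
  shows "smooth_endo (cmap c ` (cdom c \<inter> cdom d)) (\<lambda>x. frechet_derivative (transition c d) (at x))"
  unfolding smooth_endo_def
  using smooth_transition[OF assms] smooth_on_differentiable linear_frechet_derivative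
    smooth_on_frechet_derivative by blast

text \<open>Differentiates the transformation law \<open>X\<^sub>d \<circ> \<tau> = D\<tau> X\<^sub>c\<close>. The first term on the right contains the second
derivative of the transition map.\<close>

lemma vf_rep_change_chart:
  assumes W: "openin M W" and X: "vector_field_on A W X" and p: "p \<in> W"
    and c: "c \<in> charts_at A p" and d: "d \<in> charts_at A p"
  defines "\<tau> \<equiv> transition c d" and "x \<equiv> cmap c p"
  shows "frechet_derivative (vf_rep d X) (at (cmap d p)) (frechet_derivative \<tau> (at x) u) =
    frechet_derivative (\<lambda>y. frechet_derivative \<tau> (at y) (X p c)) (at x) u +
    frechet_derivative \<tau> (at x) (frechet_derivative (vf_rep c X) (at x) u)"
proof -
  note cA = charts_atD(1)[OF c] and dA = charts_atD(1)[OF d]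
  let ?V = "cmap c ` (cdom c \<inter> (cdom d \<inter> W))"
  let ?L = "\<lambda>y. frechet_derivative \<tau> (at y)"
  have V: "open ?V" by (rule open_chart_image[OF cA]) (simp add: openin_cdom[OF dA] W openin_Int)
  have xV: "x \<in> ?V" using c d p by (auto simp: x_def charts_at_def)
  have L: "smooth_endo ?V ?L"
    unfolding \<tau>_def by (rule smooth_endo_subset[OF smooth_endo_transition_deriv[OF cA dA]]) auto
  have Xc: "(vf_rep c X has_derivative frechet_derivative (vf_rep c X) (at x)) (at x)"
    unfolding x_def by (rule vf_rep_has_derivative[OF X c p])
  have "\<tau> x = cmap d p" using c by (simp add: \<tau>_def x_def charts_atD)
  then have "(vf_rep d X has_derivative frechet_derivative (vf_rep d X) (at (cmap d p))) (at (\<tau> x))"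
    using vf_rep_has_derivative[OF X d p] by simp
  moreover have "(\<tau> has_derivative ?L x) (at x)"
    unfolding \<tau>_def x_def by (rule transition_has_derivative[OF c d])
  ultimately have "((\<lambda>y. vf_rep d X (\<tau> y)) has_derivative
      (\<lambda>u. frechet_derivative (vf_rep d X) (at (cmap d p)) (?L x u))) (at x)"
    by (rule has_derivative_compose[rotated])
  moreover have "((\<lambda>y. vf_rep d X (\<tau> y)) has_derivative
      (\<lambda>u. endo_deriv ?L x u (vf_rep c X x) + ?L x (frechet_derivative (vf_rep c X) (at x) u))) (at x)"
  proof (rule has_derivative_transform_within_open[OF endo_has_derivative[OF V xV L Xc] V xV])
    fix y assume "y \<in> ?V"
    then obtain q where q: "y = cmap c q" "c \<in> charts_at A q" "d \<in> charts_at A q" "q \<in> W"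
      using cA dA by (auto simp: charts_at_def)
    have "X q d = ?L y (X q c)"
      unfolding q(1) \<tau>_def by (rule tangent_change_chart[OF vector_field_onD(1)[OF X q(4)] q(2,3)])
    then show "?L y (vf_rep c X y) = vf_rep d X (\<tau> y)"
      using q by (simp add: \<tau>_def charts_atD(1,2))
  qed
  ultimately have "(\<lambda>u. frechet_derivative (vf_rep d X) (at (cmap d p)) (?L x u)) =
      (\<lambda>u. endo_deriv ?L x u (vf_rep c X x) + ?L x (frechet_derivative (vf_rep c X) (at x) u))"
    by (rule has_derivative_unique)
  from fun_cong[OF this, of u] show ?thesis
    using c by (simp add: endo_deriv_def x_def)
qed

text \<open>The second derivatives of the transition map enter the two halves of the bracket with the two fields in
opposite order, and cancel.\<close>

lemma lie_bracket_tangent: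
  assumes W: "openin M W" and X: "vector_field_on A W X" and Y: "vector_field_on A W Y" and p: "p \<in> W"
  shows "lie_bracket A X Y p \<in> tangent_space A p"
proof -
  have "lie_bracket A X Y p d = frechet_derivative (transition c d) (at (cmap c p)) (lie_bracket A X Y p c)"
    if c: "c \<in> charts_at A p" and d: "d \<in> charts_at A p" for c d
  proof -
    note cA = charts_atD(1)[OF c] and dA = charts_atD(1)[OF d]
    let ?L = "frechet_derivative (transition c d) (at (cmap c p))"
    have Xd: "X p d = ?L (X p c)" and Yd: "Y p d = ?L (Y p c)"
      using tangent_change_chart[OF vector_field_onD(1)[OF X p] c d]
        tangent_change_chart[OF vector_field_onD(1)[OF Y p] c d] .
    have "cmap c p \<in> cmap c ` (cdom c \<inter> cdom d)" using c d by (auto simp: charts_at_def)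
    from second_derivative_symmetric[OF open_chart_image[OF cA openin_cdom[OF dA]]
        smooth_transition[OF cA dA] this]
    have "frechet_derivative (\<lambda>y. frechet_derivative (transition c d) (at y) (Y p c)) (at (cmap c p)) (X p c) =
      frechet_derivative (\<lambda>y. frechet_derivative (transition c d) (at y) (X p c)) (at (cmap c p)) (Y p c)" .
    then show ?thesis
      using c d vf_rep_change_chart[OF W X p c d, of "Y p c"] vf_rep_change_chart[OF W Y p c d, of "X p c"]
      by (simp add: lie_bracket_def Xd Yd linear_diff[OF linear_transition_deriv[OF c d]])
  qed
  moreover have "lie_bracket A X Y p c = 0" if "c \<notin> charts_at A p" for c
    using that by (simp add: lie_bracket_def)
  ultimately show ?thesis unfolding tangent_space_def by blast
qed

text \<open>Coordinate fields realise every pair of tangent vectors at a point, so that a Nijenhuis tensor vanishing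
on fields vanishes pointwise.\<close>

lemma coordinate_vector_field:
  assumes c: "c \<in> A"
  shows "vector_field_on A (cdom c) (\<lambda>q. coord_vec A c q e)"
  unfolding vector_field_on_def
proof (intro conjI ballI)
  show "coord_vec A c q e \<in> tangent_space A q" if "q \<in> cdom c" for q
    using c that by (intro coord_vec_tangent) (simp add: charts_at_def)
  fix d assume d: "d \<in> A"
  let ?V = "cmap d ` (cdom d \<inter> cdom c)"
  have V: "open ?V" by (rule open_chart_image[OF d openin_cdom[OF c]])
  have img: "transition d c ` ?V \<subseteq> cmap c ` (cdom c \<inter> cdom d)" using d by auto
  have "smooth_on (\<lambda>y. frechet_derivative (transition c d) (at (transition d c y)) e) ?V"
    by (rule smooth_on_compose[OF V open_chart_image[OF c openin_cdom[OF d]] img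
          smooth_on_frechet_derivative[OF smooth_transition[OF c d]] smooth_transition[OF d c]])
  then show "smooth_on (vf_rep d (\<lambda>q. coord_vec A c q e)) ?V"
    by (rule smooth_on_cong[OF V, rotated]) (use c d in \<open>auto simp: vf_rep_def coord_vec_def charts_at_def\<close>)
qed

section \<open>Endomorphism fields on the manifold\<close>

definition endo_rep :: "('a, 'e) chart \<Rightarrow> ('a \<Rightarrow> ('a, 'e) tvec \<Rightarrow> ('a, 'e) tvec) \<Rightarrow> 'e \<Rightarrow> 'e \<Rightarrow> 'e" where
  "endo_rep c R x e = R (cinv c x) (coord_vec A c (cinv c x) e) c"

context
  fixes R assumes R: "endomorphism_field M A R"
begin

lemma endomorphism_tangent:
  "p \<in> topspace M \<Longrightarrow> v \<in> tangent_space A p \<Longrightarrow> R p v \<in> tangent_space A p"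
  using R by (simp add: endomorphism_field_def)

lemma endomorphism_combination:
  "p \<in> topspace M \<Longrightarrow> u \<in> tangent_space A p \<Longrightarrow> v \<in> tangent_space A p \<Longrightarrow>
    R p (tscale a u + tscale b v) = tscale a (R p u) + tscale b (R p v)"
  using R by (simp add: endomorphism_field_def)

lemma smooth_endo_rep:
  assumes c: "c \<in> A"
  shows "smooth_endo (crange c) (endo_rep c R)"
  unfolding smooth_endo_def
proof (intro conjI ballI allI)
  fix x assume x: "x \<in> crange c"
  then have p: "c \<in> charts_at A (cinv c x)" using c by simp
  have "endo_rep c R x (a *\<^sub>R u + b *\<^sub>R v) = a *\<^sub>R endo_rep c R x u + b *\<^sub>R endo_rep c R x v" for a b u v
    using endomorphism_combination[OF charts_at_topspace[OF p] coord_vec_tangent[OF p] coord_vec_tangent[OF p]]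
    by (simp add: endo_rep_def coord_vec_combination[OF p])
  from this[of 1 _ 1] this[of _ _ 0] show "linear (endo_rep c R x)" by (intro linearI) simp_all
next
  show "smooth_on (\<lambda>x. endo_rep c R x v) (crange c)" for v
    using R c by (simp add: endomorphism_field_def endo_rep_def)
qed

lemma endo_rep_component:
  "c \<in> charts_at A p \<Longrightarrow> v \<in> tangent_space A p \<Longrightarrow> R p v c = endo_rep c R (cmap c p) (v c)"
  by (simp add: endo_rep_def charts_atD)

lemma endomorphism_vector_field:
  assumes W: "openin M W" and X: "vector_field_on A W X"
  shows "vector_field_on A W (\<lambda>q. R q (X q))"
  unfolding vector_field_on_def
proof (intro conjI ballI)
  show "R p (X p) \<in> tangent_space A p" if "p \<in> W" for p
    using endomorphism_tangent[OF _ vector_field_onD(1)[OF X that]] W that openin_subset by blast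
  fix c assume c: "c \<in> A"
  let ?V = "cmap c ` (cdom c \<inter> W)"
  have V: "open ?V" by (rule open_chart_image[OF c W])
  have "smooth_endo ?V (endo_rep c R)"
    by (rule smooth_endo_subset[OF smooth_endo_rep[OF c]]) auto
  from smooth_endo_apply[OF V this vector_field_onD(2)[OF X c]]
  show "smooth_on (vf_rep c (\<lambda>q. R q (X q))) ?V"
    by (rule smooth_on_cong[OF V, rotated])
      (use c vector_field_onD(1)[OF X] in \<open>auto simp: vf_rep_def endo_rep_def charts_at_def\<close>)
qed

lemma endomorphism_vf_rep_deriv:
  assumes W: "openin M W" and X: "vector_field_on A W X" and c: "c \<in> charts_at A p" and p: "p \<in> W"
  shows "frechet_derivative (vf_rep c (\<lambda>q. R q (X q))) (at (cmap c p)) u =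
    endo_deriv (endo_rep c R) (cmap c p) u (X p c) +
    endo_rep c R (cmap c p) (frechet_derivative (vf_rep c X) (at (cmap c p)) u)"
proof -
  note cA = charts_atD(1)[OF c]
  let ?V = "cmap c ` (cdom c \<inter> W)"
  have V: "open ?V" "cmap c p \<in> ?V" using open_chart_image[OF cA W] c p by (auto simp: charts_at_def)
  have L: "smooth_endo ?V (endo_rep c R)"
    by (rule smooth_endo_subset[OF smooth_endo_rep[OF cA]]) auto
  have "(vf_rep c (\<lambda>q. R q (X q)) has_derivative
    (\<lambda>u. endo_deriv (endo_rep c R) (cmap c p) u (vf_rep c X (cmap c p)) +
      endo_rep c R (cmap c p) (frechet_derivative (vf_rep c X) (at (cmap c p)) u))) (at (cmap c p))"
    by (rule has_derivative_transform_within_open[OF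
          endo_has_derivative[OF V L vf_rep_has_derivative[OF X c p]] V])
      (use cA vector_field_onD(1)[OF X] in \<open>auto simp: vf_rep_def endo_rep_def charts_at_def\<close>)
  from frechet_derivativeI[OF this] show ?thesis using c by simp
qed

text \<open>Both sides are computed with the product rule; the derivatives of the components of \<open>X\<close> and \<open>Y\<close>
cancel, which is the tensoriality of the Nijenhuis tensor. The brackets have to be tangent vectors
before \<open>R\<close> acts on them through its components.\<close>

lemma nijenhuis_component:
  assumes W: "openin M W" and X: "vector_field_on A W X" and Y: "vector_field_on A W Y"
    and c: "c \<in> charts_at A p" and p: "p \<in> W"
  shows "nijenhuis A R X Y p c = nijenhuis_rep (endo_rep c R) (endo_rep c R) (cmap c p) (X p c) (Y p c)"
proof -
  let ?L = "endo_rep c R" and ?x = "cmap c p"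
  let ?RX = "\<lambda>q. R q (X q)" and ?RY = "\<lambda>q. R q (Y q)"
  have pM: "p \<in> topspace M" by (rule charts_at_topspace[OF c])
  have lin: "linear (?L ?x)"
    by (rule smooth_endo_linear[OF smooth_endo_rep[OF charts_atD(1)[OF c]]]) (simp add: charts_atD[OF c])
  note RX = endomorphism_vector_field[OF W X] and RY = endomorphism_vector_field[OF W Y]
  have t: "lie_bracket A X Y p \<in> tangent_space A p" "lie_bracket A ?RX Y p \<in> tangent_space A p"
    "lie_bracket A X ?RY p \<in> tangent_space A p"
    using lie_bracket_tangent[OF W] X Y RX RY p by blast+
  note comp = endo_rep_component[OF c]
  have comps: "R p (R p (lie_bracket A X Y p)) c = ?L ?x (?L ?x (lie_bracket A X Y p c))"
    "R p (lie_bracket A ?RX Y p) c = ?L ?x (lie_bracket A ?RX Y p c)"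
    "R p (lie_bracket A X ?RY p) c = ?L ?x (lie_bracket A X ?RY p c)"
    "R p (X p) c = ?L ?x (X p c)" "R p (Y p) c = ?L ?x (Y p c)"
    using comp[OF t(1)] comp[OF t(2)] comp[OF t(3)] comp[OF endomorphism_tangent[OF pM t(1)]]
      comp[OF vector_field_onD(1)[OF X p]] comp[OF vector_field_onD(1)[OF Y p]] by simp_all
  show ?thesis
    unfolding nijenhuis_def Let_def plus_fun_apply minus_apply comps
    using c
    by (simp add: lie_bracket_def comps endomorphism_vf_rep_deriv[OF W X c p]
        endomorphism_vf_rep_deriv[OF W Y c p] nijenhuis_rep_def linear_add[OF lin] linear_diff[OF lin])
qed

lemma nijenhuis_zero_iff:
  "nijenhuis_zero M A R \<longleftrightarrow>
    (\<forall>c\<in>A. \<forall>x\<in>crange c. \<forall>u v. nijenhuis_rep (endo_rep c R) (endo_rep c R) x u v = 0)"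
proof (intro iffI ballI allI)
  fix c x u v assume N: "nijenhuis_zero M A R" and c: "c \<in> A" and x: "x \<in> crange c"
  let ?p = "cinv c x"
  have p: "c \<in> charts_at A ?p" "?p \<in> cdom c" using c x by auto
  note F = coordinate_vector_field[OF c]
  have "nijenhuis A R (\<lambda>q. coord_vec A c q u) (\<lambda>q. coord_vec A c q v) ?p c = 0"
    using N openin_cdom[OF c] F p(2) unfolding nijenhuis_zero_def by (metis zero_fun_apply)
  then show "nijenhuis_rep (endo_rep c R) (endo_rep c R) x u v = 0"
    using nijenhuis_component[OF openin_cdom[OF c] F F p] p x by simp
next
  assume N: "\<forall>c\<in>A. \<forall>x\<in>crange c. \<forall>u v. nijenhuis_rep (endo_rep c R) (endo_rep c R) x u v = 0"
  show "nijenhuis_zero M A R"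
    unfolding nijenhuis_zero_def
  proof (intro allI impI ballI)
    fix W X Y p
    assume *: "openin M W \<and> vector_field_on A W X \<and> vector_field_on A W Y" and p: "p \<in> W"
    then have W: "openin M W" and X: "vector_field_on A W X" and Y: "vector_field_on A W Y" by auto
    have pM: "p \<in> topspace M" using W p openin_subset by blast
    then obtain c where c: "c \<in> charts_at A p" using charts_at_nonempty by blast
    note RX = endomorphism_vector_field[OF W X] and RY = endomorphism_vector_field[OF W Y]
    have "nijenhuis A R X Y p \<in> tangent_space A p"
      unfolding nijenhuis_def Let_def
      by (intro tangent_diff tangent_add endomorphism_tangent pM lie_bracket_tangent[OF W] X Y RX RY p)
    moreover have "nijenhuis A R X Y p c = 0"
      using nijenhuis_component[OF W X Y c p] N charts_atD[OF c] by simp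
    ultimately show "nijenhuis A R X Y p = 0"
      using tangent_nonzero_component[OF c] by blast
  qed
qed

end

subsection \<open>Polynomials of an endomorphism field\<close>

text \<open>The counterpart of \<open>opoly\<close> on tangent vectors, which are functions on charts with their own scalar
multiplication. Being independent of a chart, it defines global fields.\<close>

definition tpoly :: "real poly \<Rightarrow> (('a, 'e) tvec \<Rightarrow> ('a, 'e) tvec) \<Rightarrow> ('a, 'e) tvec \<Rightarrow> ('a, 'e) tvec" where
  "tpoly q F v = (\<Sum>i\<le>degree q. tscale (coeff q i) ((F ^^ i) v))"

lemma sum_fun_apply: "(\<Sum>i\<in>I. f i) c = (\<Sum>i\<in>I. f i c)" for f :: "_ \<Rightarrow> ('a, 'e) tvec"
  by (induction I rule: infinite_finite_induct) auto

context
  fixes R assumes R: "endomorphism_field M A R"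
begin

lemma endomorphism_power_tangent:
  "p \<in> topspace M \<Longrightarrow> v \<in> tangent_space A p \<Longrightarrow> (R p ^^ i) v \<in> tangent_space A p"
  by (induction i) (auto intro: endomorphism_tangent[OF R])

lemma tpoly_tangent:
  "p \<in> topspace M \<Longrightarrow> v \<in> tangent_space A p \<Longrightarrow> tpoly q (R p) v \<in> tangent_space A p"
  unfolding tpoly_def by (intro tangent_sum tangent_scale endomorphism_power_tangent)

lemma tpoly_component:
  assumes c: "c \<in> charts_at A p" and v: "v \<in> tangent_space A p"
  shows "tpoly q (R p) v c = opoly q (endo_rep c R (cmap c p)) (v c)"
proof -
  have pM: "p \<in> topspace M" by (rule charts_at_topspace[OF c])
  have "(R p ^^ i) v c = (endo_rep c R (cmap c p) ^^ i) (v c)" for i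
    by (induction i) (auto simp: endo_rep_component[OF R c] endomorphism_power_tangent pM v)
  then show ?thesis by (simp add: tpoly_def opoly_def sum_fun_apply)
qed

lemma endo_rep_tpoly:
  assumes "c \<in> A" "x \<in> crange c"
  shows "endo_rep c (\<lambda>p. tpoly q (R p)) x = opoly q (endo_rep c R x)"
proof
  fix e
  have p: "c \<in> charts_at A (cinv c x)" using assms by simp
  show "endo_rep c (\<lambda>p. tpoly q (R p)) x e = opoly q (endo_rep c R x) e"
    using tpoly_component[OF p coord_vec_tangent[OF p]] assms p
    by (simp add: endo_rep_def[of c "\<lambda>p. tpoly q (R p)"])
qed

lemma endomorphism_field_tpoly: "endomorphism_field M A (\<lambda>p. tpoly q (R p))"
  unfolding endomorphism_field_def
proof (intro conjI ballI allI)
  fix p assume pM: "p \<in> topspace M"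
  obtain c where c: "c \<in> charts_at A p" using charts_at_nonempty[OF pM] by blast
  have lin: "linear (opoly q (endo_rep c R (cmap c p)))"
    by (intro linear_opoly smooth_endo_linear[OF smooth_endo_rep[OF R charts_atD(1)[OF c]]]
        cmap_in_crange charts_atD(2)[OF c])
  show "tpoly q (R p) v \<in> tangent_space A p" if "v \<in> tangent_space A p" for v
    by (rule tpoly_tangent[OF pM that])
  fix u v a b assume uv: "u \<in> tangent_space A p" "v \<in> tangent_space A p"
  show "tpoly q (R p) (tscale a u + tscale b v) = tscale a (tpoly q (R p) u) + tscale b (tpoly q (R p) v)"
    by (rule tangent_eqI[OF c])
      (auto simp: tpoly_component[OF c] uv tangent_combination tpoly_tangent pM
        linear_add[OF lin] linear_cmul[OF lin])
next
  fix c e assume c: "c \<in> A"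
  show "smooth_on (\<lambda>x. tpoly q (R (cinv c x)) (coord_vec A c (cinv c x) e) c) (crange c)"
    by (rule smooth_on_cong[OF open_crange[OF c] _
          smooth_endo_smooth[OF smooth_endo_opoly[OF open_crange[OF c] smooth_endo_rep[OF R c]], of q e]])
      (simp add: endo_rep_tpoly[OF c, symmetric] endo_rep_def)
qed

lemma nijenhuis_zero_tpoly:
  assumes "nijenhuis_zero M A R"
  shows "nijenhuis_zero M A (\<lambda>p. tpoly q (R p))"
  unfolding nijenhuis_zero_iff[OF endomorphism_field_tpoly]
proof (intro ballI allI)
  fix c x u v assume c: "c \<in> A" and x: "x \<in> crange c"
  let ?L = "endo_rep c R" and ?P = "\<lambda>x. opoly q (endo_rep c R x)"
  let ?Q = "endo_rep c (\<lambda>p. tpoly q (R p))"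
  note U = open_crange[OF c]
  have L: "smooth_endo (crange c) ?L" by (rule smooth_endo_rep[OF R c])
  have P: "smooth_endo (crange c) ?P" by (rule smooth_endo_opoly[OF U L])
  have eq: "?P y w = ?Q y w" if "y \<in> crange c" for y w using endo_rep_tpoly[OF c that] by simp
  have zero: "nijenhuis_rep ?L ?L y u v = 0" if "y \<in> crange c" for y u v
    using assms c that unfolding nijenhuis_zero_iff[OF R] by blast
  have "nijenhuis_rep ?Q ?Q x u v = nijenhuis_rep ?Q ?P x u v"
    by (rule nijenhuis_rep_cong[OF U x P eq])
  also have "\<dots> = - nijenhuis_rep ?P ?Q x v u" by (rule nijenhuis_rep_swap)
  also have "\<dots> = - nijenhuis_rep ?P ?P x v u" using nijenhuis_rep_cong[OF U x P eq] by simp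
  also have "\<dots> = 0" using nijenhuis_rep_opoly[OF U L zero x] by simp
  finally show "nijenhuis_rep ?Q ?Q x u v = 0" .
qed

end

end

section \<open>Two-tensors\<close>

context smooth_atlas
begin

lemma two_tensor_combination:
  assumes "smooth_two_tensor M A B" "p \<in> topspace M"
    and "u \<in> tangent_space A p" "v \<in> tangent_space A p" "w \<in> tangent_space A p"
  shows "B p (tscale a u + tscale b v) w = a * B p u w + b * B p v w"
    and "B p w (tscale a u + tscale b v) = a * B p w u + b * B p w v"
  using assms unfolding smooth_two_tensor_def by blast+

lemma tensor_rep_bilinear:
  assumes B: "smooth_two_tensor M A B" and c: "c \<in> A" and x: "x \<in> crange c"
  shows "bilinear (tensor_rep A c B x)"
proof -
  have p: "c \<in> charts_at A (cinv c x)" using c x by simp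
  note T = coord_vec_tangent[OF p] and pM = charts_at_topspace[OF p]
  have left: "tensor_rep A c B x (a *\<^sub>R u + b *\<^sub>R v) w = a * tensor_rep A c B x u w + b * tensor_rep A c B x v w"
    and right: "tensor_rep A c B x w (a *\<^sub>R u + b *\<^sub>R v) = a * tensor_rep A c B x w u + b * tensor_rep A c B x w v"
    for a b u v w
    unfolding tensor_rep_def coord_vec_combination[OF p]
    using two_tensor_combination[OF B pM T T T] by auto
  show ?thesis
    unfolding bilinear_def
    using left[of 1 _ 1] left[of _ _ 0] right[of _ 1 _ 1] right[of _ _ _ 0]
    by (auto intro!: linearI)
qed

lemma tensor_rep_component:
  "c \<in> charts_at A p \<Longrightarrow> u \<in> tangent_space A p \<Longrightarrow> v \<in> tangent_space A p \<Longrightarrow>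
    B p u v = tensor_rep A c B (cmap c p) (u c) (v c)"
  by (simp add: tensor_rep_def charts_atD)

text \<open>An endomorphism field or a tensor is specified only by its effect on tangent vectors; the congruence
rules transfer each notion between tensors that agree there.\<close>

lemma tensor_rep_cong:
  assumes "\<And>p u v. p \<in> topspace M \<Longrightarrow> u \<in> tangent_space A p \<Longrightarrow> v \<in> tangent_space A p \<Longrightarrow> B p u v = B' p u v"
    and "c \<in> A" "x \<in> crange c"
  shows "tensor_rep A c B x u v = tensor_rep A c B' x u v"
proof -
  have p: "c \<in> charts_at A (cinv c x)" using assms(2,3) by simp
  show ?thesis unfolding tensor_rep_def
    by (intro assms(1) charts_at_topspace[OF p] coord_vec_tangent[OF p])
qed

lemma smooth_two_tensor_cong:
  assumes eq: "\<And>p u v. p \<in> topspace M \<Longrightarrow> u \<in> tangent_space A p \<Longrightarrow> v \<in> tangent_space A p \<Longrightarrow> B p u v = B' p u v"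
    and B: "smooth_two_tensor M A B"
  shows "smooth_two_tensor M A B'"
  unfolding smooth_two_tensor_def
proof (intro conjI ballI allI)
  fix p u v w a b
  assume *: "p \<in> topspace M" "u \<in> tangent_space A p" "v \<in> tangent_space A p" "w \<in> tangent_space A p"
  show "B' p (tscale a u + tscale b v) w = a * B' p u w + b * B' p v w"
    "B' p w (tscale a u + tscale b v) = a * B' p w u + b * B' p w v"
    using two_tensor_combination[OF B *, of a b] * tangent_combination[OF *(2,3)] by (simp_all add: eq)
next
  fix c e f assume c: "c \<in> A"
  show "smooth_on (\<lambda>x. tensor_rep A c B' x e f) (crange c)"
    by (rule smooth_on_cong[OF open_crange[OF c] tensor_rep_cong[OF eq c]])
      (use B c in \<open>auto simp: smooth_two_tensor_def\<close>)
qed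

lemma riemannian_metric_cong:
  assumes eq: "\<And>p u v. p \<in> topspace M \<Longrightarrow> u \<in> tangent_space A p \<Longrightarrow> v \<in> tangent_space A p \<Longrightarrow> B p u v = B' p u v"
    and B: "riemannian_metric M A B"
  shows "riemannian_metric M A B'"
proof -
  have "smooth_two_tensor M A B'"
    by (rule smooth_two_tensor_cong[OF eq]) (use B in \<open>auto simp: riemannian_metric_def\<close>)
  then show ?thesis using B unfolding riemannian_metric_def by (simp add: eq[symmetric])
qed

lemma closed_two_form_cong:
  assumes eq: "\<And>p u v. p \<in> topspace M \<Longrightarrow> u \<in> tangent_space A p \<Longrightarrow> v \<in> tangent_space A p \<Longrightarrow> B p u v = B' p u v"
    and B: "closed_two_form M A B"
  shows "closed_two_form M A B'"
proof -
  have B2: "smooth_two_tensor M A B" using B by (simp add: closed_two_form_def two_form_def)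
  have "smooth_two_tensor M A B'" by (rule smooth_two_tensor_cong[OF eq B2])
  moreover have "B' p u v = - B' p v u"
    if "p \<in> topspace M" "u \<in> tangent_space A p" "v \<in> tangent_space A p" for p u v
  proof -
    have "B p u v = - B p v u" using B that unfolding closed_two_form_def two_form_def by blast
    then show ?thesis using eq[OF that] eq[OF that(1,3,2)] by simp
  qed
  ultimately have "two_form M A B'" unfolding two_form_def by blast
  moreover have "ext_deriv_rep A c B' x u v w = 0" if c: "c \<in> A" and x: "x \<in> crange c" for c x u v w
  proof -
    have "frechet_derivative (\<lambda>y. tensor_rep A c B y e f) (at x) =
        frechet_derivative (\<lambda>y. tensor_rep A c B' y e f) (at x)" for e f
    proof (rule frechet_derivative_transform_within_open[OF _ open_crange[OF c] x])
      show "(\<lambda>y. tensor_rep A c B y e f) differentiable (at x)"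
        using B2 c x by (intro smooth_on_differentiable[of _ "crange c"]) (auto simp: smooth_two_tensor_def)
    qed (rule tensor_rep_cong[OF eq c])
    then have "ext_deriv_rep A c B' x u v w = ext_deriv_rep A c B x u v w"
      by (simp add: ext_deriv_rep_def)
    then show ?thesis using B c x by (simp add: closed_two_form_def)
  qed
  ultimately show ?thesis by (simp add: closed_two_form_def)
qed

lemma tensor_rep_endomorphism:
  assumes R: "endomorphism_field M A R" and c: "c \<in> A" and x: "x \<in> crange c"
  shows "tensor_rep A c (\<lambda>p u v. B p (R p u) v) x e f = tensor_rep A c B x (endo_rep c R x e) f"
proof -
  have p: "c \<in> charts_at A (cinv c x)" using c x by simp
  note T = coord_vec_tangent[OF p]
  show ?thesis
    unfolding tensor_rep_def[of A c "\<lambda>p u v. B p (R p u) v"]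
    using tensor_rep_component[OF p endomorphism_tangent[OF R charts_at_topspace[OF p] T] T, of B e f] c x p
    by (simp add: endo_rep_def)
qed

lemma smooth_two_tensor_endomorphism:
  assumes B: "smooth_two_tensor M A B" and R: "endomorphism_field M A R"
  shows "smooth_two_tensor M A (\<lambda>p u v. B p (R p u) v)"
  unfolding smooth_two_tensor_def
proof (intro conjI ballI allI)
  fix p u v w a b
  assume *: "p \<in> topspace M" "u \<in> tangent_space A p" "v \<in> tangent_space A p" "w \<in> tangent_space A p"
  note t = endomorphism_tangent[OF R *(1)]
  show "B p (R p (tscale a u + tscale b v)) w = a * B p (R p u) w + b * B p (R p v) w"
    using endomorphism_combination[OF R *(1-3)] two_tensor_combination(1)[OF B *(1) t[OF *(2)] t[OF *(3)] *(4)]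
    by simp
  show "B p (R p w) (tscale a u + tscale b v) = a * B p (R p w) u + b * B p (R p w) v"
    by (rule two_tensor_combination(2)[OF B *(1-3) t[OF *(4)]])
next
  fix c e f assume c: "c \<in> A"
  note U = open_crange[OF c]
  have "smooth_on (\<lambda>x. \<Sum>b\<in>Basis. (endo_rep c R x e \<bullet> b) * tensor_rep A c B x b f) (crange c)"
    using B c unfolding smooth_two_tensor_def
    by (intro smooth_on_sum smooth_on_mult smooth_on_inner_const U
        smooth_endo_smooth[OF smooth_endo_rep[OF R c]]) auto
  moreover have "(\<Sum>b\<in>Basis. (endo_rep c R x e \<bullet> b) * tensor_rep A c B x b f) =
      tensor_rep A c (\<lambda>p u v. B p (R p u) v) x e f" if x: "x \<in> crange c" for x
  proof -
    have lin: "linear (\<lambda>u. tensor_rep A c B x u f)"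
      using tensor_rep_bilinear[OF B c x] by (simp add: bilinear_def)
    have "tensor_rep A c B x (endo_rep c R x e) f =
        tensor_rep A c B x (\<Sum>b\<in>Basis. (endo_rep c R x e \<bullet> b) *\<^sub>R b) f"
      by (simp only: euclidean_representation)
    also have "\<dots> = (\<Sum>b\<in>Basis. (endo_rep c R x e \<bullet> b) * tensor_rep A c B x b f)"
      by (simp add: linear_sum[OF lin] linear_cmul[OF lin])
    finally show ?thesis by (simp add: tensor_rep_endomorphism[OF R c x])
  qed
  ultimately show "smooth_on (\<lambda>x. tensor_rep A c (\<lambda>p u v. B p (R p u) v) x e f) (crange c)"
    by (rule smooth_on_cong[OF U, rotated])
qed

lemma two_form_rep_skew:
  assumes "two_form M A B" "c \<in> A" "x \<in> crange c"
  shows "tensor_rep A c B x u v = - tensor_rep A c B x v u"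
proof -
  have p: "c \<in> charts_at A (cinv c x)" using assms by simp
  have skew: "B p u v = - B p v u"
    if "p \<in> topspace M" "u \<in> tangent_space A p" "v \<in> tangent_space A p" for p u v
    using assms(1) that unfolding two_form_def by blast
  show ?thesis
    unfolding tensor_rep_def
    using skew[OF charts_at_topspace[OF p] coord_vec_tangent[OF p] coord_vec_tangent[OF p]] .
qed

lemma inner_form_tensor_rep:
  assumes g: "riemannian_metric M A g" and c: "c \<in> A" and x: "x \<in> crange c"
  shows "inner_form (tensor_rep A c g x)"
proof
  have p: "c \<in> charts_at A (cinv c x)" using c x by simp
  note pM = charts_at_topspace[OF p] and T = coord_vec_tangent[OF p]
  show "bilinear (tensor_rep A c g x)"
    using g c x by (intro tensor_rep_bilinear) (auto simp: riemannian_metric_def)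
  show "tensor_rep A c g x u v = tensor_rep A c g x v u" for u v
  proof -
    have "g p u v = g p v u"
      if "p \<in> topspace M" "u \<in> tangent_space A p" "v \<in> tangent_space A p" for p u v
      using g that unfolding riemannian_metric_def by blast
    from this[OF pM T T] show ?thesis unfolding tensor_rep_def .
  qed
  show "tensor_rep A c g x u u > 0" if "u \<noteq> 0" for u
  proof -
    have "coord_vec A c (cinv c x) u \<noteq> 0"
      using coord_vec_component[OF p, of u] that by (metis zero_fun_apply)
    moreover have "g p u u > 0"
      if "p \<in> topspace M" "u \<in> tangent_space A p" "u \<noteq> 0" for p u
      using g that unfolding riemannian_metric_def by blast
    ultimately show ?thesis unfolding tensor_rep_def using pM T by blast
  qed
qed

end

section \<open>From a Kaehler structure to a calibrated field\<close>

text \<open>Lets wedge products of forms on a tangent space be computed on component vectors, where the linear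
algebra of a Euclidean space applies.\<close>

lemma wedge_transfer:
  assumes "\<And>v. (\<And>i. i < k \<Longrightarrow> v i \<in> V) \<Longrightarrow> \<alpha> v = \<alpha>' (\<lambda>i. \<phi> (v i))"
    and "\<And>v. (\<And>i. i < l \<Longrightarrow> v i \<in> V) \<Longrightarrow> \<beta> v = \<beta>' (\<lambda>i. \<phi> (v i))"
    and v: "\<And>i. i < k + l \<Longrightarrow> v i \<in> V"
  shows "wedge k l \<alpha> \<beta> v = wedge k l \<alpha>' \<beta>' (\<lambda>i. \<phi> (v i))"
proof -
  have "of_int (sign \<sigma>) * \<alpha> (\<lambda>i. v (\<sigma> i)) * \<beta> (\<lambda>i. v (\<sigma> (k + i))) =
      of_int (sign \<sigma>) * \<alpha>' (\<lambda>i. \<phi> (v (\<sigma> i))) * \<beta>' (\<lambda>i. \<phi> (v (\<sigma> (k + i))))"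
    if p: "\<sigma> permutes {..<k + l}" for \<sigma>
  proof -
    have V: "v (\<sigma> i) \<in> V" if "i < k + l" for i using permutes_in_image[OF p, of i] v that by simp
    have "\<alpha> (\<lambda>i. v (\<sigma> i)) = \<alpha>' (\<lambda>i. \<phi> (v (\<sigma> i)))" by (rule assms(1)) (simp add: V)
    moreover have "\<beta> (\<lambda>i. v (\<sigma> (k + i))) = \<beta>' (\<lambda>i. \<phi> (v (\<sigma> (k + i))))" by (rule assms(2)) (simp add: V)
    ultimately show ?thesis by simp
  qed
  then have "(\<Sum>\<sigma> | \<sigma> permutes {..<k + l}. of_int (sign \<sigma>) * \<alpha> (\<lambda>i. v (\<sigma> i)) * \<beta> (\<lambda>i. v (\<sigma> (k + i)))) =
      (\<Sum>\<sigma> | \<sigma> permutes {..<k + l}. of_int (sign \<sigma>) * \<alpha>' (\<lambda>i. \<phi> (v (\<sigma> i))) * \<beta>' (\<lambda>i. \<phi> (v (\<sigma> (k + i)))))"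
    by (intro sum.cong) auto
  then show ?thesis unfolding wedge_def by (rule arg_cong)
qed

lemma wedge_power_transfer:
  assumes "\<And>x y. x \<in> V \<Longrightarrow> y \<in> V \<Longrightarrow> \<omega> x y = B (\<phi> x) (\<phi> y)" "\<And>i. i < 2 * k \<Longrightarrow> v i \<in> V"
  shows "wedge_power \<omega> k v = wedge_power B k (\<lambda>i. \<phi> (v i))"
  using assms(2)
proof (induction k arbitrary: v)
  case (Suc k)
  show ?case
    unfolding wedge_power.simps
    by (rule wedge_transfer[where V = V]) (use Suc assms(1) in auto)
qed simp

lemma wedge_power_cong:
  "(\<And>i. i < 2 * k \<Longrightarrow> v i = w i) \<Longrightarrow> wedge_power \<omega> k v = wedge_power \<omega> k w"
proof (induction k arbitrary: v w)
  case (Suc k)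
  show ?case
    unfolding wedge_power.simps
  proof (rule wedge_cong)
    show "wedge_power \<omega> k v = wedge_power \<omega> k w" if "\<And>i. i < 2 * k \<Longrightarrow> v i = w i" for v w
      using that by (rule Suc.IH)
    show "\<omega> (v 0) (v 1) = \<omega> (w 0) (w 1)"
      if "\<And>i :: nat. i < 2 \<Longrightarrow> v i = w i" for v w
      using that[of 0] that[of 1] by simp
    show "v i = w i" if "i < 2 * k + 2" for i using Suc.prems that by simp
  qed
qed simp

lemma alternating_form_wedge_power:
  assumes bil: "bilinear B"
    and \<phi>: "\<And>x y a b. \<phi> (tscale a x + tscale b y) = a *\<^sub>R \<phi> x + b *\<^sub>R \<phi> y"
    and V: "\<And>x y a b. x \<in> V \<Longrightarrow> y \<in> V \<Longrightarrow> tscale a x + tscale b y \<in> V"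
    and \<omega>: "\<And>x y. x \<in> V \<Longrightarrow> y \<in> V \<Longrightarrow> \<omega> x y = B (\<phi> x) (\<phi> y)"
  shows "alternating_form V (2 * n) (\<lambda>v. wedge_power \<omega> n v / fact n)"
  unfolding alternating_form_def
proof (intro conjI allI impI ballI)
  note alt = wedge_power_alternating[OF bil, of n]
  have tr: "wedge_power \<omega> n v = wedge_power B n (\<lambda>i. \<phi> (v i))" if "\<And>i. i < 2 * n \<Longrightarrow> v i \<in> V" for v
    by (rule wedge_power_transfer[where V = V and B = B and \<phi> = \<phi>]) (simp_all add: \<omega> that)
  show "wedge_power \<omega> n v / fact n = wedge_power \<omega> n w / fact n" if "\<forall>i<2 * n. v i = w i" for v w
    using wedge_power_cong[of n v w \<omega>] that by simp
  show "wedge_power \<omega> n (v(i := tscale a x + tscale b y)) / fact n =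
      a * (wedge_power \<omega> n (v(i := x)) / fact n) + b * (wedge_power \<omega> n (v(i := y)) / fact n)"
    if v: "(\<forall>j<2 * n. v j \<in> V) \<and> i < 2 * n" and xy: "x \<in> V" "y \<in> V" for v i x y a b
  proof -
    let ?w = "\<lambda>j. \<phi> (v j)"
    have tr': "wedge_power \<omega> n (v(i := z)) = wedge_power B n (?w(i := \<phi> z))" if "z \<in> V" for z
    proof -
      have "wedge_power \<omega> n (v(i := z)) = wedge_power B n (\<lambda>j. \<phi> ((v(i := z)) j))"
        by (rule tr) (use v that in auto)
      also have "(\<lambda>j. \<phi> ((v(i := z)) j)) = ?w(i := \<phi> z)" by auto
      finally show ?thesis .
    qed
    have lin: "linear (\<lambda>z. wedge_power B n (?w(i := z)))"
      using multilinear_form_linear[OF alternating_multilinear[OF alt]] v by blast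
    show ?thesis
      by (simp add: tr' xy V \<phi> linear_add[OF lin] linear_cmul[OF lin] add_divide_distrib)
  qed
  show "wedge_power \<omega> n v / fact n = 0"
    if v: "(\<forall>k<2 * n. v k \<in> V) \<and> i < j \<and> j < 2 * n \<and> v i = v j" for v i j
  proof -
    have "wedge_power B n (\<lambda>i. \<phi> (v i)) = 0"
      by (rule alternating_eq_zero[OF alt, of i j]) (use v in auto)
    then show ?thesis using tr v by simp
  qed
qed

context smooth_atlas
begin

text \<open>The field is \<open>R = - J\<close>, written as a polynomial in \<open>J\<close> to inherit smoothness and integrability.\<close>

lemma calibrated_of_kaehler:
  assumes dim: "DIM('e) = 2 * n" and K: "kaehler_structure M A g J"
    and \<kappa>: "\<And>p u v. p \<in> topspace M \<Longrightarrow> u \<in> tangent_space A p \<Longrightarrow> v \<in> tangent_space A p \<Longrightarrow>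
      \<kappa> p u v = g p (J p u) v"
  shows "\<exists>R. endomorphism_field M A R \<and> calibrated M A n \<kappa> R \<and> nijenhuis_zero M A R"
proof -
  have g: "riemannian_metric M A g" and J: "endomorphism_field M A J"
    and J2: "\<And>p v. p \<in> topspace M \<Longrightarrow> v \<in> tangent_space A p \<Longrightarrow> J p (J p v) = - v"
    and NJ: "nijenhuis_zero M A J" and closed: "closed_two_form M A (\<lambda>p u v. g p (J p u) v)"
    using K by (auto simp: kaehler_structure_def)
  define R where "R = (\<lambda>p. tpoly [:0, - 1:] (J p))"
  have R: "endomorphism_field M A R" and NR: "nijenhuis_zero M A R"
    unfolding R_def by (rule endomorphism_field_tpoly[OF J], rule nijenhuis_zero_tpoly[OF J NJ])
  have JJ: "endo_rep c J x (endo_rep c J x v) = - v" if "c \<in> A" "x \<in> crange c" for c x v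
  proof -
    have p: "c \<in> charts_at A (cinv c x)" using that by simp
    note T = coord_vec_tangent[OF p] and pM = charts_at_topspace[OF p]
    show ?thesis
      using arg_cong[OF J2[OF pM T[of v]], of "\<lambda>u. u c"] that p
        endo_rep_component[OF J p endomorphism_tangent[OF J pM T]] endo_rep_component[OF J p T]
      by simp
  qed
  have JR: "J p (R p u) = u" if p: "p \<in> topspace M" and u: "u \<in> tangent_space A p" for p u
  proof -
    obtain c where c: "c \<in> charts_at A p" using charts_at_nonempty[OF p] by blast
    have cx: "c \<in> A" "cmap c p \<in> crange c" using charts_atD[OF c] by auto
    have lin: "linear (endo_rep c J (cmap c p))" by (rule smooth_endo_linear[OF smooth_endo_rep[OF J cx(1)] cx(2)])
    note Ru = endomorphism_tangent[OF R p u]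
    have "R p u c = - endo_rep c J (cmap c p) (u c)"
      unfolding R_def tpoly_component[OF J c u] by (simp add: opoly_pCons[OF lin] linear_0[OF lin] linear_neg[OF lin] linear_cmul[OF lin])
    then have "J p (R p u) c = u c"
      unfolding endo_rep_component[OF J c Ru] by (simp add: linear_neg[OF lin] JJ[OF cx])
    then show ?thesis by (rule tangent_eqI[OF c endomorphism_tangent[OF J p Ru] u])
  qed
  have gR: "\<kappa> p (R p u) v = g p u v"
    if "p \<in> topspace M" "u \<in> tangent_space A p" "v \<in> tangent_space A p" for p u v
    using that by (simp add: \<kappa> endomorphism_tangent[OF R] JR)
  have "riemannian_metric M A (\<lambda>p u v. \<kappa> p (R p u) v)"
    by (rule riemannian_metric_cong[OF _ g]) (simp add: gR)
  moreover have "is_volume_form (tangent_space A p) (2 * n) (\<lambda>u v. \<kappa> p (R p u) v)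
      (wedge_power (\<kappa> p) n) (\<lambda>v. wedge_power (\<kappa> p) n v / fact n)" if p: "p \<in> topspace M" for p
  proof -
    obtain c where c: "c \<in> charts_at A p" using charts_at_nonempty[OF p] by blast
    have cx: "c \<in> A" "cmap c p \<in> crange c" using charts_atD[OF c] by auto
    let ?G = "tensor_rep A c g (cmap c p)" and ?L = "endo_rep c J (cmap c p)"
    let ?B = "\<lambda>u v. ?G (?L u) v"
    have lin: "linear ?L" by (rule smooth_endo_linear[OF smooth_endo_rep[OF J cx(1)] cx(2)])
    interpret inner_form ?G by (rule inner_form_tensor_rep[OF g cx])
    have B: "\<kappa> p u v = ?B (u c) (v c)" if "u \<in> tangent_space A p" "v \<in> tangent_space A p" for u v
      using that p tensor_rep_component[OF c endomorphism_tangent[OF J p that(1)] that(2), of g]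
      by (simp add: \<kappa> endo_rep_component[OF J c])
    have bil: "bilinear ?B" using lin by (auto simp: bilinear_def linear_iff)
    have skew: "?G (?L u) v = - ?G u (?L v)" for u v
    proof -
      have "two_form M A (\<lambda>p u v. g p (J p u) v)" using closed by (simp add: closed_two_form_def)
      from two_form_rep_skew[OF this cx, of u v] have "?G (?L u) v = - ?G (?L v) u"
        by (simp add: tensor_rep_endomorphism[OF J cx])
      then show ?thesis using sym by simp
    qed
    have alt: "alternating_form (tangent_space A p) (2 * n) (\<lambda>v. wedge_power (\<kappa> p) n v / fact n)"
      by (rule alternating_form_wedge_power[OF bil, where \<phi> = "\<lambda>v. v c"])
        (auto simp: tangent_combination B)
    have "wedge_power (\<kappa> p) n v / fact n = 1"
      if v: "\<forall>i<2 * n. v i \<in> tangent_space A p"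
        and on: "\<forall>i<2 * n. \<forall>j<2 * n. \<kappa> p (R p (v i)) (v j) = (if i = j then 1 else 0)"
        and positive: "wedge_power (\<kappa> p) n v > 0" for v
    proof -
      have "orthonormal (2 * n) (\<lambda>i. v i c)"
        unfolding orthonormal_def using v on by (simp add: gR[OF p] tensor_rep_component[OF c, symmetric])
      from wedge_power_orthonormal[OF lin JJ[OF cx] skew dim this]
      have "\<bar>wedge_power ?B n (\<lambda>i. v i c)\<bar> = fact n" .
      moreover have "wedge_power (\<kappa> p) n v = wedge_power ?B n (\<lambda>i. v i c)"
        by (rule wedge_power_transfer[where V = "tangent_space A p"]) (use v B in auto)
      ultimately show ?thesis using positive by simp
    qed
    with alt show ?thesis unfolding is_volume_form_def by blast
  qed
  ultimately have "calibrated M A n \<kappa> R" by (simp add: calibrated_def)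
  with R NR show ?thesis by blast
qed

section \<open>From a calibrated field to a Kaehler structure\<close>

context
  fixes \<kappa> R
  assumes conn: "connected_space M"
    and closed: "closed_two_form M A \<kappa>"
    and R: "endomorphism_field M A R"
    and metric: "riemannian_metric M A (\<lambda>p u v. \<kappa> p (R p u) v)"
    and NR: "nijenhuis_zero M A R"
begin

text \<open>The metric \<open>\<kappa>(R \<cdot>, \<cdot>)\<close> in the chart \<open>c\<close> at the point with coordinates \<open>x\<close>.\<close>

definition metric_rep :: "('a, 'e) chart \<Rightarrow> 'e \<Rightarrow> 'e \<Rightarrow> 'e \<Rightarrow> real" where
  "metric_rep c x u v = tensor_rep A c \<kappa> x (endo_rep c R x u) v"

lemma kappa_two_form: "two_form M A \<kappa>" and kappa_smooth: "smooth_two_tensor M A \<kappa>"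
  using closed unfolding closed_two_form_def two_form_def by blast+

lemma linear_rep: "c \<in> A \<Longrightarrow> x \<in> crange c \<Longrightarrow> linear (endo_rep c R x)"
  by (rule smooth_endo_linear[OF smooth_endo_rep[OF R]])

lemma inner_form_metric_rep:
  assumes "c \<in> A" "x \<in> crange c"
  shows "inner_form (metric_rep c x)"
proof -
  have "metric_rep c x = tensor_rep A c (\<lambda>p u v. \<kappa> p (R p u) v) x"
    by (intro ext) (simp add: metric_rep_def tensor_rep_endomorphism[OF R assms])
  then show ?thesis using inner_form_tensor_rep[OF metric assms] by simp
qed

text \<open>\<open>g(R u, v) = g(v, R u) = \<kappa>(R v, R u)\<close>, and this is skew in \<open>u\<close> and \<open>v\<close>.\<close>

lemma metric_rep_skew:
  assumes "c \<in> A" "x \<in> crange c"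
  shows "metric_rep c x (endo_rep c R x u) v = - metric_rep c x u (endo_rep c R x v)"
proof -
  interpret inner_form "metric_rep c x" by (rule inner_form_metric_rep[OF assms])
  have "metric_rep c x u (endo_rep c R x v) = - metric_rep c x v (endo_rep c R x u)"
    unfolding metric_rep_def by (rule two_form_rep_skew[OF kappa_two_form assms])
  then show ?thesis using sym by simp
qed

text \<open>The positive self-adjoint field \<open>- R\<^sup>2\<close>. Polynomials in it are, by composition, polynomials in \<open>R\<close>.\<close>

definition neg_square :: "('a, 'e) chart \<Rightarrow> 'e \<Rightarrow> 'e \<Rightarrow> 'e" where
  "neg_square c x = opoly [:0, 0, - 1:] (endo_rep c R x)"

lemma neg_square_eq:
  assumes "c \<in> A" "x \<in> crange c"
  shows "neg_square c x v = - endo_rep c R x (endo_rep c R x v)"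
  using linear_rep[OF assms]
  by (simp add: neg_square_def opoly_pCons linear_0 linear_neg linear_cmul)

lemma neg_square_linear: "c \<in> A \<Longrightarrow> x \<in> crange c \<Longrightarrow> linear (neg_square c x)"
  unfolding neg_square_def by (intro linear_opoly linear_rep)

lemma neg_square_selfadjoint:
  assumes "c \<in> A" "x \<in> crange c"
  shows "metric_rep c x (neg_square c x u) v = metric_rep c x u (neg_square c x v)"
proof -
  interpret inner_form "metric_rep c x" by (rule inner_form_metric_rep[OF assms])
  show ?thesis by (simp add: neg_square_eq[OF assms] metric_rep_skew[OF assms])
qed

lemma neg_square_positive:
  assumes "c \<in> A" "x \<in> crange c" "u \<noteq> 0"
  shows "metric_rep c x (neg_square c x u) u > 0"
proof -
  interpret inner_form "metric_rep c x" by (rule inner_form_metric_rep[OF assms(1,2)])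
  have "metric_rep c x u u > 0" by (rule pos[OF assms(3)])
  then have "endo_rep c R x u \<noteq> 0"
    using bilinear_lzero[OF tensor_rep_bilinear[OF kappa_smooth assms(1,2)]] by (auto simp: metric_rep_def)
  then show ?thesis
    using pos by (simp add: neg_square_eq[OF assms(1,2)] metric_rep_skew[OF assms(1,2), of "endo_rep c R x u"])
qed

lemma opoly_neg_square_selfadjoint:
  assumes "c \<in> A" "x \<in> crange c"
  shows "metric_rep c x (opoly q (neg_square c x) u) v = metric_rep c x u (opoly q (neg_square c x) v)"
  by (rule opoly_adjoint[OF inner_form.bilin[OF inner_form_metric_rep[OF assms]]
        neg_square_linear[OF assms], OF neg_square_selfadjoint[OF assms]])

lemma odd_trace_zero:
  assumes "c \<in> A" "x \<in> crange c" "odd k"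
  shows "endo_trace (endo_rep c R x ^^ k) = 0"
proof (rule inner_form.endo_trace_skew[OF inner_form_metric_rep[OF assms(1,2)]])
  interpret inner_form "metric_rep c x" by (rule inner_form_metric_rep[OF assms(1,2)])
  show "linear (endo_rep c R x ^^ k)" by (rule linear_funpow[OF linear_rep[OF assms(1,2)]])
  have "metric_rep c x ((endo_rep c R x ^^ i) u) v = (- 1) ^ i * metric_rep c x u ((endo_rep c R x ^^ i) v)"
    for i u v
  proof (induction i arbitrary: u v)
    case (Suc i)
    then show ?case by (simp add: metric_rep_skew[OF assms(1,2)] funpow_swap1)
  qed simp
  then show "metric_rep c x ((endo_rep c R x ^^ k) u) v = - metric_rep c x u ((endo_rep c R x ^^ k) v)" for u v
    using assms(3) by simp
qed

lemma trace_power_constant: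
  assumes c: "c \<in> A" and ball: "ball x0 r \<subseteq> crange c" and x: "x \<in> ball x0 r" "y \<in> ball x0 r"
  shows "endo_trace (endo_rep c R x ^^ k) = endo_trace (endo_rep c R y ^^ k)"
proof -
  have "((\<lambda>y. endo_trace (endo_rep c R y ^^ k)) has_derivative (\<lambda>u. 0)) (at z)" if "z \<in> crange c" for z
    by (rule endo_trace_power_deriv_zero[OF open_crange[OF c] smooth_endo_rep[OF R c] _ _ that])
      (use NR c odd_trace_zero[OF c] in \<open>auto simp: nijenhuis_zero_iff[OF R]\<close>)
  then have "((\<lambda>y. endo_trace (endo_rep c R y ^^ k)) has_derivative (\<lambda>u. 0)) (at z within ball x0 r)"
    if "z \<in> ball x0 r" for z using that ball has_derivative_at_withinI by blast
  from has_derivative_zero_unique[OF convex_ball this x(1) x(2)] show ?thesis by simp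
qed

text \<open>The trace of \<open>f(R)\<^sup>2\<close> is constant on the ball and zero at \<open>x\<close>. As a polynomial in \<open>- R\<^sup>2\<close>, \<open>f(R)\<close> is
self-adjoint, so it vanishes wherever its square has trace zero.\<close>

lemma annihilating_polynomial_locally_constant:
  assumes c: "c \<in> A" and ball: "ball x0 r \<subseteq> crange c" and x: "x \<in> ball x0 r" "y \<in> ball x0 r"
    and f: "f = pcompose F [:0, 0, - 1:]" and zero: "\<And>v. opoly f (endo_rep c R x) v = 0"
  shows "opoly f (endo_rep c R y) v = 0"
proof -
  have xy: "x \<in> crange c" "y \<in> crange c" using ball x by auto
  have "opoly f (endo_rep c R y) = opoly F (neg_square c y)"
    by (rule ext) (simp add: f neg_square_def opoly_pcompose linear_rep[OF c xy(2)])
  then have selfadjoint: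
    "metric_rep c y (opoly f (endo_rep c R y) u) v = metric_rep c y u (opoly f (endo_rep c R y) v)" for u v
    using opoly_neg_square_selfadjoint[OF c xy(2)] by simp
  have "opoly (f * f) (endo_rep c R z) v = opoly f (endo_rep c R z) (opoly f (endo_rep c R z) v)"
    if "z \<in> crange c" for z v by (rule opoly_mult[OF linear_rep[OF c that]])
  then have sq: "(\<lambda>v. opoly f (endo_rep c R z) (opoly f (endo_rep c R z) v)) = opoly (f * f) (endo_rep c R z)"
    if "z \<in> crange c" for z using that by auto
  have "endo_trace (opoly (f * f) (endo_rep c R y)) = endo_trace (opoly (f * f) (endo_rep c R x))"
    unfolding endo_trace_opoly using trace_power_constant[OF c ball x] by simp
  also have "\<dots> = 0" unfolding sq[OF xy(1), symmetric] zero by (simp add: endo_trace_def)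
  finally have "endo_trace (\<lambda>v. opoly f (endo_rep c R y) (opoly f (endo_rep c R y) v)) = 0"
    by (simp only: sq[OF xy(2)])
  then show ?thesis
    by (rule inner_form.selfadjoint_zeroI[OF inner_form_metric_rep[OF c xy(2)]
          linear_opoly[where q = f, OF linear_rep[OF c xy(2)]], OF selfadjoint])
qed

lemma annihilated_iff:
  assumes c: "c \<in> charts_at A p"
  shows "(\<forall>v\<in>tangent_space A p. tpoly f (R p) v = 0) \<longleftrightarrow> (\<forall>w. opoly f (endo_rep c R (cmap c p)) w = 0)"
proof (intro iffI allI ballI)
  fix w assume "\<forall>v\<in>tangent_space A p. tpoly f (R p) v = 0"
  then have "tpoly f (R p) (coord_vec A c p w) c = 0" using coord_vec_tangent[OF c] by simp
  then show "opoly f (endo_rep c R (cmap c p)) w = 0"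
    using tpoly_component[OF R c coord_vec_tangent[OF c]] c by simp
next
  fix v assume *: "\<forall>w. opoly f (endo_rep c R (cmap c p)) w = 0" and v: "v \<in> tangent_space A p"
  show "tpoly f (R p) v = 0"
    by (rule tangent_eqI[OF c tpoly_tangent[OF R charts_at_topspace[OF c] v] tangent_zero])
      (simp add: tpoly_component[OF R c v] *)
qed

text \<open>The condition on a point is local in both directions, so it holds on an open and closed set.\<close>

lemma annihilating_polynomial_constant:
  assumes p: "p \<in> topspace M" and q: "q \<in> topspace M" and f: "f = pcompose F [:0, 0, - 1:]"
    and zero: "\<forall>v\<in>tangent_space A p. tpoly f (R p) v = 0"
  shows "\<forall>v\<in>tangent_space A q. tpoly f (R q) v = 0"
proof -
  let ?Z = "\<lambda>p. \<forall>v\<in>tangent_space A p. tpoly f (R p) v = 0"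
  have nbhd: "\<exists>N. openin M N \<and> a \<in> N \<and> (\<forall>b\<in>N. ?Z b \<longleftrightarrow> ?Z a)" if a: "a \<in> topspace M" for a
  proof -
    obtain c where c: "c \<in> charts_at A a" using charts_at_nonempty[OF a] by blast
    note cA = charts_atD(1)[OF c]
    obtain r where r: "r > 0" "ball (cmap c a) r \<subseteq> crange c"
      using open_crange[OF cA] charts_atD(2)[OF c] by (meson cmap_in_crange openE)
    let ?N = "{b \<in> cdom c. cmap c b \<in> ball (cmap c a) r}"
    have "?Z b \<longleftrightarrow> ?Z a" if b: "b \<in> ?N" for b
    proof -
      have cb: "c \<in> charts_at A b" using cA b by (simp add: charts_at_def)
      have in_ball: "cmap c a \<in> ball (cmap c a) r" "cmap c b \<in> ball (cmap c a) r" using r(1) b by auto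
      show ?thesis
        unfolding annihilated_iff[OF c] annihilated_iff[OF cb]
        using annihilating_polynomial_locally_constant[OF cA r(2) in_ball f]
          annihilating_polynomial_locally_constant[OF cA r(2) in_ball(2,1) f] by blast
    qed
    moreover have "a \<in> ?N" using charts_atD[OF c] r(1) by simp
    moreover have "openin M ?N" by (rule openin_chart_preimage[OF cA open_ball])
    ultimately show ?thesis by blast
  qed
  have locally_constant: "openin M {a \<in> topspace M. Q (?Z a)}" for Q
  proof (subst openin_subopen, intro ballI)
    fix a assume a: "a \<in> {a \<in> topspace M. Q (?Z a)}"
    then obtain N where N: "openin M N" "a \<in> N" "\<forall>b\<in>N. ?Z b \<longleftrightarrow> ?Z a" using nbhd by blast
    have "N \<subseteq> {a \<in> topspace M. Q (?Z a)}"
    proof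
      fix b assume b: "b \<in> N"
      then have "?Z b = ?Z a" using N(3) by blast
      then show "b \<in> {a \<in> topspace M. Q (?Z a)}"
        using a b openin_subset[OF N(1)] by (simp only: mem_Collect_eq) blast
    qed
    with N show "\<exists>T. openin M T \<and> a \<in> T \<and> T \<subseteq> {a \<in> topspace M. Q (?Z a)}" by blast
  qed
  let ?E = "{a \<in> topspace M. ?Z a}"
  have "openin M ?E" by (rule locally_constant[of "\<lambda>P. P"])
  moreover have "topspace M - ?E = {a \<in> topspace M. \<not> ?Z a}" by blast
  then have "openin M (topspace M - ?E)" using locally_constant[of Not] by (simp only:)
  then have "closedin M ?E" unfolding closedin_def by auto
  ultimately have "?E = {} \<or> ?E = topspace M" using conn connected_space_clopen_in by blast
  then show ?thesis using p q zero by blast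
qed

lemma inverse_fourth_root_exists:
  "\<exists>h. \<forall>c\<in>A. \<forall>x\<in>crange c. \<forall>v. opoly ([:0, 1:] * h ^ 4 - 1) (neg_square c x) v = 0"
\<comment> \<open>On the empty manifold there is no point at which to choose \<open>h\<close>, but there is nothing to prove.\<close>
proof (cases "topspace M = {}")
  case True
  then have "crange c = {}" if "c \<in> A" for c using cdom_subset[OF that] by (simp add: crange_def)
  then show ?thesis by blast
next
  case False
  then obtain p where p: "p \<in> topspace M" by blast
  then obtain c where c: "c \<in> charts_at A p" using charts_at_nonempty by blast
  have cx: "c \<in> A" "cmap c p \<in> crange c" using charts_atD[OF c] by auto
  obtain h where h: "\<forall>v. opoly ([:0, 1:] * h ^ 4 - 1) (neg_square c (cmap c p)) v = 0"
    using inner_form.inverse_fourth_root_polynomial[OF inner_form_metric_rep[OF cx] neg_square_linear[OF cx],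
        OF neg_square_selfadjoint[OF cx] neg_square_positive[OF cx]] by blast
  define f where "f = pcompose ([:0, 1:] * h ^ 4 - 1) [:0, 0, - 1:]"
  have f_eq: "opoly f (endo_rep d R x) v = opoly ([:0, 1:] * h ^ 4 - 1) (neg_square d x) v"
    if "d \<in> A" "x \<in> crange d" for d x v
    unfolding f_def neg_square_def by (rule opoly_pcompose[OF linear_rep[OF that]])
  have zero: "\<forall>v\<in>tangent_space A p. tpoly f (R p) v = 0"
    unfolding annihilated_iff[OF c] using h f_eq[OF cx] by simp
  have "opoly ([:0, 1:] * h ^ 4 - 1) (neg_square d x) v = 0" if d: "d \<in> A" and x: "x \<in> crange d" for d x v
  proof -
    have q: "d \<in> charts_at A (cinv d x)" using d x by simp
    from annihilating_polynomial_constant[OF p charts_at_topspace[OF q] f_def zero]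
    show ?thesis unfolding annihilated_iff[OF q] using f_eq[OF d x] d x by simp
  qed
  then show ?thesis by blast
qed

text \<open>With \<open>S = - R\<^sup>2\<close> and \<open>S h(S)\<^sup>4 = 1\<close> everywhere, put \<open>E = R h(S)\<^sup>2\<close> and \<open>J = - E\<close>; then
\<open>E\<^sup>2 = - S h(S)\<^sup>4 = -1\<close>. The metric is \<open>\<kappa>(E \<cdot>, \<cdot>)\<close>, so that inserting \<open>J\<close> gives back \<open>\<kappa>\<close>.\<close>

lemma kaehler_of_calibrated:
  "\<exists>g J. kaehler_structure M A g J \<and>
    (\<forall>p\<in>topspace M. \<forall>u\<in>tangent_space A p. \<forall>v\<in>tangent_space A p. \<kappa> p u v = g p (J p u) v)"
proof -
  obtain h where h: "\<And>c x v. c \<in> A \<Longrightarrow> x \<in> crange c \<Longrightarrow> opoly ([:0, 1:] * h ^ 4 - 1) (neg_square c x) v = 0"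
    using inverse_fourth_root_exists by blast
  define H where "H = pcompose h [:0, 0, - 1:]"
  define e where "e = [:0, 1:] * (H * H)"
  define E where "E = (\<lambda>p. tpoly e (R p))"
  define J where "J = (\<lambda>p. tpoly (- e) (R p))"
  define g where "g = (\<lambda>p u v. \<kappa> p (E p u) v)"
  have E: "endomorphism_field M A E" and J: "endomorphism_field M A J"
    unfolding E_def J_def by (rule endomorphism_field_tpoly[OF R])+
  have NJ: "nijenhuis_zero M A J" unfolding J_def by (rule nijenhuis_zero_tpoly[OF R NR])
  have chart_identities: "opoly e L v = L (T (T v))" "opoly (- e) L v = - opoly e L v" "opoly e L (opoly e L v) = - v"
    "T v = 0 \<Longrightarrow> v = 0"
    if cx: "c \<in> A" "x \<in> crange c" and L: "L = endo_rep c R x" and T: "T = opoly h (neg_square c x)" for c x L T v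
  proof -
    have lin: "linear L" unfolding L by (rule linear_rep[OF cx])
    have TH: "T v = opoly H L v" for v unfolding T H_def L neg_square_def opoly_pcompose[OF linear_rep[OF cx]] ..
    have linT: "linear T" unfolding T by (rule linear_opoly[OF neg_square_linear[OF cx]])
    have comm: "T (L v) = L (T v)" for v unfolding TH by (rule opoly_commute[OF lin])
    show e: "opoly e L v = L (T (T v))" for v
      unfolding e_def by (simp add: opoly_mult[OF lin] opoly_pCons[OF lin] linear_0[OF lin] TH)
    show "opoly (- e) L v = - opoly e L v"
      using opoly_smult[OF lin, of "- 1" e v] by simp
    have root: "- L (L (T (T (T (T w))))) = w" for w
    proof -
      have "opoly (h ^ 4) (neg_square c x) w = T (T (T (T w)))"
        by (simp add: power4_eq_xxxx opoly_mult[OF neg_square_linear[OF cx]] T)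
      then show ?thesis
        using h[OF cx, of w]
        by (simp add: opoly_diff[OF neg_square_linear[OF cx]] opoly_mult[OF neg_square_linear[OF cx]]
            opoly_pCons[OF neg_square_linear[OF cx]] linear_0[OF neg_square_linear[OF cx]]
            linear_0[OF linear_rep[OF cx]] neg_square_eq[OF cx] L
            del: mult_pCons_left)
    qed
    show "opoly e L (opoly e L v) = - v"
      using root[of v] by (simp add: e comm) (metis minus_minus)
    show "v = 0" if "T v = 0"
      using root[of v] that linear_0[OF linT] linear_0[OF lin] by simp
  qed
  have EJ: "E p (J p u) = u" and JJ: "J p (J p u) = - u"
    if p: "p \<in> topspace M" and u: "u \<in> tangent_space A p" for p u
  proof -
    obtain c where c: "c \<in> charts_at A p" using charts_at_nonempty[OF p] by blast
    have cx: "c \<in> A" "cmap c p \<in> crange c" using charts_atD[OF c] by auto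
    let ?L = "endo_rep c R (cmap c p)"
    have lin: "linear (opoly e ?L)" by (rule linear_opoly[OF linear_rep[OF cx]])
    note Ju = endomorphism_tangent[OF J p u]
    have comp: "J p w c = - opoly e ?L (w c)" "E p w c = opoly e ?L (w c)" if "w \<in> tangent_space A p" for w
      using tpoly_component[OF R c that] chart_identities(2)[OF cx refl refl] by (simp_all add: J_def E_def)
    have "E p (J p u) c = u c" "J p (J p u) c = (- u) c"
      by (simp_all add: comp u Ju linear_neg[OF lin] chart_identities(3)[OF cx refl refl])
    then show "E p (J p u) = u" "J p (J p u) = - u"
      using tangent_eqI[OF c endomorphism_tangent[OF E p Ju] u]
        tangent_eqI[OF c endomorphism_tangent[OF J p Ju] tangent_minus[OF u]] by auto
  qed
  have g_rep: "g p u v = metric_rep c (cmap c p) (opoly h (neg_square c (cmap c p)) (u c))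
      (opoly h (neg_square c (cmap c p)) (v c))"
    if c: "c \<in> charts_at A p" and u: "u \<in> tangent_space A p" and v: "v \<in> tangent_space A p" for p u v c
  proof -
    have cx: "c \<in> A" "cmap c p \<in> crange c" using charts_atD[OF c] by auto
    note pM = charts_at_topspace[OF c]
    have "g p u v = tensor_rep A c \<kappa> (cmap c p) (opoly e (endo_rep c R (cmap c p)) (u c)) (v c)"
      unfolding g_def using tensor_rep_component[OF c endomorphism_tangent[OF E pM u] v, of \<kappa>]
        tpoly_component[OF R c u] by (simp add: E_def)
    also have "\<dots> = metric_rep c (cmap c p) (opoly h (neg_square c (cmap c p))
        (opoly h (neg_square c (cmap c p)) (u c))) (v c)"
      unfolding chart_identities(1)[OF cx refl refl] metric_rep_def ..
    finally show ?thesis by (simp only: opoly_neg_square_selfadjoint[OF cx])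
  qed
  have "riemannian_metric M A g"
    unfolding riemannian_metric_def
  proof (intro conjI ballI impI)
    show "smooth_two_tensor M A g" unfolding g_def by (rule smooth_two_tensor_endomorphism[OF kappa_smooth E])
    fix p u v assume p: "p \<in> topspace M" and u: "u \<in> tangent_space A p"
    obtain c where c: "c \<in> charts_at A p" using charts_at_nonempty[OF p] by blast
    have cx: "c \<in> A" "cmap c p \<in> crange c" using charts_atD[OF c] by auto
    interpret inner_form "metric_rep c (cmap c p)" by (rule inner_form_metric_rep[OF cx])
    show "g p u v = g p v u" if "v \<in> tangent_space A p"
      unfolding g_rep[OF c u that] g_rep[OF c that u] by (rule sym)
    show "g p u u > 0" if "u \<noteq> 0"
      unfolding g_rep[OF c u u]
      using chart_identities(4)[OF cx refl refl, of "u c"] tangent_nonzero_component[OF c u that] by (intro pos) blast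
  qed
  moreover have eq: "\<kappa> p u v = g p (J p u) v"
    if "p \<in> topspace M" "u \<in> tangent_space A p" "v \<in> tangent_space A p" for p u v
    using that by (simp add: g_def EJ)
  moreover have "closed_two_form M A (\<lambda>p u v. g p (J p u) v)"
    by (rule closed_two_form_cong[OF _ closed]) (rule eq)
  ultimately have "kaehler_structure M A g J"
    using J NJ JJ by (simp add: kaehler_structure_def)
  with eq show ?thesis by blast
qed

end

end

theorem corollary5p4:
  fixes M :: "'a topology"
    and A :: "('a, 'e::euclidean_space) chart set"
    and \<kappa> :: "('a, 'e) two_tensor"
    and n :: nat
  assumes "smooth_manifold M A"
    and "connected_space M"
    and "DIM('e) = 2 * n"
    and "symplectic_form M A \<kappa>"
  shows "(\<exists>g J. kaehler_structure M A g J \<and>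
            (\<forall>p\<in>topspace M. \<forall>u\<in>tangent_space A p. \<forall>v\<in>tangent_space A p.
               \<kappa> p u v = g p (J p u) v))
     \<longleftrightarrow> (\<exists>R. endomorphism_field M A R \<and> calibrated M A n \<kappa> R \<and> nijenhuis_zero M A R)"
proof -
  interpret smooth_atlas M A by unfold_locales (rule assms(1))
  have closed: "closed_two_form M A \<kappa>" using assms(4) by (simp add: symplectic_form_def)
  show ?thesis
  proof
    assume "\<exists>g J. kaehler_structure M A g J \<and>
            (\<forall>p\<in>topspace M. \<forall>u\<in>tangent_space A p. \<forall>v\<in>tangent_space A p. \<kappa> p u v = g p (J p u) v)"
    then obtain g J where "kaehler_structure M A g J"
      "\<And>p u v. p \<in> topspace M \<Longrightarrow> u \<in> tangent_space A p \<Longrightarrow> v \<in> tangent_space A p \<Longrightarrow> \<kappa> p u v = g p (J p u) v"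
      by blast
    from calibrated_of_kaehler[OF assms(3) this]
    show "\<exists>R. endomorphism_field M A R \<and> calibrated M A n \<kappa> R \<and> nijenhuis_zero M A R" .
  next
    assume "\<exists>R. endomorphism_field M A R \<and> calibrated M A n \<kappa> R \<and> nijenhuis_zero M A R"
    then obtain R where "endomorphism_field M A R" "riemannian_metric M A (\<lambda>p u v. \<kappa> p (R p u) v)"
      "nijenhuis_zero M A R" by (auto simp: calibrated_def)
    from kaehler_of_calibrated[OF assms(2) closed this]
    show "\<exists>g J. kaehler_structure M A g J \<and>
            (\<forall>p\<in>topspace M. \<forall>u\<in>tangent_space A p. \<forall>v\<in>tangent_space A p. \<kappa> p u v = g p (J p u) v)" .
  qed
qed

end
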